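(* As $n\to\infty$, \[ \frac{\log 2\,\log n}{n}\cdot\mathsf M'_n\overset{\mathcal L(\lambda)}{\Longrightarrow}\Theta, \] where $\Theta$ is a positive random variable with $\Pr[\Theta\le y]=e^{-1/y}$ for $y>0$.
   Context: $I=(0,1]$, $\lambda$ is Lebesgue measure on $I$, $\mathsf a_n(x)$ denotes the $n$-th continued fraction digit of $x\in I$. $\mathbb P$ is the set of primes; $\mathsf a'_n(x):=\mathsf a_n(x)$ if $\mathsf a_n(x)\in\mathbb P$ and $0$ otherwise; $\mathsf M'_n:=\max_{1\le k\le n}\mathsf a'_k$. Strong distributional convergence $R_n\overset{\mathcal L(\lambda)}{\Longrightarrow}R$ means that for every probability measure $P\ll\lambda$ on $I$ the distributions $P\circ R_n^{-1}$ converge weakly to the law of $R$. *)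

theory Defs
  imports "HOL-Probability.Probability" "HOL-Computational_Algebra.Primes"
begin

definition unit_I :: "real set" where "unit_I = {0<..1}"

definition lambda_I :: "real measure" where
  "lambda_I = restrict_space lborel unit_I"

text \<open>Gauss map T x = 1/x - floor(1/x); with 1/0 = 0 it maps 0 to 0.\<close>
definition gauss_map :: "real \<Rightarrow> real" where
  "gauss_map x = frac (1 / x)"

text \<open>n-th continued fraction digit (n \<ge> 1): a_n(x) = floor(1 / T^(n-1) x).
  For rational x, digits beyond the expansion length are 0 (a null set).\<close>
definition cf_digit :: "nat \<Rightarrow> real \<Rightarrow> nat" where
  "cf_digit n x = nat \<lfloor>1 / (gauss_map ^^ (n - 1)) x\<rfloor>"

definition cf_digit_prime :: "nat \<Rightarrow> real \<Rightarrow> nat" where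
  "cf_digit_prime n x = (if prime (cf_digit n x) then cf_digit n x else 0)"

definition max_prime_digit :: "nat \<Rightarrow> real \<Rightarrow> nat" where
  "max_prime_digit n x = Max {cf_digit_prime k x | k. 1 \<le> k \<and> k \<le> n}"

definition strong_dist_conv :: "(nat \<Rightarrow> real \<Rightarrow> real) \<Rightarrow> real measure \<Rightarrow> bool" where
  "strong_dist_conv R Q \<longleftrightarrow>
     (\<forall>P. prob_space P \<and> sets P = sets lambda_I \<and> absolutely_continuous lambda_I P \<longrightarrow>
          weak_conv_m (\<lambda>n. distr P borel (R n)) Q)"

end

theory Submission
  imports Defs "HOL-Complex_Analysis.Complex_Analysis" "HOL-Real_Asymp.Real_Asymp"
begin

text \<open>
  The event \<open>M'_n \<le> L\<close> says that none of the first \<open>n\<close> digits is a prime above \<open>L\<close>. Integrating a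
  Lipschitz density (with respect to the Gauss measure) over this event amounts to integrating its \<open>n\<close>-th image
  under the Perron-Frobenius operator \<open>U\<close> of the Gauss map with the branches indexed by primes above \<open>L\<close>
  deleted. As \<open>U\<close> contracts Lipschitz constants by 11/12 and the deleted part is of size \<open>\<sigma> = \<Sum>_{p > L} 1/p^2\<close>,
  all these images are constant up to \<open>O(\<sigma>)\<close>; hence each step multiplies the integral by \<open>1 - e\<close> up
  to \<open>O(\<sigma>^2)\<close>, where \<open>e \<sim> \<sigma> / ln 2\<close> is the Gauss measure of the deleted branches, and the probability
  tends to \<open>exp (- lim n e)\<close>. Lipschitz densities are dense in \<open>L^1\<close>, which covers all \<open>P \<lless> \<lambda>\<close>.

  With the given normalisation the limit is the stated one iff \<open>\<Sum>_{p > x} 1/p^2 \<sim> 1/(x ln x)\<close>, which is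
  equivalent to the prime number theorem. It is obtained in the manner of Wiener and Ikehara: since
  \<open>\<zeta>(1 + i t) \<noteq> 0\<close>, the series \<open>\<Sum>_p ln p / p^s - 1/(s - 1)\<close> extends continuously to \<open>Re s \<ge> 1\<close>, so by the
  Riemann-Lebesgue lemma the measures \<open>\<Sum>_p (ln p / p) \<delta>_{ln p - ln x}\<close>, weighted by a kernel with compactly
  supported Fourier transform, have convergent characteristic functions. Levy's continuity theorem then allows
  testing against \<open>exp (-t)\<close> on \<open>t > 0\<close>.
\<close>

section \<open>The zeta function near the line Re s = 1\<close>

text \<open>The deleted branches enter only through \<open>x * ln x * prime_tail x\<close>, so no
  counting function of primes is formed: the test function exp (-t) on t > 0, read against the prime
  measure shifted by ln x, is already x times the sum of ln p / p^2 over p > x, up to damping. This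
  also replaces the monotonicity step of the usual Tauberian argument: exp (-t) decays faster than
  the kernel, so their quotient is bounded and has a single jump. The series exists only for Re s >
  1; tying the damping exponent to x by \<epsilon> ln x \<longrightarrow> 0 merges the limit towards
  the line with the limit in x. On the dynamical side the obstacle is the accumulation of errors
  over n steps: n \<sigma> stays bounded but does not vanish, so an error of order \<sigma> per step
  would spoil the limit, whereas order \<sigma>^2 is harmless. The sup norm gives only order
  \<sigma>; the second factor comes from the Lipschitz seminorm. Taking the invariant Gauss measure
  as reference makes U preserve constants and integrals, so that deleting branches is the only thing
  that moves the mean.\<close>

text \<open>Summing \<open>(s - 1) n^{-s} - (n^{1-s} - (n+1)^{1-s})\<close> over all \<open>n\<close> gives \<open>(s - 1) \<zeta>(s) - 1\<close>; the terms are
  \<open>O(n^{-Re s - 1})\<close>, so \<open>zeta_reg s = (s - 1) \<zeta>(s)\<close> is regular at 1 and beyond the line \<open>Re s = 1\<close>.\<close>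

definition zeta_term :: "nat \<Rightarrow> complex \<Rightarrow> complex" where
  "zeta_term n s = (s - 1) * of_nat (Suc n) powr (-s) - of_nat (Suc n) powr (1 - s)
     + of_nat (Suc (Suc n)) powr (1 - s)"

definition zeta_reg :: "complex \<Rightarrow> complex" where
  "zeta_reg s = 1 + (\<Sum>n. zeta_term n s)"

text \<open>With m = n + 1, the term is F (m + 1) - F m for F z = z^(1-s) - (1-s) z m^(-s). The
  derivative of F vanishes at m, so the mean value inequality, applied first to z^(-s) and then to
  F, gains the factor 1/m that makes the series converge to the left of Re s = 1.\<close>

lemma norm_zeta_term_le:
  assumes "Re s \<ge> 0"
  shows "norm (zeta_term n s) \<le> norm (s - 1) * norm s * real (Suc n) powr (- Re s - 1)"
proof -
  define m where "m = real (Suc n)"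
  have m: "m \<ge> 1" by (simp add: m_def)
  define S where "S = closed_segment (complex_of_real m) (complex_of_real (m + 1))"
  have S: "\<exists>x. z = complex_of_real x \<and> m \<le> x \<and> x \<le> m + 1" if "z \<in> S" for z
    using that unfolding S_def closed_segment_of_real
    by (auto simp: closed_segment_eq_real_ivl)
  have inS: "complex_of_real m \<in> S" "complex_of_real (m + 1) \<in> S"
    by (auto simp: S_def)
  have conv: "convex S" by (simp add: S_def)
  have pos: "z \<notin> \<real>\<^sub>\<le>\<^sub>0" if "z \<in> S" for z
    using S[OF that] m by (auto simp: complex_nonpos_Reals_iff)
  have d1: "norm (z powr (-s) - complex_of_real m powr (-s)) \<le> norm s * m powr (- Re s - 1) * 1"
    if z: "z \<in> S" for z
  proof -
    have "norm (z powr (-s) - complex_of_real m powr (-s)) \<le> (norm s * m powr (- Re s - 1)) * norm (z - complex_of_real m)"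
    proof (rule field_differentiable_bound[OF conv, where f' = "\<lambda>z. -s * z powr (-s - 1)"])
      fix w assume w: "w \<in> S"
      show "((\<lambda>z. z powr - s) has_field_derivative - s * w powr (- s - 1)) (at w within S)"
        using has_field_derivative_powr[OF pos[OF w]] by (rule has_field_derivative_at_within)
      obtain x where x: "w = complex_of_real x" "m \<le> x" using S[OF w] by blast
      have "norm (w powr (-s - 1)) = x powr (- Re s - 1)"
        using x m by (simp add: norm_powr_real_powr)
      also have "\<dots> \<le> m powr (- Re s - 1)"
        using x m assms by (intro powr_mono2') auto
      finally show "norm (- s * w powr (- s - 1)) \<le> norm s * m powr (- Re s - 1)"
        by (simp add: norm_mult mult_left_mono)
    qed (use z inS in auto)
    also have "\<dots> \<le> norm s * m powr (- Re s - 1) * 1"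
    proof (rule mult_left_mono)
      obtain x where x: "z = complex_of_real x" "m \<le> x" "x \<le> m + 1" using S[OF z] by blast
      thus "norm (z - complex_of_real m) \<le> 1"
        by (metis abs_of_nonneg diff_ge_0_iff_ge diff_le_eq add.commute norm_of_real of_real_diff)
    qed auto
    finally show ?thesis .
  qed
  have "norm ((\<lambda>z. z powr (1-s) - z * (1-s) * complex_of_real m powr (-s)) (complex_of_real (m + 1))
      - (\<lambda>z. z powr (1-s) - z * (1-s) * complex_of_real m powr (-s)) (complex_of_real m))
     \<le> (norm (s - 1) * (norm s * m powr (- Re s - 1))) * norm (complex_of_real (m + 1) - complex_of_real m)"
  proof (rule field_differentiable_bound[OF conv, 
        where f' = "\<lambda>z. (1-s) * (z powr (-s) - complex_of_real m powr (-s))"])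
    fix w assume w: "w \<in> S"
    show "((\<lambda>z. z powr (1-s) - z * (1-s) * complex_of_real m powr (-s)) has_field_derivative
        (1-s) * (w powr (-s) - complex_of_real m powr (-s))) (at w within S)"
      by (rule has_field_derivative_at_within, (rule derivative_eq_intros refl has_field_derivative_powr[OF pos[OF w]])+)
         (auto simp: algebra_simps)
    show "norm ((1-s) * (w powr (-s) - complex_of_real m powr (-s))) \<le> norm (s - 1) * (norm s * m powr (- Re s - 1))"
      using d1[OF w] by (simp add: norm_mult norm_minus_commute mult_left_mono)
  qed (use inS in auto)
  also have "(\<lambda>z. z powr (1-s) - z * (1-s) * complex_of_real m powr (-s)) (complex_of_real (m + 1))
      - (\<lambda>z. z powr (1-s) - z * (1-s) * complex_of_real m powr (-s)) (complex_of_real m) = zeta_term n s"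
    by (simp add: zeta_term_def m_def algebra_simps)
  finally show ?thesis by (simp add: m_def mult.assoc)
qed

text \<open>The abscissa 1/2 is a convenient choice: it puts the line Re s = 1 into the interior and
  makes n^(-3/2) a summable majorant.\<close>

lemma zeta_reg_holomorphic: "zeta_reg holomorphic_on {s. Re s > 1/2}"
proof -
  have "(\<lambda>s. \<Sum>n. zeta_term n s) holomorphic_on {s. Re s > 1/2}"
  proof (rule holomorphic_uniform_sequence)
    show "open {s. Re s > 1/2}" by (rule open_halfspace_Re_gt)
    show "(\<lambda>s. \<Sum>n<N. zeta_term n s) holomorphic_on {s. 1/2 < Re s}" for N
      unfolding zeta_term_def by (intro holomorphic_intros)
    fix x assume x: "x \<in> {s. Re s > 1/2}"
    then obtain d where d: "d > 0" "cball x d \<subseteq> {s. Re s > 1/2}"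
      using open_contains_cball[of "{s. Re s > 1/2}"] open_halfspace_Re_gt[of "1/2"] by blast
    define R where "R = norm x + d + 1"
    have "uniform_limit (cball x d) (\<lambda>N s. \<Sum>n<N. zeta_term n s) (\<lambda>s. \<Sum>n. zeta_term n s) sequentially"
    proof (rule Weierstrass_m_test)
      show "summable (\<lambda>n. R * R * real (Suc n) powr (-3/2))"
        by (subst summable_Suc_iff[of "\<lambda>n. R * R * real n powr (-3/2)"])
           (intro summable_mult, simp add: summable_real_powr_iff)
      fix n s assume s: "s \<in> cball x d"
      have "norm s \<le> norm x + d"
        using s norm_triangle_ineq2[of s x] by (auto simp: dist_norm norm_minus_commute)
      hence n: "norm s \<le> R" "norm (s - 1) \<le> R"
        using norm_triangle_ineq4[of s 1] by (auto simp: R_def)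
      have re: "Re s > 1/2" using s d by auto
      have "norm (zeta_term n s) \<le> norm (s - 1) * norm s * real (Suc n) powr (- Re s - 1)"
        by (rule norm_zeta_term_le) (use re in auto)
      also have "\<dots> \<le> R * R * real (Suc n) powr (-3/2)"
        using n re by (intro mult_mono powr_mono) (auto intro: order_trans[OF norm_ge_zero])
      finally show "norm (zeta_term n s) \<le> R * R * real (Suc n) powr (-3/2)" .
    qed
    with d show "\<exists>d>0. cball x d \<subseteq> {s. 1/2 < Re s} \<and>
       uniform_limit (cball x d) (\<lambda>N s. \<Sum>n<N. zeta_term n s) (\<lambda>s. \<Sum>n. zeta_term n s) sequentially"
      by blast
  qed
  thus ?thesis unfolding zeta_reg_def by (intro holomorphic_intros)
qed

lemma norm_nat_powr: "norm (of_nat n powr s :: complex) = real n powr Re s"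
  by (simp add: norm_powr_real_powr)

lemma abs_summable_on_nat_powr:
  assumes "Re s > 1"
  shows "(\<lambda>n. norm (of_nat n powr (-s) :: complex)) summable_on A"
proof -
  have "summable (\<lambda>n. norm (of_nat n powr (-s) :: complex))"
    using assms by (simp add: norm_nat_powr summable_real_powr_iff)
  hence "(\<lambda>n. norm (of_nat n powr (-s) :: complex)) summable_on UNIV"
    by (simp add: summable_on_UNIV_nonneg_real_iff)
  thus ?thesis by (rule summable_on_subset_banach) auto
qed

lemma zeta_reg_eq:
  assumes "Re s > 1"
  shows "zeta_reg s = (s - 1) * infsum (\<lambda>n. of_nat n powr (-s)) UNIV"
proof -
  have hs: "((\<lambda>n. of_nat n powr (-s)) has_sum infsum (\<lambda>n. of_nat n powr (-s) :: complex) UNIV) UNIV"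
    using abs_summable_summable[OF abs_summable_on_nat_powr[OF assms]] by (rule has_sum_infsum)
  hence "(\<lambda>n. of_nat n powr (-s)) sums infsum (\<lambda>n. of_nat n powr (-s) :: complex) UNIV"
    by (rule has_sum_imp_sums)
  \<comment> \<open>The index n = 0 may be dropped because \<open>0 powr z = 0\<close>; the sum over
    \<open>UNIV\<close> is therefore the usual zeta series.\<close>
  hence 1: "(\<lambda>n. of_nat (Suc n) powr (-s)) sums infsum (\<lambda>n. of_nat n powr (-s) :: complex) UNIV"
    by (subst sums_Suc_iff) auto
  have "(\<lambda>n. norm (of_nat (Suc n) powr (1-s) :: complex)) \<longlonglongrightarrow> 0"
    unfolding norm_nat_powr using assms by real_asymp
  hence "(\<lambda>n. of_nat (Suc n) powr (1-s) :: complex) \<longlonglongrightarrow> 0"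
    by (rule tendsto_norm_zero_cancel)
  from telescope_sums[OF this]
  have 2: "(\<lambda>n. of_nat (Suc (Suc n)) powr (1-s) - of_nat (Suc n) powr (1-s) :: complex) sums (0 - 1)"
    by simp
  have "zeta_term n s = (s - 1) * of_nat (Suc n) powr (-s) + (of_nat (Suc (Suc n)) powr (1-s) - of_nat (Suc n) powr (1-s))" for n
    by (simp add: zeta_term_def)
  hence "(\<lambda>n. zeta_term n s) sums ((s - 1) * infsum (\<lambda>n. of_nat n powr (-s)) UNIV + (0 - 1))"
    using sums_add[OF sums_mult[OF 1, of "s - 1"] 2] by simp
  thus ?thesis by (simp add: zeta_reg_def sums_iff)
qed

section \<open>Partial Euler products as a sieve\<close>

definition rough :: "nat \<Rightarrow> nat set" where
  "rough N = {n. n > 0 \<and> (\<forall>p. prime p \<and> p \<le> N \<longrightarrow> \<not> p dvd n)}"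

text \<open>The reciprocal of the partial Euler product, in a form without divisions.\<close>

definition euler_prod :: "nat \<Rightarrow> complex \<Rightarrow> complex" where
  "euler_prod N s = (\<Prod>p | prime p \<and> p \<le> N. 1 - of_nat p powr (-s))"

lemma rough_Suc_prime:
  assumes "prime (Suc N)"
  shows "rough N = rough (Suc N) \<union> (\<lambda>n. Suc N * n) ` rough N" (is "_ = ?R")
    and "rough (Suc N) \<inter> (\<lambda>n. Suc N * n) ` rough N = {}"
proof -
  have "m \<in> ?R" if m: "m \<in> rough N" for m
  proof (cases "Suc N dvd m")
    case True
    then obtain k where "m = Suc N * k" by blast
    moreover from this m have "k \<in> rough N" by (auto simp: rough_def)
    ultimately show ?thesis by blast
  next
    case False
    with m show ?thesis by (auto simp: rough_def le_Suc_eq)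
  qed
  moreover have "Suc N * n \<in> rough N" if n: "n \<in> rough N" for n
  proof -
    have "\<not> p dvd Suc N * n" if p: "prime p" "p \<le> N" for p
    proof
      assume "p dvd Suc N * n"
      hence "p dvd Suc N \<or> p dvd n" using p(1) by (simp only: prime_dvd_mult_iff)
      hence "p = Suc N \<or> p dvd n" using primes_dvd_imp_eq[OF p(1) assms] by blast
        thus False using p n by (auto simp: rough_def)
    qed
    thus ?thesis using n by (auto simp: rough_def)
  qed
  moreover have "rough (Suc N) \<subseteq> rough N" by (auto simp: rough_def)
  ultimately show "rough N = ?R" by blast
  show "rough (Suc N) \<inter> (\<lambda>n. Suc N * n) ` rough N = {}"
    using assms by (auto simp: rough_def simp del: mult_Suc)
qed

lemma euler_prod_Suc: 
  "euler_prod (Suc N) s = (if prime (Suc N) then 1 - of_nat (Suc N) powr (-s) else 1) * euler_prod N s"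
proof (cases "prime (Suc N)")
  case True
  have "{p. prime p \<and> p \<le> Suc N} = insert (Suc N) {p. prime p \<and> p \<le> N}"
    using True by (auto simp: le_Suc_eq)
  thus ?thesis using True by (simp add: euler_prod_def)
next
  case False
  have "{p. prime p \<and> p \<le> Suc N} = {p. prime p \<and> p \<le> N}"
    using False by (auto simp: le_Suc_eq)
  thus ?thesis using False by (simp add: euler_prod_def)
qed

text \<open>Sieve of Eratosthenes: the factor 1 - p^(-s) removes all multiples of p from the series.
  The identity is exact for each N, so that no infinite product has to be handled.\<close>

lemma euler_prod_mult_zeta:
  assumes s: "Re s > 1"
  shows "euler_prod N s * infsum (\<lambda>n. of_nat n powr (-s)) UNIV = infsum (\<lambda>n. of_nat n powr (-s)) (rough N)"
proof (induction N)
  case 0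
  have "{p::nat. prime p \<and> p = 0} = {}" by auto
  moreover have "infsum (\<lambda>n. of_nat n powr (-s) :: complex) (rough 0) = infsum (\<lambda>n. of_nat n powr (-s)) UNIV"
    by (rule infsum_cong_neutral) (auto simp: rough_def)
  ultimately show ?case by (simp add: euler_prod_def)
next
  case (Suc N)
  let ?f = "\<lambda>n. of_nat n powr (-s) :: complex"
  show ?case
  proof (cases "prime (Suc N)")
    case True
    have sm: "?f summable_on A" for A
      by (rule abs_summable_summable[OF abs_summable_on_nat_powr[OF s]])
    have "infsum ?f (rough N) = infsum ?f (rough (Suc N)) + infsum ?f ((\<lambda>n. Suc N * n) ` rough N)"
      by (subst rough_Suc_prime(1)[OF True]) (rule infsum_Un_disjoint[OF sm sm rough_Suc_prime(2)[OF True]])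
    also have "infsum ?f ((\<lambda>n. Suc N * n) ` rough N) = infsum (?f \<circ> (\<lambda>n. Suc N * n)) (rough N)"
      by (rule infsum_reindex) (simp add: inj_on_def del: mult_Suc)
    also have "?f \<circ> (\<lambda>n. Suc N * n) = (\<lambda>n. of_nat (Suc N) powr (-s) * ?f n)"
      unfolding o_def of_nat_mult by (intro ext powr_times_real) auto
    also have "infsum \<dots> (rough N) = of_nat (Suc N) powr (-s) * infsum ?f (rough N)"
      by (rule infsum_cmult_right') 
    finally have "infsum ?f (rough (Suc N)) = (1 - of_nat (Suc N) powr (-s)) * infsum ?f (rough N)"
      by (simp add: algebra_simps)
    thus ?thesis using True Suc.IH by (simp add: euler_prod_Suc mult.assoc)
  next
    case False
    hence "rough (Suc N) = rough N" by (auto simp: rough_def le_Suc_eq)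
    thus ?thesis using False Suc.IH by (simp add: euler_prod_Suc)
  qed
qed

text \<open>The only N-rough number up to N is 1. The bound depends on \<sigma> alone and is thus
  uniform on half-planes, which is what differentiating the limit later asks for.\<close>

lemma rough_infsum_minus_1:
  assumes \<sigma>: "\<sigma> > 1" and s: "Re s \<ge> \<sigma>"
  shows "norm (infsum (\<lambda>n. of_nat n powr (-s)) (rough N) - 1) \<le> infsum (\<lambda>n. real n powr (-\<sigma>)) {N<..}"
proof -
  let ?f = "\<lambda>n. of_nat n powr (-s) :: complex"
  have s1: "Re s > 1" using assms by simp
  have sm: "(\<lambda>n. norm (?f n)) summable_on A" for A by (rule abs_summable_on_nat_powr[OF s1])
  have smr: "(\<lambda>n. real n powr (-\<sigma>)) summable_on A" for A
    using abs_summable_on_nat_powr[of "of_real \<sigma>" A] \<sigma> by (simp add: norm_nat_powr)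
  have 1: "1 \<in> rough N" by (auto simp: rough_def)
  have "infsum ?f (rough N) = infsum ?f {1} + infsum ?f (rough N - {1})"
    by (subst infsum_Un_disjoint[symmetric])
       (use 1 in \<open>auto simp: insert_absorb intro: abs_summable_summable[OF sm]\<close>)
  hence "norm (infsum ?f (rough N) - 1) = norm (infsum ?f (rough N - {1}))" by simp
  also have "\<dots> \<le> infsum (\<lambda>n. norm (?f n)) (rough N - {1})"
    by (rule norm_infsum_bound[OF sm])
  also have "\<dots> \<le> infsum (\<lambda>n. real n powr (-\<sigma>)) {N<..}"
  proof (rule infsum_mono_neutral)
    fix n assume "n \<in> (rough N - {1}) - {N<..}"
    hence n: "n \<in> rough N" "n \<noteq> 1" "n \<le> N" by auto
    then obtain p where p: "prime p" "p dvd n" using prime_factor_nat by blast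
    with n have "p \<le> N" by (auto simp: rough_def dest!: dvd_imp_le)
    with n p have False by (auto simp: rough_def)
    thus "norm (?f n) \<le> 0" ..
  next
    fix n assume "n \<in> (rough N - {1}) \<inter> {N<..}"
    hence "n \<ge> 1" by auto
    thus "norm (?f n) \<le> real n powr (-\<sigma>)" 
      unfolding norm_nat_powr using s by (intro powr_mono) auto
  qed (use sm smr in auto)
  finally show ?thesis .
qed

lemma infsum_powr_tail_tendsto:
  assumes "\<sigma> > 1"
  shows "(\<lambda>N. infsum (\<lambda>n. real n powr (-\<sigma>)) {N<..}) \<longlonglongrightarrow> 0"
proof -
  let ?f = "\<lambda>n. real n powr (-\<sigma>)"
  have smr: "?f summable_on A" for A
    using abs_summable_on_nat_powr[of "of_real \<sigma>" A] assms by (simp add: norm_nat_powr)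
  have "infsum ?f {N<..} = infsum ?f UNIV - (\<Sum>n<Suc N. ?f n)" for N
  proof -
    have "infsum ?f UNIV = infsum ?f {..<Suc N} + infsum ?f {N<..}"
      by (subst infsum_Un_disjoint[symmetric]) (auto intro!: smr arg_cong[of _ _ "infsum ?f"])
    thus ?thesis by simp
  qed
  moreover have "?f sums infsum ?f UNIV"
    by (rule has_sum_imp_sums[OF has_sum_infsum[OF smr]])
  hence "(\<lambda>N. infsum ?f UNIV - (\<Sum>n<Suc N. ?f n)) \<longlonglongrightarrow> infsum ?f UNIV - infsum ?f UNIV"
    unfolding sums_def by (intro tendsto_diff tendsto_const) (rule LIMSEQ_Suc)
  ultimately show ?thesis by simp
qed

text \<open>Mertens: \<open>3 + 4 cos a + cos (2 a) = 2 (1 + cos a)^2 \<ge> 0\<close>, applied to each term of the logarithmic series.\<close>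

lemma mertens_factor_le_1:
  fixes z :: complex
  assumes r: "0 \<le> r" "r < 1" and z: "norm z = 1"
  shows "(1 - r) ^ 3 * norm (1 - of_real r * z) ^ 4 * norm (1 - of_real r * z ^ 2) \<le> 1"
proof -
  have ln_sums: "(\<lambda>n. - Re (w ^ n / of_nat n)) sums ln (norm (1 - w))" if w: "norm w < 1" for w :: complex
  proof -
    have nz: "1 - w \<noteq> 0" using w by auto
    have "(\<lambda>n. Re ((-1) ^ Suc n / of_nat n * (-w) ^ n)) sums Re (ln (1 + (-w)))"
      by (intro sums_Re Ln_series) (use w in auto)
    also have "(\<lambda>n. Re ((-1) ^ Suc n / of_nat n * (-w) ^ n)) = (\<lambda>n. - Re (w ^ n / of_nat n))"
    proof
      fix n
      have "(-1) ^ n * (-w) ^ n = w ^ n"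
        by (subst power_mult_distrib[symmetric]) simp
      hence "(-1) ^ Suc n / of_nat n * (-w) ^ n = - (w ^ n / of_nat n)"
        by (metis (no_types, opaque_lifting) mult_minus_left power_Suc times_divide_eq_left mult_1 minus_divide_left)
      thus "Re ((-1) ^ Suc n / of_nat n * (-w) ^ n) = - Re (w ^ n / of_nat n)" by (simp only: uminus_complex.simps)
    qed
    finally show ?thesis using nz by simp
  qed
  have nrm: "norm (complex_of_real r) < 1" "norm (of_real r * z) < 1" "norm (of_real r * z ^ 2) < 1"
    using r z by (auto simp: norm_mult norm_power)
  have nz_norm: "norm (1 - w) > 0" if "norm w < 1" for w :: complex using that by auto
  define g where "g = (\<lambda>n. 3 * - Re (of_real r ^ n / of_nat n) + 4 * - Re ((of_real r * z) ^ n / of_nat n)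
              + - Re ((of_real r * z ^ 2) ^ n / of_nat n))"
  have g: "g sums (3 * ln (norm (1 - complex_of_real r)) + 4 * ln (norm (1 - of_real r * z)) 
              + ln (norm (1 - of_real r * z ^ 2)))"
    unfolding g_def by (intro sums_add sums_mult ln_sums nrm)
  have "g n \<le> 0" for n
  proof -
    have "Re (z ^ n) ^ 2 + Im (z ^ n) ^ 2 = 1"
      using z by (metis cmod_power2 norm_power one_power2 power_one)
    moreover have "(z ^ 2) ^ n = (z ^ n) ^ 2" by (metis power_mult mult.commute)
    ultimately have re: "Re ((z ^ 2) ^ n) = 2 * Re (z ^ n) ^ 2 - 1"
      by (simp add: Re_power2)
    define c where "c = r ^ n / real n"
    have "c \<ge> 0" using r by (simp add: c_def)
    have "complex_of_real r ^ n / of_nat n = of_real c"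
      "(of_real r * z) ^ n / of_nat n = of_real c * z ^ n"
      "(of_real r * z ^ 2) ^ n / of_nat n = of_real c * (z ^ 2) ^ n"
      unfolding c_def power_mult_distrib by simp_all
    moreover have "Re (of_real c * w) = c * Re w" for w by simp
    ultimately have "g n = - (c * (2 * (1 + Re (z ^ n)) ^ 2))"
      unfolding g_def by (simp only: re Re_complex_of_real) (simp add: power2_eq_square algebra_simps)
    thus ?thesis using \<open>c \<ge> 0\<close> by simp
  qed
  hence "3 * ln (norm (1 - complex_of_real r)) + 4 * ln (norm (1 - of_real r * z)) 
              + ln (norm (1 - of_real r * z ^ 2)) \<le> 0"
    using sums_le[OF _ g sums_zero] by auto
  moreover have "norm (1 - complex_of_real r) = 1 - r"
    using r by (metis abs_of_pos diff_gt_0_iff_gt norm_of_real of_real_1 of_real_diff)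
  moreover have "norm (1 - of_real r * z) > 0" "norm (1 - of_real r * z ^ 2) > 0"
    using nz_norm[OF nrm(2)] nz_norm[OF nrm(3)] .
  ultimately have "ln ((1 - r) ^ 3 * norm (1 - of_real r * z) ^ 4 * norm (1 - of_real r * z ^ 2)) \<le> 0"
    using r by (simp add: ln_mult ln_realpow)
  thus ?thesis
    using r \<open>norm (1 - of_real r * z) > 0\<close> \<open>norm (1 - of_real r * z ^ 2) > 0\<close>
    by (subst (asm) ln_le_zero_iff) auto
qed

lemma euler_prod_mertens_le_1:
  assumes "\<sigma> > 1"
  shows "norm (euler_prod N (of_real \<sigma>)) ^ 3 * norm (euler_prod N (Complex \<sigma> t)) ^ 4 *
           norm (euler_prod N (Complex \<sigma> (2 * t))) \<le> 1"
proof -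
  have "(norm (1 - of_nat p powr (- complex_of_real \<sigma>))) ^ 3 * norm (1 - of_nat p powr (- Complex \<sigma> t)) ^ 4
          * norm (1 - of_nat p powr (- Complex \<sigma> (2*t))) \<le> 1" if p: "prime p" for p :: nat
  proof -
    have p1: "p > 1" using p prime_gt_1_nat by blast
    define r where "r = real p powr (-\<sigma>)"
    have r: "0 \<le> r" "r < 1" using p1 assms unfolding r_def by (auto intro: powr_less_one)
    define z where "z = exp (- \<i> * t * ln p)"
    have "of_nat p powr (- complex_of_real \<sigma>) = complex_of_real r"
      unfolding r_def using powr_of_real[of "real p" "-\<sigma>"] by simp
    moreover have "of_nat p powr (- Complex \<sigma> t) = of_real r * z"
      using p1 by (simp add: r_def z_def powr_def Complex_eq exp_add[symmetric] exp_of_real[symmetric] algebra_simps Ln_of_nat)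
    moreover have "of_nat p powr (- Complex \<sigma> (2*t)) = of_real r * z ^ 2"
      using p1 by (simp add: r_def z_def powr_def Complex_eq exp_add[symmetric] exp_of_real[symmetric] algebra_simps Ln_of_nat exp_double[symmetric])
    moreover have "norm z = 1" by (simp add: z_def)
    moreover have "norm (1 - complex_of_real r) = 1 - r"
      using r by (metis abs_of_pos diff_gt_0_iff_gt norm_of_real of_real_1 of_real_diff)
    ultimately show ?thesis using mertens_factor_le_1[OF r] by metis
  qed
  hence "(\<Prod>p | prime p \<and> p \<le> N. (norm (1 - of_nat p powr (- complex_of_real \<sigma>))) ^ 3 * norm (1 - of_nat p powr (- Complex \<sigma> t)) ^ 4
          * norm (1 - of_nat p powr (- Complex \<sigma> (2*t)))) \<le> 1"
    by (intro prod_le_1) auto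
  thus ?thesis
    by (simp add: euler_prod_def prod.distrib prod_power_distrib prod_norm[symmetric])
qed

section \<open>Non-vanishing of zeta on Re s = 1\<close>

definition zeta :: "complex \<Rightarrow> complex" where
  "zeta s = zeta_reg s / (s - 1)"

lemma euler_prod_zeta_bound:
  assumes "\<sigma> > 1" "Re s \<ge> \<sigma>"
  shows "norm (euler_prod N s * zeta s - 1) \<le> infsum (\<lambda>n. real n powr (-\<sigma>)) {N<..}"
proof -
  have "s \<noteq> 1" "Re s > 1" using assms by auto
  thus ?thesis using rough_infsum_minus_1[OF assms, of N] euler_prod_mult_zeta[of s N]
    by (simp add: zeta_def zeta_reg_eq)
qed

lemma euler_prod_zeta_tendsto:
  assumes "Re s > 1"
  shows "(\<lambda>N. euler_prod N s * zeta s) \<longlonglongrightarrow> 1"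
proof -
  have "(\<lambda>N. euler_prod N s * zeta s - 1) \<longlonglongrightarrow> 0"
    by (rule Lim_null_comparison[OF _ infsum_powr_tail_tendsto[OF assms]])
       (use euler_prod_zeta_bound[OF assms] in auto)
  thus ?thesis by (simp add: LIM_zero_iff)
qed

text \<open>Multiplied by the zeta values, the finite products of
  \<open>euler_prod_mertens_le_1\<close> tend to 1, and they are themselves at most 1. Working with
  finite products avoids logarithms of zeta.\<close>

lemma zeta_mertens_ge_1:
  assumes "\<sigma> > 1"
  shows "norm (zeta (of_real \<sigma>)) ^ 3 * norm (zeta (Complex \<sigma> t)) ^ 4 * norm (zeta (Complex \<sigma> (2 * t))) \<ge> 1"
    (is "?Z \<ge> 1")
proof -
  let ?E = "\<lambda>N. norm (euler_prod N (of_real \<sigma>)) ^ 3 * norm (euler_prod N (Complex \<sigma> t)) ^ 4 *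
           norm (euler_prod N (Complex \<sigma> (2 * t)))"
  have "(\<lambda>N. norm (euler_prod N (of_real \<sigma>) * zeta (of_real \<sigma>)) ^ 3 * norm (euler_prod N (Complex \<sigma> t) * zeta (Complex \<sigma> t)) ^ 4 *
           norm (euler_prod N (Complex \<sigma> (2 * t)) * zeta (Complex \<sigma> (2*t)))) \<longlonglongrightarrow> norm (1::complex) ^ 3 * norm (1::complex) ^ 4 * norm (1::complex)"
    using assms by (intro tendsto_intros euler_prod_zeta_tendsto) auto
  hence "(\<lambda>N. ?E N * ?Z) \<longlonglongrightarrow> 1"
    by (simp add: norm_mult power_mult_distrib algebra_simps)
  moreover have "?E N * ?Z \<le> ?Z" for N
    using mult_right_mono[OF euler_prod_mertens_le_1[OF assms, of N t], of ?Z] by simp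
  ultimately show ?thesis by (intro LIMSEQ_le_const2) auto
qed

lemma zeta_reg_continuous: "continuous_on {s. Re s > 1/2} zeta_reg"
  by (rule holomorphic_on_imp_continuous_on[OF zeta_reg_holomorphic])

lemma zeta_reg_1: "zeta_reg 1 = 1"
proof -
  have "zeta_term n 1 = 0" for n by (simp add: zeta_term_def del: of_nat_Suc)
  thus ?thesis by (simp add: zeta_reg_def)
qed

text \<open>Bookkeeping for the next proof with d = \<sigma> - 1: the pole contributes d^(-3), the
  supposed zero d^4, and one factor d is left over.\<close>

lemma mertens_rearrange:
  fixes d :: real
  assumes "d \<noteq> 0"
  shows "X ^ 3 * (Y / d) ^ 4 * (W / b) * (d / a ^ 4) = (X / d) ^ 3 * (Y / a) ^ 4 * (W / b)"
proof -
  have "d ^ 4 = d ^ 3 * d" by (simp add: eval_nat_numeral)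
  thus ?thesis using assms by (simp add: power_divide mult_ac)
qed

text \<open>To the right of the line, \<open>euler_prod N s * zeta s\<close> tends to 1. On the
  line, a zero at 1 + i t would force the Mertens product to 0 as \<sigma> decreases to 1, being a
  fourfold zero against a triple pole with a bounded factor near 1 + 2 i t, although the product is
  at least 1. Here t is nonzero because \<open>zeta_reg 1 = 1\<close>.\<close>

lemma zeta_reg_nonzero:
  assumes "Re s \<ge> 1"
  shows "zeta_reg s \<noteq> 0"
proof (cases "Re s > 1")
  case True
  have "zeta s \<noteq> 0"
    using euler_prod_zeta_tendsto[OF True] by (auto simp: LIMSEQ_const_iff)
  thus ?thesis by (auto simp: zeta_def)
next
  case False
  define t where "t = Im s"
  have s: "s = Complex 1 t" using False assms by (simp add: t_def complex_eq_iff)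
  show ?thesis
  proof
    assume zero: "zeta_reg s = 0"
    have t0: "t \<noteq> 0" using zero zeta_reg_1 by (auto simp: s complex_eq_iff Complex_eq)
    have cont: "isCont zeta_reg (Complex 1 u)" for u
      using continuous_on_eq_continuous_at[OF open_halfspace_Re_gt[of "1/2"], THEN iffD1, OF zeta_reg_continuous] by auto
    have "(zeta_reg has_field_derivative deriv zeta_reg s) (at s)"
      using holomorphic_derivI[OF zeta_reg_holomorphic open_halfspace_Re_gt, of s] by (simp add: s)
    hence "((\<lambda>w. (zeta_reg w - zeta_reg s) / (w - s)) \<longlongrightarrow> deriv zeta_reg s) (at s)"
      by (simp add: has_field_derivative_iff)
    hence quot: "((\<lambda>w. zeta_reg w / (w - s)) \<longlongrightarrow> deriv zeta_reg s) (at s)"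
      using zero by simp
    have lim: "((\<lambda>\<sigma>. Complex \<sigma> u) \<longlongrightarrow> Complex 1 u) (at_right 1)" for u
      unfolding Complex_eq by (intro tendsto_intros)
    have filt: "filterlim (\<lambda>\<sigma>. Complex \<sigma> t) (at s) (at_right 1)"
      unfolding filterlim_at using lim[of t] 
      by (auto simp: s eventually_at_right_less eventually_at_filter complex_eq_iff)
    have L1: "((\<lambda>\<sigma>. zeta_reg (Complex \<sigma> t) / (Complex \<sigma> t - s)) \<longlongrightarrow> deriv zeta_reg s) (at_right 1)"
      by (rule filterlim_compose[OF quot filt])
    have L0: "((\<lambda>\<sigma>. zeta_reg (Complex \<sigma> 0)) \<longlongrightarrow> zeta_reg (Complex 1 0)) (at_right 1)"
      by (rule isCont_tendsto_compose[OF cont lim])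
    have L2: "((\<lambda>\<sigma>. zeta_reg (Complex \<sigma> (2*t))) \<longlongrightarrow> zeta_reg (Complex 1 (2*t))) (at_right 1)"
      by (rule isCont_tendsto_compose[OF cont lim])
    \<comment> \<open>The Mertens product in terms of \<open>zeta_reg\<close>, with the fourth power
      taken of the difference quotient at the supposed zero; all factors but the last converge, and
      the last tends to 0.\<close>
    define h where "h = (\<lambda>\<sigma>. norm (zeta_reg (Complex \<sigma> 0)) ^ 3 * norm (zeta_reg (Complex \<sigma> t) / (Complex \<sigma> t - s)) ^ 4
        * (norm (zeta_reg (Complex \<sigma> (2*t))) / norm (Complex \<sigma> (2*t) - 1)) * ((\<sigma> - 1) / norm (Complex \<sigma> t - 1) ^ 4))"
    have "(h \<longlongrightarrow> norm (zeta_reg (Complex 1 0)) ^ 3 * norm (deriv zeta_reg s) ^ 4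
        * (norm (zeta_reg (Complex 1 (2*t))) / norm (Complex 1 (2*t) - 1)) * ((1 - 1) / norm (Complex 1 t - 1) ^ 4)) (at_right 1)"
      unfolding h_def using t0 by (intro tendsto_intros L0 L1 L2 lim) (auto simp: complex_eq_iff)
    hence "(h \<longlongrightarrow> 0) (at_right 1)" by simp
    moreover have "eventually (\<lambda>\<sigma>. h \<sigma> \<ge> 1) (at_right 1)"
      using eventually_at_right_less[of "1::real"]
    proof eventually_elim
      case (elim \<sigma>)
      have e1: "complex_of_real \<sigma> = Complex \<sigma> 0" by (simp add: complex_eq_iff)
      have e2: "norm (Complex \<sigma> 0 - 1) = \<sigma> - 1" "norm (Complex \<sigma> t - s) = \<sigma> - 1"
        using elim by (auto simp: s cmod_def)
      have "h \<sigma> = norm (zeta (of_real \<sigma>)) ^ 3 * norm (zeta (Complex \<sigma> t)) ^ 4 * norm (zeta (Complex \<sigma> (2 * t)))"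
        unfolding h_def zeta_def e1 norm_divide e2 by (rule mertens_rearrange) (use elim in auto)
      thus ?case using zeta_mertens_ge_1[OF elim] by simp
    qed
    ultimately have "(0::real) \<ge> 1"
      by (intro tendsto_lowerbound[of h 0 "at_right 1" 1]) auto
    thus False by simp
  qed
qed

section \<open>The Dirichlet series over the primes\<close>

definition log_prime :: "nat \<Rightarrow> real" where
  "log_prime n = (if prime n then ln (real n) else 0)"

lemma log_prime_nonneg [simp]: "log_prime n \<ge> 0"
  by (auto simp: log_prime_def dest: prime_gt_0_nat)

lemma log_prime_le: "log_prime n \<le> ln (real n)"
  by (cases "n = 0") (auto simp: log_prime_def)

lemma summable_log_powr:
  assumes "\<sigma> > 1"
  shows "summable (\<lambda>n. ln (real n) * real n powr (-\<sigma>))"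
proof -
  define \<delta> where "\<delta> = (\<sigma> - 1) / 2"
  have \<delta>: "\<delta> > 0" "\<delta> - \<sigma> < -1" using assms by (auto simp: \<delta>_def field_simps)
  show ?thesis
  proof (rule summable_comparison_test')
    show "summable (\<lambda>n. real n powr (\<delta> - \<sigma>) / \<delta>)"
      using \<delta> by (intro summable_divide) (simp add: summable_real_powr_iff)
    fix n :: nat assume n: "n \<ge> 1"
    have "ln (real n) * real n powr (-\<sigma>) \<le> real n powr \<delta> / \<delta> * real n powr (-\<sigma>)"
      using n \<delta> by (intro mult_right_mono ln_powr_bound) auto
    also have "\<dots> = real n powr (\<delta> - \<sigma>) / \<delta>"
      by (simp add: powr_add[symmetric])
    finally show "norm (ln (real n) * real n powr (-\<sigma>)) \<le> real n powr (\<delta> - \<sigma>) / \<delta>"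
      using n by simp
  qed
qed

lemma summable_log_prime:
  assumes "\<sigma> > 1"
  shows "summable (\<lambda>n. log_prime n * real n powr (-\<sigma>))"
  by (rule summable_comparison_test'[OF summable_log_powr[OF assms], of 0])
     (auto simp: abs_mult intro!: mult_right_mono log_prime_le)

lemma norm_nat_powr_le_half:
  assumes "Re s \<ge> 1" "n \<ge> 2"
  shows "norm (of_nat n powr (-s) :: complex) \<le> 1/2"
proof -
  have "real n powr (- Re s) \<le> real n powr (-1)" using assms by (intro powr_mono) auto
  also have "\<dots> \<le> 1/2" using assms by (simp add: powr_minus field_simps)
  finally show ?thesis by (simp add: norm_nat_powr)
qed

lemma has_derivative_euler_prod:
  fixes s :: complex
  assumes "Re s > 1"
  shows "(euler_prod N has_field_derivative
           euler_prod N s * (\<Sum>p | prime p \<and> p \<le> N. ln (real p) * of_nat p powr (-s) / (1 - of_nat p powr (-s)))) (at s)"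
proof (induction N)
  case 0
  have *: "{p::nat. prime p \<and> p = 0} = {}" by auto
  have "euler_prod 0 = (\<lambda>_. 1)" by (auto simp: euler_prod_def * fun_eq_iff)
  thus ?case by (simp add: *)
next
  case (Suc N)
  show ?case
  proof (cases "prime (Suc N)")
    case True
    hence 2: "Suc N \<ge> 2" by (rule prime_ge_2_nat)
    have set: "{p. prime p \<and> p \<le> Suc N} = insert (Suc N) {p. prime p \<and> p \<le> N}"
      using True by (auto simp: le_Suc_eq)
    have nz: "1 - of_nat (Suc N) powr (-s) \<noteq> (0::complex)"
      using norm_nat_powr_le_half[of s "Suc N"] assms 2 by force
    have fe: "euler_prod (Suc N) = (\<lambda>s. (1 - of_nat (Suc N) powr (-s)) * euler_prod N s)"
      using True by (auto simp: euler_prod_Suc fun_eq_iff)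
    define X where "X = (of_nat (Suc N) powr (-s) :: complex)"
    define S where "S = (\<Sum>p | prime p \<and> p \<le> N. ln (real p) * of_nat p powr (-s) / (1 - of_nat p powr (-s)))"
    have "((\<lambda>s. 1 - w powr (-s)) has_field_derivative Ln w * w powr (-s)) (at s)" if "w \<noteq> 0" for w :: complex
    proof -
      have "((\<lambda>s. w powr (-s)) has_field_derivative Ln w * w powr (-s) * (-1)) (at s)"
        by (rule DERIV_chain2[OF has_field_derivative_powr_right[OF that]]) (rule derivative_eq_intros refl)+
      from DERIV_diff[OF DERIV_const[of 1] this] show ?thesis by simp
    qed
    from this[of "of_nat (Suc N)"]
    have d: "((\<lambda>s. 1 - of_nat (Suc N) powr (-s)) has_field_derivative of_real (ln (real (Suc N))) * X) (at s)"
      by (simp add: Ln_of_nat X_def del: of_nat_Suc)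
    have alg: "a * X * P + P * S * (1 - X) = (1 - X) * P * (a * X / (1 - X) + S)" for a P
    proof -
      have "1 - X \<noteq> 0" using nz unfolding X_def .
      thus ?thesis by (simp add: field_simps)
    qed
    have "(\<Sum>p\<in>insert (Suc N) {p. prime p \<and> p \<le> N}. ln (real p) * of_nat p powr (-s) / (1 - of_nat p powr (-s)))
        = of_real (ln (real (Suc N))) * X / (1 - X) + S"
      unfolding X_def S_def by (subst sum.insert) auto
    thus ?thesis
      unfolding fe set using DERIV_mult[OF d Suc.IH]
      by (simp only: alg X_def[symmetric] S_def[symmetric])
  next
    case False
    hence "{p. prime p \<and> p \<le> Suc N} = {p. prime p \<and> p \<le> N}" by (auto simp: le_Suc_eq)
    moreover have "euler_prod (Suc N) = euler_prod N" using False by (auto simp: euler_prod_Suc fun_eq_iff)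
    ultimately show ?thesis using Suc.IH by simp
  qed
qed

text \<open>The functions \<open>euler_prod N s * zeta s\<close> tend to 1 locally uniformly, so
  their derivatives tend to 0. Divided by the functions themselves, these derivatives are the sums
  of the logarithmic derivatives of the two factors.\<close>

lemma log_deriv_zeta_sum:
  fixes s :: complex
  assumes s: "Re s > 1"
  shows "(\<lambda>N. \<Sum>p | prime p \<and> p \<le> N. ln (real p) * of_nat p powr (-s) / (1 - of_nat p powr (-s)))
           \<longlonglongrightarrow> 1 / (s - 1) - deriv zeta_reg s / zeta_reg s"
proof -
  let ?S = "{s. Re s > 1}"
  let ?L = "\<lambda>N (s::complex). \<Sum>p | prime p \<and> p \<le> N. ln (real p) * of_nat p powr (-s) / (1 - of_nat p powr (-s)) :: complex"
  define D where "D = (\<lambda>s. deriv zeta_reg s / zeta_reg s - 1 / (s - 1))"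
  have nz: "zeta s \<noteq> 0" if "Re s > 1" for s
    using zeta_reg_nonzero[of s] that by (auto simp: zeta_def)
  have dz: "(zeta has_field_derivative zeta s * D s) (at s)" if "Re s > 1" for s
  proof -
    have "(zeta_reg has_field_derivative deriv zeta_reg s) (at s)"
      using holomorphic_derivI[OF zeta_reg_holomorphic open_halfspace_Re_gt, of s] that by simp
    moreover have "((\<lambda>s. s - 1) has_field_derivative 1) (at s)" by (rule derivative_eq_intros refl | simp)+
    moreover have "s - 1 \<noteq> 0" using that by auto
    ultimately have "((\<lambda>s. zeta_reg s / (s - 1)) has_field_derivative
        (deriv zeta_reg s * (s - 1) - zeta_reg s * 1) / ((s - 1) * (s - 1))) (at s)"
      by (rule DERIV_divide)
    also have "(a * c - b * 1) / (c * c) = b / c * (a / b - 1 / c)" if "b \<noteq> 0" "c \<noteq> 0" for a b c :: complex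
      using that by (simp add: field_simps)
    hence "(deriv zeta_reg s * (s - 1) - zeta_reg s * 1) / ((s - 1) * (s - 1)) = zeta s * D s"
      using zeta_reg_nonzero[of s] that \<open>s - 1 \<noteq> 0\<close> unfolding zeta_def D_def by auto
    finally have "((\<lambda>s. zeta_reg s / (s - 1)) has_field_derivative zeta s * D s) (at s)" .
    thus ?thesis by (simp add: zeta_def[abs_def])
  qed
  have "\<exists>g'. \<forall>x\<in>?S. ((\<lambda>_. 1) has_field_derivative g' x) (at x) \<and>
          (\<lambda>N. euler_prod N x * zeta x * (?L N x + D x)) \<longlonglongrightarrow> g' x"
  proof (rule has_complex_derivative_uniform_sequence)
    show "open ?S" by (rule open_halfspace_Re_gt)
    show "((\<lambda>s. euler_prod N s * zeta s) has_field_derivative euler_prod N x * zeta x * (?L N x + D x)) (at x)"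
      if "x \<in> ?S" for N x
      by (rule DERIV_cong[OF DERIV_mult[OF has_derivative_euler_prod dz]]) (use that in \<open>auto simp: algebra_simps\<close>)
    fix x assume x: "x \<in> ?S"
    then obtain d where d: "d > 0" "cball x d \<subseteq> ?S"
      using open_contains_cball[of ?S] open_halfspace_Re_gt[of 1] by blast
    have "x - of_real d \<in> cball x d" using d by (auto simp: dist_norm)
    hence "Re (x - of_real d) > 1" using d by blast
    hence \<sigma>: "Re x - d > 1" by simp
    have "uniform_limit (cball x d) (\<lambda>N s. euler_prod N s * zeta s) (\<lambda>_. 1) sequentially"
    proof (rule uniform_limitI)
      fix e :: real assume "e > 0"
      with infsum_powr_tail_tendsto[OF \<sigma>]
      have "\<forall>\<^sub>F N in sequentially. infsum (\<lambda>n. real n powr (-(Re x - d))) {N<..} < e"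
        by (rule order_tendstoD)
      thus "\<forall>\<^sub>F N in sequentially. \<forall>s\<in>cball x d. dist (euler_prod N s * zeta s) 1 < e"
      proof eventually_elim
        case (elim N)
        show ?case
        proof
          fix s assume "s \<in> cball x d"
          hence "Re s \<ge> Re x - d" 
            using abs_Re_le_cmod[of "x - s"] by (auto simp: dist_norm)
          from euler_prod_zeta_bound[OF \<sigma> this, of N] elim
          show "dist (euler_prod N s * zeta s) 1 < e" by (simp add: dist_norm)
        qed
      qed
    qed
    with d show "\<exists>d>0. cball x d \<subseteq> ?S \<and> uniform_limit (cball x d) (\<lambda>N s. euler_prod N s * zeta s) (\<lambda>_. 1) sequentially"
      by blast
  qed
  then obtain g' where g': "((\<lambda>_. 1::complex) has_field_derivative g') (at s)"
      "(\<lambda>N. euler_prod N s * zeta s * (?L N s + D s)) \<longlonglongrightarrow> g'" using s by auto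
  have "g' = 0" using g'(1) by (rule DERIV_unique) simp
  with g' have "(\<lambda>N. euler_prod N s * zeta s * (?L N s + D s) / (euler_prod N s * zeta s)) \<longlonglongrightarrow> 0 / 1"
    by (intro tendsto_divide euler_prod_zeta_tendsto s) auto
  moreover have "\<forall>\<^sub>F N in sequentially. euler_prod N s * zeta s \<noteq> 0"
    using tendsto_imp_eventually_ne[OF euler_prod_zeta_tendsto[OF s], of 0] by simp
  hence "\<forall>\<^sub>F N in sequentially. euler_prod N s * zeta s * (?L N s + D s) / (euler_prod N s * zeta s) = ?L N s + D s"
    by eventually_elim auto
  ultimately have "(\<lambda>N. ?L N s + D s) \<longlonglongrightarrow> 0" by (simp add: tendsto_cong)
  from tendsto_diff[OF this tendsto_const[of "D s"]] show ?thesis by (simp add: D_def)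
qed

text \<open>The logarithmic derivative of zeta also counts higher prime powers. Their share, the sum
  of the \<open>T n\<close>, has terms of size at most 2 ln p / p^2 for Re s \<ge> 1 and so
  converges uniformly up to the line; the rest of G is continuous because \<open>zeta_reg\<close>
  has no zeros there.\<close>

theorem prime_dirichlet_series:
  obtains G :: "complex \<Rightarrow> complex" where "continuous_on {s. Re s \<ge> 1} G"
    "\<And>s::complex. Re s > 1 \<Longrightarrow> (\<lambda>n. log_prime n * of_nat n powr (-s)) sums (1 / (s - 1) + G s)"
proof
  define T where "T = (\<lambda>n (s::complex). log_prime n * of_nat n powr (-s) * of_nat n powr (-s) / (1 - of_nat n powr (-s)) :: complex)"
  define E where "E = (\<lambda>s. \<Sum>n. T n s)"
  have T_bound: "norm (T n s) \<le> 2 * (ln (real n) * real n powr (-2))" if s: "Re s \<ge> 1" for n s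
  proof (cases "n \<ge> 2")
    case True
    have "norm (1 - of_nat n powr (-s) :: complex) \<ge> 1 - norm (of_nat n powr (-s) :: complex)"
      by (metis norm_one norm_triangle_ineq2)
    hence "norm (1 - of_nat n powr (-s) :: complex) \<ge> 1/2"
      using norm_nat_powr_le_half[OF s True] by linarith
    moreover have "real n powr (- Re s) \<le> 1 / real n"
      using powr_mono[of "- Re s" "-1" "real n"] True s by (simp add: powr_minus divide_inverse)
    ultimately have "norm (T n s) \<le> (ln (real n) * (1 / real n) * (1 / real n)) / (1/2)"
      unfolding T_def norm_divide norm_mult norm_nat_powr using True log_prime_le[of n]
      by (intro frac_le mult_mono) auto
    thus ?thesis using True by (simp add: powr_minus power2_eq_square field_simps)
  next
    case False
    hence "n = 0 \<or> n = 1" by auto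
    thus ?thesis by (auto simp: T_def log_prime_def)
  qed
  have smb: "summable (\<lambda>n. 2 * (ln (real n) * real n powr (-2)))"
    by (intro summable_mult summable_log_powr) auto
  have ul: "uniform_limit {s. Re s \<ge> 1} (\<lambda>N s. \<Sum>n<N. T n s) E sequentially"
    unfolding E_def by (rule Weierstrass_m_test[OF _ smb]) (use T_bound in auto)
  have contE: "continuous_on {s. Re s \<ge> 1} E"
  proof (rule uniform_limit_theorem[OF _ ul])
    have "continuous_on {s. Re s \<ge> 1} (T n)" for n
    proof (cases "n \<ge> 2")
      case True
      have "1 - of_nat n powr (-s) \<noteq> (0::complex)" if "Re s \<ge> 1" for s
        using norm_nat_powr_le_half[OF that True] by force
      thus ?thesis unfolding T_def using True by (intro continuous_intros) auto
    next
      case False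
      hence "n = 0 \<or> n = 1" by auto
      thus ?thesis by (auto simp: T_def log_prime_def)
    qed
    thus "\<forall>\<^sub>F N in sequentially. continuous_on {s. Re s \<ge> 1} (\<lambda>s. \<Sum>n<N. T n s)"
      by (intro always_eventually allI continuous_on_sum) auto
  qed auto
  show "continuous_on {s. Re s \<ge> 1} (\<lambda>s. - deriv zeta_reg s / zeta_reg s - E s)"
  proof (intro continuous_intros contE)
    have "deriv zeta_reg holomorphic_on {s. Re s > 1/2}"
      by (intro holomorphic_deriv zeta_reg_holomorphic open_halfspace_Re_gt)
    thus "continuous_on {s. Re s \<ge> 1} (deriv zeta_reg)"
      by (rule continuous_on_subset[OF holomorphic_on_imp_continuous_on]) auto
    show "continuous_on {s. Re s \<ge> 1} zeta_reg"
      using zeta_reg_continuous by (rule continuous_on_subset) auto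
  qed (use zeta_reg_nonzero in auto)
  fix s :: complex assume s: "Re s > 1"
  have "(\<lambda>N. \<Sum>n<N. T n s) \<longlonglongrightarrow> E s"
    using tendsto_uniform_limitI[OF ul] s by auto
  hence "(\<lambda>N. (\<Sum>p | prime p \<and> p \<le> N. ln (real p) * of_nat p powr (-s) / (1 - of_nat p powr (-s)))
             - (\<Sum>n<Suc N. T n s)) \<longlonglongrightarrow> (1 / (s - 1) - deriv zeta_reg s / zeta_reg s) - E s"
    by (intro tendsto_diff log_deriv_zeta_sum s) (rule LIMSEQ_Suc)
  also have "(\<lambda>N. (\<Sum>p | prime p \<and> p \<le> N. ln (real p) * of_nat p powr (-s) / (1 - of_nat p powr (-s)))
             - (\<Sum>n<Suc N. T n s)) = (\<lambda>N. \<Sum>n<Suc N. log_prime n * of_nat n powr (-s))"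
  proof
    fix N
    have "(\<Sum>p | prime p \<and> p \<le> N. ln (real p) * of_nat p powr (-s) / (1 - of_nat p powr (-s)) :: complex)
        = (\<Sum>n<Suc N. log_prime n * of_nat n powr (-s) / (1 - of_nat n powr (-s)))"
      by (rule sum.mono_neutral_cong_left) (auto simp: log_prime_def)
    hence "(\<Sum>p | prime p \<and> p \<le> N. ln (real p) * of_nat p powr (-s) / (1 - of_nat p powr (-s)) :: complex)
             - (\<Sum>n<Suc N. T n s) = (\<Sum>n<Suc N. log_prime n * of_nat n powr (-s) / (1 - of_nat n powr (-s)) - T n s)"
      by (simp only: sum_subtractf)
    also have "\<dots> = (\<Sum>n<Suc N. log_prime n * of_nat n powr (-s))"
    proof (rule sum.cong)
      fix n
      show "log_prime n * of_nat n powr (-s) / (1 - of_nat n powr (-s)) - T n s = log_prime n * of_nat n powr (-s)"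
      proof (cases "prime n")
        case True
        hence "n \<ge> 2" by (rule prime_ge_2_nat)
        hence "1 - of_nat n powr (-s) \<noteq> (0::complex)"
          using norm_nat_powr_le_half[of s n] s by force
        moreover have "a * x / (1 - x) - a * x * x / (1 - x) = a * x" if "1 - x \<noteq> 0" for a x :: complex
        proof -
          have "a * x / (1 - x) - a * x * x / (1 - x) = a * x * (1 - x) / (1 - x)"
            unfolding diff_divide_distrib[symmetric] by (simp add: ring_distribs)
          thus ?thesis using that by simp
        qed
        ultimately show ?thesis unfolding T_def by blast
      qed (simp add: T_def log_prime_def)
    qed auto
    finally show "(\<Sum>p | prime p \<and> p \<le> N. ln (real p) * of_nat p powr (-s) / (1 - of_nat p powr (-s)) :: complex)
             - (\<Sum>n<Suc N. T n s) = (\<Sum>n<Suc N. log_prime n * of_nat n powr (-s))" .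
  qed
  finally have "(\<lambda>N. \<Sum>n<N. log_prime n * of_nat n powr (-s)) \<longlonglongrightarrow>
      1 / (s - 1) - deriv zeta_reg s / zeta_reg s - E s"
    by (rule LIMSEQ_imp_Suc)
  note lim = this
  show "(\<lambda>n. log_prime n * of_nat n powr (-s)) sums (1 / (s - 1) + (- deriv zeta_reg s / zeta_reg s - E s))"
  proof -
    have "a - b / c - d = a + (- b / c - d)" for a b c d :: complex by simp
    thus ?thesis using lim unfolding sums_def by metis
  qed
qed

section \<open>A Fejer-type kernel and the Riemann-Lebesgue lemma\<close>

definition tri :: "real \<Rightarrow> real" where "tri w = max 0 (1 - \<bar>w\<bar>)"

text \<open>Equal to (sin (t/2) / (t/2))^2, the Fourier transform of \<open>tri\<close>; the value
  at 0 is the limit.\<close>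

definition fejer :: "real \<Rightarrow> real" where
  "fejer t = (if t = 0 then 1 else 2 * (1 - cos t) / t\<^sup>2)"

text \<open>The zeros of a single Fejer kernel lie in \<open>2 \<pi> \<int>\<close>; adding a translate makes the kernel positive, so that one can divide by it.\<close>

definition kern :: "real \<Rightarrow> real" where "kern t = fejer t + fejer (t + 1)"

lemma tri_bounds: "0 \<le> tri w" "tri w \<le> 1"
  by (auto simp: tri_def)

lemma continuous_on_tri [continuous_intros]: "continuous_on A tri"
  unfolding tri_def by (intro continuous_intros)

lemma integrable_tri_mult:
  fixes h :: "real \<Rightarrow> complex"
  assumes "continuous_on UNIV h"
  shows "integrable lborel (\<lambda>w. of_real (tri w) * h w)"
proof -
  have "integrable lborel (\<lambda>w. indicator {-1..1} w *\<^sub>R (of_real (tri w) * h w))"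
    by (rule borel_integrable_compact) (auto intro!: continuous_intros continuous_on_subset[OF assms])
  also have "(\<lambda>w. indicator {-1..1} w *\<^sub>R (of_real (tri w) * h w)) = (\<lambda>w. of_real (tri w) * h w)"
    by (auto simp: fun_eq_iff tri_def split: split_indicator)
  finally show ?thesis .
qed

lemma fejer_integral: "(\<integral>w. of_real (tri w) * iexp (w * t) \<partial>lborel) = complex_of_real (fejer t)"
proof -
  define f1 where "f1 = (\<lambda>w. complex_of_real (1 - w) * iexp (w * t))"
  define f2 where "f2 = (\<lambda>w. complex_of_real (1 + w) * iexp (w * t))"
  \<comment> \<open>Antiderivatives of the two halves of the integrand, found by one integration by
    parts and kept as functions of a complex variable so that the field derivative rules apply. They
    divide by t, whence the separate case t = 0.\<close>
  define F1 where "F1 = (\<lambda>z. if t = 0 then z - z ^ 2 / 2 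
    else (1 - z) * exp (\<i> * t * z) / (\<i> * t) - exp (\<i> * t * z) / t ^ 2)"
  define F2 where "F2 = (\<lambda>z. if t = 0 then z + z ^ 2 / 2 
    else (1 + z) * exp (\<i> * t * z) / (\<i> * t) + exp (\<i> * t * z) / t ^ 2)"
  have d1: "(F1 has_field_derivative (1 - z) * exp (\<i> * t * z)) (at z)" for z
  proof (cases "t = 0")
    case True
    thus ?thesis unfolding F1_def by (auto intro!: derivative_eq_intros)
  next
    case False
    have "(F1 has_field_derivative ((0 - 1) * exp (\<i> * t * z) + exp (\<i> * t * z) * (\<i> * t) * (1 - z)) / (\<i> * t)
         - exp (\<i> * t * z) * (\<i> * t) / t ^ 2) (at z)"
      unfolding F1_def using False by (auto intro!: derivative_eq_intros simp: power2_eq_square eval_nat_numeral)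
    also have "((0 - 1) * exp (\<i> * t * z) + exp (\<i> * t * z) * (\<i> * t) * (1 - z)) / (\<i> * t)
         - exp (\<i> * t * z) * (\<i> * t) / t ^ 2 = (1 - z) * exp (\<i> * t * z)"
      using False by (simp add: field_simps power2_eq_square)
    finally show ?thesis .
  qed
  have d2: "(F2 has_field_derivative (1 + z) * exp (\<i> * t * z)) (at z)" for z
  proof (cases "t = 0")
    case True
    thus ?thesis unfolding F2_def by (auto intro!: derivative_eq_intros)
  next
    case False
    have "(F2 has_field_derivative ((0 + 1) * exp (\<i> * t * z) + exp (\<i> * t * z) * (\<i> * t) * (1 + z)) / (\<i> * t)
         + exp (\<i> * t * z) * (\<i> * t) / t ^ 2) (at z)"
      unfolding F2_def using False by (auto intro!: derivative_eq_intros simp: power2_eq_square eval_nat_numeral)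
    also have "((0 + 1) * exp (\<i> * t * z) + exp (\<i> * t * z) * (\<i> * t) * (1 + z)) / (\<i> * t)
         + exp (\<i> * t * z) * (\<i> * t) / t ^ 2 = (1 + z) * exp (\<i> * t * z)"
      using False by (simp add: field_simps power2_eq_square)
    finally show ?thesis .
  qed
  have v1: "((\<lambda>w. F1 (of_real w)) has_vector_derivative f1 w) (at w within {0..1})" for w
    using has_vector_derivative_real_field[OF d1[of "of_real w"], of "{0..1}"] by (simp add: f1_def mult_ac)
  have v2: "((\<lambda>w. F2 (of_real w)) has_vector_derivative f2 w) (at w within {-1..0})" for w
    using has_vector_derivative_real_field[OF d2[of "of_real w"], of "{-1..0}"] by (simp add: f2_def mult_ac)
  have h1: "has_bochner_integral lborel (\<lambda>w. indicator {0..1} w *\<^sub>R f1 w) (F1 (of_real 1) - F1 (of_real 0))"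
    by (rule has_bochner_integral_FTC_Icc[where F = "\<lambda>w. F1 (of_real w)", OF _ v1])
       (auto simp: f1_def intro!: continuous_intros)
  have h2: "has_bochner_integral lborel (\<lambda>w. indicator {-1..0} w *\<^sub>R f2 w) (F2 (of_real 0) - F2 (of_real (-1)))"
    by (rule has_bochner_integral_FTC_Icc[where F = "\<lambda>w. F2 (of_real w)", OF _ v2])
       (auto simp: f2_def intro!: continuous_intros)
  have "(\<integral>w. of_real (tri w) * iexp (w * t) \<partial>lborel) = 
        (\<integral>w. indicator {0..1} w *\<^sub>R f1 w + indicator {-1..0} w *\<^sub>R f2 w \<partial>lborel)"
  proof (rule integral_cong_AE)
    show "(\<lambda>w. complex_of_real (tri w) * iexp (w * t)) \<in> borel_measurable lborel"
      by (rule borel_measurable_integrable[OF integrable_tri_mult]) (intro continuous_intros)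
    show "(\<lambda>w. indicator {0..1} w *\<^sub>R f1 w + indicator {-1..0} w *\<^sub>R f2 w) \<in> borel_measurable lborel"
      using has_bochner_integral_add[OF h1 h2] by (auto dest: has_bochner_integral_integrable)
    show "AE w in lborel. of_real (tri w) * iexp (w * t) = indicator {0..1} w *\<^sub>R f1 w + indicator {-1..0} w *\<^sub>R f2 w"
      using AE_lborel_singleton[of 0]
      by eventually_elim (auto simp: tri_def f1_def f2_def split: split_indicator)
  qed
  also have "\<dots> = (F1 1 - F1 0) + (F2 0 - F2 (-1))"
    using has_bochner_integral_integral_eq[OF has_bochner_integral_add[OF h1 h2]] by simp
  also have "\<dots> = of_real (fejer t)"
  proof (cases "t = 0")
    case True
    thus ?thesis by (simp add: F1_def F2_def fejer_def)
  next
    case False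
    have cos: "exp (\<i> * t) + exp (- (\<i> * t)) = 2 * of_real (cos t)"
      by (simp add: exp_Euler cos_of_real sin_of_real flip: exp_minus_Euler)
         (simp add: exp_minus_Euler cos_of_real sin_of_real)
    have "(F1 1 - F1 0) + (F2 0 - F2 (-1)) = (2 - (exp (\<i> * t) + exp (- (\<i> * t)))) / t ^ 2"
      using False by (simp add: F1_def F2_def field_simps)
    also have "\<dots> = of_real (fejer t)" using False by (simp add: cos fejer_def)
    finally show ?thesis .
  qed
  finally show ?thesis .
qed

text \<open>Translating a kernel by 1 multiplies its transform by a phase, so the support stays
  [-1, 1]: the second Fejer kernel costs nothing on the frequency side.\<close>

definition kern_hat :: "real \<Rightarrow> complex" where
  "kern_hat w = of_real (tri w) * (1 + iexp w)"

lemma kern_integral: "(\<integral>w. kern_hat w * iexp (w * t) \<partial>lborel) = complex_of_real (kern t)"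
proof -
  have i: "integrable lborel (\<lambda>w. of_real (tri w) * iexp (w * t))" for t
    by (intro integrable_tri_mult continuous_intros)
  have "kern_hat w * iexp (w * t) = of_real (tri w) * iexp (w * t) + of_real (tri w) * iexp (w * (t + 1))" for w
    by (simp add: kern_hat_def ring_distribs exp_add mult_ac)
  thus ?thesis
    by (simp only: Bochner_Integration.integral_add[OF i i] fejer_integral kern_def of_real_add)
qed

lemma fejer_nonneg: "0 \<le> fejer t"
  by (simp add: fejer_def)

lemma kern_nonneg: "0 \<le> kern t"
  by (simp add: kern_def fejer_nonneg)

lemma fejer_le: "fejer t \<le> 8 * inverse (1 + t\<^sup>2)"
proof (cases "\<bar>t\<bar> \<le> 1")
  case True
  have "fejer t \<le> 1"
  proof (cases "t = 0")
    case False
    have "1 - cos t = 2 * sin (t / 2) ^ 2"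
      using cos_double_sin[of "t/2"] by simp
    also have "sin (t/2) ^ 2 \<le> (t/2) ^ 2"
      using abs_sin_x_le_abs_x[of "t/2"] by (rule abs_le_square_iff[THEN iffD1])
    finally have "2 * (1 - cos t) \<le> t ^ 2" by (simp add: power_divide)
    thus ?thesis using False by (simp add: fejer_def)
  qed (simp add: fejer_def)
  also have "1 \<le> 8 * inverse (1 + t\<^sup>2)"
    using True abs_square_le_1[of t] by (simp add: field_simps add_pos_nonneg)
  finally show ?thesis .
next
  case False
  hence "1 \<le> t ^ 2" using abs_square_less_1[of t] by linarith
  hence t: "t \<noteq> 0" "1 + t\<^sup>2 \<le> 2 * t\<^sup>2" "t\<^sup>2 > 0" by auto
  have "fejer t = 2 * (1 - cos t) / t\<^sup>2" using t by (simp only: fejer_def if_False)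
  also have "\<dots> \<le> 4 / t\<^sup>2"
  proof (rule divide_right_mono)
    have "2 * (1 - cos t) \<le> 2 * (1 - (-1))"
      by (intro mult_left_mono diff_left_mono cos_ge_minus_one) simp
    thus "2 * (1 - cos t) \<le> 4" by simp
  qed simp
  also have "\<dots> \<le> 8 / (1 + t\<^sup>2)"
    using t by (simp add: field_simps)
  finally show ?thesis by (simp add: divide_inverse)
qed

lemma fejer_measurable [measurable]: "fejer \<in> borel_measurable borel"
  unfolding fejer_def by measurable

lemma kern_measurable [measurable]: "kern \<in> borel_measurable borel"
  unfolding kern_def by measurable

lemma integrable_fejer: "integrable lborel fejer"
proof (rule Bochner_Integration.integrable_bound)
  show "integrable lborel (\<lambda>t::real. 8 * inverse (1 + t\<^sup>2))"
    using integrable_inverse_1_plus_square by (simp add: set_integrable_def)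
  show "AE t in lborel. norm (fejer t) \<le> norm (8 * inverse (1 + t\<^sup>2))"
    using fejer_le fejer_nonneg by (auto intro!: AE_I2 simp: add_pos_nonneg abs_of_nonneg)
qed auto

lemma integrable_kern: "integrable lborel kern"
  using lborel_integrable_real_affine[OF integrable_fejer, of 1 1] integrable_fejer
  unfolding kern_def by (intro Bochner_Integration.integrable_add) (auto simp: add.commute)

text \<open>Here the compact support of the transform pays off: kernel averages of M around l see
  only the values of \<open>char M\<close> at frequencies within distance 1 of u.\<close>

lemma kern_fubini:
  assumes "finite_measure M" and sets: "sets M = sets borel"
  shows "(\<integral>v. of_real (kern (v - l)) * iexp (u * (v - l)) \<partial>M) =
         (\<integral>w. kern_hat w * iexp (- (w + u) * l) * char M (w + u) \<partial>lborel)"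
proof -
  interpret M: finite_measure M by fact
  interpret P: pair_sigma_finite M lborel ..
  note [measurable_cong] = sets
  define f where "f = (\<lambda>v w. kern_hat w * iexp ((w + u) * (v - l)))"
  have cont: "continuous_on UNIV (\<lambda>w. (1 + iexp w) * iexp ((w + u) * (v - l)))" for v
    by (intro continuous_intros)
  have f_eq: "f v = (\<lambda>w. of_real (tri w) * ((1 + iexp w) * iexp ((w + u) * (v - l))))" for v
    by (auto simp: f_def kern_hat_def)
  have [measurable]: "tri \<in> borel_measurable borel"
    by (intro borel_measurable_continuous_onI continuous_intros)
  have [measurable]: "kern_hat \<in> borel_measurable borel" unfolding kern_hat_def by measurable
  have meas: "(\<lambda>(v, w). f v w) \<in> borel_measurable (M \<Otimes>\<^sub>M lborel)"
    unfolding f_def by measurable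
  have int: "integrable lborel (f v)" for v
    unfolding f_eq by (rule integrable_tri_mult[OF cont])
  have nrm: "norm (f v w) = norm (kern_hat w)" for v w
    by (simp add: f_def norm_mult)
  have int2: "integrable (M \<Otimes>\<^sub>M lborel) (\<lambda>(v, w). f v w)"
    by (rule P.Fubini_integrable[OF meas]) (auto simp: nrm int)
  have "(\<integral>v. of_real (kern (v - l)) * iexp (u * (v - l)) \<partial>M) = (\<integral>v. (\<integral>w. f v w \<partial>lborel) \<partial>M)"
  proof (rule Bochner_Integration.integral_cong)
    fix v
    have "f v w = kern_hat w * iexp (w * (v - l)) * iexp (u * (v - l))" for w
      by (simp add: f_def ring_distribs exp_add mult_ac)
    thus "of_real (kern (v - l)) * iexp (u * (v - l)) = (\<integral>w. f v w \<partial>lborel)"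
      by (simp only: kern_integral[symmetric] Bochner_Integration.integral_mult_left_zero)
  qed auto
  also have "\<dots> = (\<integral>w. (\<integral>v. f v w \<partial>M) \<partial>lborel)"
    using P.Fubini_integral[OF int2] by simp
  also have "\<dots> = (\<integral>w. kern_hat w * iexp (- (w + u) * l) * char M (w + u) \<partial>lborel)"
  proof (rule Bochner_Integration.integral_cong)
    fix w
    have "f v w = (kern_hat w * iexp (- (w + u) * l)) * iexp ((w + u) * v)" for v
    proof -
      have "(w + u) * (v - l) = - (w + u) * l + (w + u) * v" by (simp add: algebra_simps)
      thus ?thesis by (simp only: f_def of_real_add distrib_left exp_add mult.assoc)
    qed
    thus "(\<integral>v. f v w \<partial>M) = kern_hat w * iexp (- (w + u) * l) * char M (w + u)"
      by (simp only: char_def Bochner_Integration.integral_mult_right_zero)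
  qed auto
  finally show ?thesis .
qed

text \<open>Shifting w by half a period, pi / l, changes the sign of the oscillating factor. Twice
  the integral is therefore the integral of g w - g (w + pi / l) against it, and this is small since
  g is continuous with compact support.\<close>

lemma riemann_lebesgue_tri:
  fixes h :: "real \<Rightarrow> complex"
  assumes h: "continuous_on UNIV h" and l: "filterlim l at_top sequentially"
  shows "(\<lambda>n. \<integral>w. of_real (tri w) * h w * iexp (- w * l n) \<partial>lborel) \<longlonglongrightarrow> 0"
proof -
  define g where "g = (\<lambda>w. of_real (tri w) * h w)"
  have gc: "continuous_on UNIV g" unfolding g_def by (intro continuous_intros h)
  hence [measurable]: "g \<in> borel_measurable borel" by (rule borel_measurable_continuous_onI)
  have gint: "integrable lborel g" unfolding g_def by (rule integrable_tri_mult[OF h])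
  have "compact (g ` {-1..1})" by (intro compact_continuous_image continuous_on_subset[OF gc]) auto
  then obtain B where B: "\<And>w. w \<in> {-1..1} \<Longrightarrow> norm (g w) \<le> B"
    using compact_imp_bounded bounded_iff by (metis imageI)
  have g0: "g w = 0" if "w \<notin> {-1..1}" for w using that by (auto simp: g_def tri_def)
  have B0: "B \<ge> 0" by (rule order_trans[OF norm_ge_zero B[of 0]]) auto
  have gB: "norm (g w) \<le> B" for w using B[of w] g0[of w] B0 by (cases "w \<in> {-1..1}") auto
  define \<delta> where "\<delta> = (\<lambda>n. pi / l n)"
  have \<delta>: "\<delta> \<longlonglongrightarrow> 0" unfolding \<delta>_def
    by (rule real_tendsto_divide_at_top[OF tendsto_const l])
  have "eventually (\<lambda>n. l n > 0 \<and> \<bar>\<delta> n\<bar> < 1) sequentially"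
    using l order_tendstoD(2)[OF tendsto_rabs_zero[OF \<delta>], of 1]
    by (intro eventually_conj) (auto simp: filterlim_at_top_dense)
  then obtain N where N: "\<And>n. n \<ge> N \<Longrightarrow> l n > 0 \<and> \<bar>\<delta> n\<bar> < 1"
    by (auto simp: eventually_sequentially)
  \<comment> \<open>From index N on, l n is positive and the shift is below 1, so that both
    translates vanish outside [-2, 2], the support of the majorant.\<close>
  define D where "D = (\<lambda>n. \<integral>w. norm (g w - g (w + \<delta> (n + N))) \<partial>lborel)"
  have "D \<longlonglongrightarrow> (\<integral>w. 0 \<partial>(lborel :: real measure))"
    unfolding D_def
  proof (rule integral_dominated_convergence[where w = "\<lambda>w. 2 * B * indicator {-2..2} w"])
    show "AE w in lborel. (\<lambda>n. norm (g w - g (w + \<delta> (n + N)))) \<longlonglongrightarrow> 0"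
    proof (rule AE_I2)
      fix w
      have "isCont g w" using gc by (simp add: continuous_on_eq_continuous_at)
      moreover have "(\<lambda>n. w + \<delta> (n + N)) \<longlonglongrightarrow> w + 0"
        by (intro tendsto_intros LIMSEQ_ignore_initial_segment \<delta>)
      ultimately have "(\<lambda>n. g (w + \<delta> (n + N))) \<longlonglongrightarrow> g w" by (intro isCont_tendsto_compose[of _ g]) auto
      from tendsto_diff[OF tendsto_const[of "g w"] this]
      show "(\<lambda>n. norm (g w - g (w + \<delta> (n + N)))) \<longlonglongrightarrow> 0"
        using tendsto_norm_zero by force
    qed
    fix n
    show "AE w in lborel. norm (norm (g w - g (w + \<delta> (n + N)))) \<le> 2 * B * indicator {-2..2} w"
    proof (rule AE_I2)
      fix w
      have "norm (g w - g (w + \<delta> (n + N))) \<le> B + B"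
        by (intro order_trans[OF norm_triangle_ineq4] add_mono gB)
      moreover have "g w = 0 \<and> g (w + \<delta> (n + N)) = 0" if "w \<notin> {-2..2}"
        using that N[of "n + N"] by (auto intro!: g0)
      ultimately show "norm (norm (g w - g (w + \<delta> (n + N)))) \<le> 2 * B * indicator {-2..2} w"
        by (auto split: split_indicator)
    qed
  qed auto
  hence D0: "D \<longlonglongrightarrow> 0" by simp
  define I where "I = (\<lambda>n. \<integral>w. g w * iexp (- w * l n) \<partial>lborel)"
  have intI: "integrable lborel (\<lambda>w. g w * iexp (a * w + b))" for a b
    unfolding g_def mult.assoc by (intro integrable_tri_mult continuous_intros h)
  have "norm (I (n + N)) \<le> D n" for n
  proof -
    define L where "L = l (n + N)"
    have L: "L > 0" "\<delta> (n + N) = pi / L" using N[of "n + N"] by (auto simp: L_def \<delta>_def)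
    have "I (n + N) = (\<integral>w. g (pi / L + 1 * w) * iexp (- (pi / L + 1 * w) * L) \<partial>lborel)"
      unfolding I_def L_def[symmetric] by (subst lborel_integral_real_affine[of 1 _ "pi / L"]) auto
    also have "\<dots> = (\<integral>w. - (g (w + pi / L) * iexp (- w * L)) \<partial>lborel)"
    proof (rule Bochner_Integration.integral_cong)
      fix w
      have "- (pi / L + 1 * w) * L = - w * L - pi" using L by (simp add: field_simps)
      hence "iexp (- (pi / L + 1 * w) * L) = iexp (- w * L) * exp (- (\<i> * pi))"
        by (simp only: of_real_diff right_diff_distrib exp_diff exp_minus divide_inverse)
      also have "exp (- (\<i> * pi)) = -1" by (simp add: exp_minus exp_pi_i')
      finally show "g (pi / L + 1 * w) * iexp (- (pi / L + 1 * w) * L) = - (g (w + pi / L) * iexp (- w * L))"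
        by (simp add: add.commute)
    qed auto
    finally have I2: "I (n + N) = - (\<integral>w. g (w + pi / L) * iexp (- w * L) \<partial>lborel)" by simp
    have i1: "integrable lborel (\<lambda>w. g w * iexp (- w * L))" using intI[of "-L" 0] by (simp add: mult.commute)
    have i2: "integrable lborel (\<lambda>w. g (w + pi / L) * iexp (- w * L))"
    proof -
      have "integrable lborel (\<lambda>w. g (pi / L + 1 * w) * iexp (- L * (pi / L + 1 * w) + pi))"
        by (rule lborel_integrable_real_affine[OF intI]) auto
      moreover have "- L * (pi / L + 1 * w) + pi = - w * L" for w using L by (simp add: field_simps)
      ultimately show ?thesis by (simp only: mult_1 add.commute[of "pi / L"])
    qed
    have "2 * I (n + N) = (\<integral>w. g w * iexp (- w * L) \<partial>lborel) - (\<integral>w. g (w + pi / L) * iexp (- w * L) \<partial>lborel)"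
      using I2 unfolding I_def L_def by simp
    also have "\<dots> = (\<integral>w. (g w - g (w + pi / L)) * iexp (- w * L) \<partial>lborel)"
      by (subst Bochner_Integration.integral_diff[OF i1 i2, symmetric]) (simp add: ring_distribs)
    finally have "norm (2 * I (n + N)) \<le> (\<integral>w. norm ((g w - g (w + pi / L)) * iexp (- w * L)) \<partial>lborel)"
      using integral_norm_bound by metis
    also have "\<dots> = D n" by (simp add: D_def norm_mult L)
    finally have "2 * norm (I (n + N)) \<le> D n" by (simp add: norm_mult)
    thus ?thesis using norm_ge_zero[of "I (n + N)"] by linarith
  qed
  hence "(\<lambda>n. I (n + N)) \<longlonglongrightarrow> 0"
    by (intro Lim_null_comparison[OF _ D0] always_eventually) auto
  hence "I \<longlonglongrightarrow> 0" by (rule LIMSEQ_offset)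
  thus ?thesis by (simp add: I_def g_def)
qed

section \<open>Primes weighted by the kernel\<close>

text \<open>Mass ln p / p^(1+\<epsilon>) sits at ln p, so the characteristic function at y is the
  Dirichlet series over the primes at s = 1 + \<epsilon> - i y.\<close>

definition prime_meas :: "real \<Rightarrow> real measure" where
  "prime_meas \<epsilon> = distr (density (count_space UNIV) (\<lambda>n. ennreal (log_prime n * real n powr (-1 - \<epsilon>)))) borel (\<lambda>n. ln (real n))"

text \<open>The continuous model of the primes: its characteristic function at y is the pole 1 / (s
  - 1) at s = 1 + \<epsilon> - i y, so comparing it with the prime measure leaves just the function
  G that is continuous up to the line.\<close>

definition exp_meas :: "real \<Rightarrow> real measure" where
  "exp_meas \<epsilon> = density lborel (\<lambda>v. ennreal (indicator {0<..} v * exp (- (v * \<epsilon>))))"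

lemma sets_prime_meas [simp, measurable_cong]: "sets (prime_meas \<epsilon>) = sets borel"
  by (simp add: prime_meas_def)

lemma sets_exp_meas [simp, measurable_cong]: "sets (exp_meas \<epsilon>) = sets borel"
  by (simp add: exp_meas_def)

lemma space_prime_meas [simp]: "space (prime_meas \<epsilon>) = UNIV"
  by (simp add: prime_meas_def)

lemma space_exp_meas [simp]: "space (exp_meas \<epsilon>) = UNIV"
  by (simp add: exp_meas_def)

lemma summable_log_prime':
  assumes "\<epsilon> > 0"
  shows "summable (\<lambda>n. log_prime n * real n powr (-1 - \<epsilon>))"
  using summable_log_prime[of "1 + \<epsilon>"] assms by simp

lemma finite_prime_meas:
  assumes "\<epsilon> > 0"
  shows "finite_measure (prime_meas \<epsilon>)"
proof
  have "emeasure (prime_meas \<epsilon>) UNIV = (\<integral>\<^sup>+n. ennreal (log_prime n * real n powr (-1 - \<epsilon>)) \<partial>count_space UNIV)"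
    by (simp add: prime_meas_def emeasure_distr emeasure_density)
  also have "\<dots> \<noteq> \<infinity>"
    unfolding nn_integral_count_space_nat infinity_ennreal_def
    by (rule ennreal_suminf_neq_top[OF summable_log_prime'[OF assms]]) simp
  finally show "emeasure (prime_meas \<epsilon>) (space (prime_meas \<epsilon>)) \<noteq> \<infinity>" by simp
qed

lemma integrable_exp_density:
  assumes "\<epsilon> > 0"
  shows "integrable lborel (\<lambda>v::real. indicator {0<..} v * exp (- (v * \<epsilon>)))"
  using integrable_I0i_exp_mscale[OF assms] by (simp add: set_integrable_def)

lemma finite_exp_meas:
  assumes "\<epsilon> > 0"
  shows "finite_measure (exp_meas \<epsilon>)"
proof
  have "emeasure (exp_meas \<epsilon>) UNIV = (\<integral>\<^sup>+v. ennreal (indicator {0<..} v * exp (- (v * \<epsilon>))) \<partial>lborel)"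
    by (simp add: exp_meas_def emeasure_density)
  also have "\<dots> = ennreal (\<integral>v. indicator {0<..} v * exp (- (v * \<epsilon>)) \<partial>lborel)"
    by (rule nn_integral_eq_integral[OF integrable_exp_density[OF assms]]) simp
  finally show "emeasure (exp_meas \<epsilon>) (space (exp_meas \<epsilon>)) \<noteq> \<infinity>" by simp
qed

lemma integral_prime_meas:
  fixes f :: "real \<Rightarrow> 'a :: {banach, second_countable_topology}"
  assumes [measurable]: "f \<in> borel_measurable borel" and B: "\<And>t. norm (f t) \<le> B" and \<epsilon>: "\<epsilon> > 0"
  shows "(\<lambda>n. (log_prime n * real n powr (-1 - \<epsilon>)) *\<^sub>R f (ln (real n))) sums integral\<^sup>L (prime_meas \<epsilon>) f"
proof -
  have "integral\<^sup>L (prime_meas \<epsilon>) f = (\<integral>n. (log_prime n * real n powr (-1 - \<epsilon>)) *\<^sub>R f (ln (real n)) \<partial>count_space UNIV)"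
    unfolding prime_meas_def by (subst integral_distr) (auto simp: integral_density)
  moreover have "integrable (count_space UNIV) (\<lambda>n. (log_prime n * real n powr (-1 - \<epsilon>)) *\<^sub>R f (ln (real n)))"
    unfolding integrable_count_space_nat_iff
  proof (rule summable_comparison_test')
    show "summable (\<lambda>n. log_prime n * real n powr (-1 - \<epsilon>) * B)"
      by (intro summable_mult2 summable_log_prime' \<epsilon>)
    show "norm (norm ((log_prime n * real n powr (-1 - \<epsilon>)) *\<^sub>R f (ln (real n)))) \<le> log_prime n * real n powr (-1 - \<epsilon>) * B" for n
      by (simp add: mult_left_mono B)
  qed
  ultimately show ?thesis using sums_integral_count_space_nat by metis
qed

lemma char_exp_meas:
  assumes \<epsilon>: "\<epsilon> > 0"
  shows "char (exp_meas \<epsilon>) y = 1 / (of_real \<epsilon> - \<i> * of_real y)"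
proof -
  define c where "c = complex_of_real \<epsilon> - \<i> * of_real y"
  have c: "c \<noteq> 0" "Re c = \<epsilon>" using \<epsilon> by (auto simp: c_def complex_eq_iff)
  have "char (exp_meas \<epsilon>) y = (\<integral>v. (indicator {0<..} v * exp (- (v * \<epsilon>))) *\<^sub>R iexp (y * v) \<partial>lborel)"
    unfolding char_def exp_meas_def by (subst integral_density) auto
  also have "\<dots> = (\<integral>v. indicator {0<..} v *\<^sub>R exp (- c * of_real v) \<partial>lborel)"
  proof (rule Bochner_Integration.integral_cong)
    fix v :: real
    have "- c * of_real v = of_real (- (v * \<epsilon>)) + \<i> * of_real (y * v)"
      by (simp add: c_def algebra_simps)
    hence "exp (- c * of_real v) = exp (- (v * \<epsilon>)) *\<^sub>R iexp (y * v)"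
      by (simp only: exp_add exp_of_real scaleR_conv_of_real)
    thus "(indicator {0<..} v * exp (- (v * \<epsilon>))) *\<^sub>R iexp (y * v) = indicator {0<..} v *\<^sub>R exp (- c * of_real v)"
      by simp
  qed auto
  finally have eq: "char (exp_meas \<epsilon>) y = (\<integral>v. indicator {0<..} v *\<^sub>R exp (- c * of_real v) \<partial>lborel)" .
  define I where "I = (\<lambda>n. \<integral>v. indicator {0..real n} v *\<^sub>R exp (- c * of_real v) \<partial>lborel)"
  have L1: "I \<longlonglongrightarrow> (\<integral>v. indicator {0<..} v *\<^sub>R exp (- c * of_real v) \<partial>lborel)"
    unfolding I_def
  proof (rule integral_dominated_convergence[where w = "\<lambda>v. indicator {0<..} v * exp (- (v * \<epsilon>))"])
    show "integrable lborel (\<lambda>v::real. indicator {0<..} v * exp (- (v * \<epsilon>)))"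
      by (rule integrable_exp_density[OF \<epsilon>])
    show "AE v in lborel. (\<lambda>n. indicator {0..real n} v *\<^sub>R exp (- c * of_real v)) \<longlonglongrightarrow> indicator {0<..} v *\<^sub>R exp (- c * of_real v)"
      using AE_lborel_singleton[of 0]
    proof eventually_elim
      case (elim v)
      have "indicator {0..real n} v = (indicator {0<..} v :: real)" if "n \<ge> nat \<lceil>v\<rceil>" for n
      proof -
        have "v \<le> real n" using that by linarith
        thus ?thesis using elim by (auto split: split_indicator)
      qed
      hence "eventually (\<lambda>n. indicator {0..real n} v = (indicator {0<..} v :: real)) sequentially"
        using eventually_sequentially by blast
      hence "eventually (\<lambda>n. indicator {0..real n} v *\<^sub>R exp (- c * of_real v) = indicator {0<..} v *\<^sub>R exp (- c * of_real v)) sequentially"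
        by eventually_elim simp
      thus ?case by (rule tendsto_eventually)
    qed
    show "AE v in lborel. norm (indicator {0..real n} v *\<^sub>R exp (- c * of_real v)) \<le> indicator {0<..} v * exp (- (v * \<epsilon>))" for n
      using AE_lborel_singleton[of 0]
      by eventually_elim (auto simp: c(2) mult.commute split: split_indicator)
  qed auto
  have L2: "I n = 1 / c - exp (- c * of_real (real n)) / c" for n
  proof -
    have "((\<lambda>z. - exp (- c * z) / c) has_field_derivative exp (- c * z)) (at z)" for z
      using c by (auto intro!: derivative_eq_intros)
    hence "((\<lambda>v. - exp (- c * of_real v) / c) has_vector_derivative exp (- c * of_real v)) (at v within {0..real n})" for v
      by (rule has_vector_derivative_real_field)
    hence "I n = (- exp (- c * of_real (real n)) / c) - (- exp (- c * of_real 0) / c)"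
      unfolding I_def by (intro integral_FTC_Icc continuous_intros) auto
    thus ?thesis by simp
  qed
  have L3: "(\<lambda>n. 1 / c - exp (- c * of_real (real n)) / c) \<longlonglongrightarrow> 1 / c - 0 / c"
  proof (intro tendsto_intros c)
    have "(\<lambda>n. exp (- (\<epsilon> * real n))) \<longlonglongrightarrow> 0" using \<epsilon> by real_asymp
    hence "(\<lambda>n. norm (exp (- c * of_real (real n)))) \<longlonglongrightarrow> 0" by (simp add: c)
    thus "(\<lambda>n. exp (- c * of_real (real n))) \<longlonglongrightarrow> 0" by (rule tendsto_norm_zero_cancel)
  qed
  have "I \<longlonglongrightarrow> 1 / c" using L3 by (simp add: L2[abs_def])
  from LIMSEQ_unique[OF L1 this]
  show ?thesis by (simp add: eq c_def)
qed

lemma char_prime_meas: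
  obtains G :: "complex \<Rightarrow> complex" where "continuous_on {s. Re s \<ge> 1} G"
    "\<And>\<epsilon> y. \<epsilon> > 0 \<Longrightarrow> char (prime_meas \<epsilon>) y = char (exp_meas \<epsilon>) y + G (Complex (1 + \<epsilon>) (- y))"
proof -
  obtain G :: "complex \<Rightarrow> complex" where G: "continuous_on {s. Re s \<ge> 1} G"
    "\<And>s::complex. Re s > 1 \<Longrightarrow> (\<lambda>n. log_prime n * of_nat n powr (-s)) sums (1 / (s - 1) + G s)"
    using prime_dirichlet_series by blast
  have "char (prime_meas \<epsilon>) y = char (exp_meas \<epsilon>) y + G (Complex (1 + \<epsilon>) (- y))" if \<epsilon>: "\<epsilon> > 0" for \<epsilon> y
  proof -
    let ?s = "Complex (1 + \<epsilon>) (- y)"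
    have "(\<lambda>n. (log_prime n * real n powr (-1 - \<epsilon>)) *\<^sub>R iexp (y * ln (real n))) sums char (prime_meas \<epsilon>) y"
      unfolding char_def by (rule integral_prime_meas[where B = 1]) (use \<epsilon> in auto)
    also have "(\<lambda>n. (log_prime n * real n powr (-1 - \<epsilon>)) *\<^sub>R iexp (y * ln (real n))) = (\<lambda>n. log_prime n * of_nat n powr (-?s))"
    proof
      fix n
      show "(log_prime n * real n powr (-1 - \<epsilon>)) *\<^sub>R iexp (y * ln (real n)) = log_prime n * of_nat n powr (-?s)"
      proof (cases "prime n")
        case True
        hence n: "n > 0" by (rule prime_gt_0_nat)
        have "- ?s * of_real (ln (real n)) = of_real ((-1 - \<epsilon>) * ln (real n)) + \<i> * of_real (y * ln (real n))"
          by (simp add: complex_eq_iff algebra_simps)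
        hence "of_nat n powr (-?s) = complex_of_real (real n powr (-1 - \<epsilon>)) * iexp (y * ln (real n))"
          using n by (simp only: powr_def[of "of_nat n :: complex"] Ln_of_nat exp_add exp_of_real powr_def[of "real n"]) auto
        thus ?thesis by (simp add: scaleR_conv_of_real)
      qed (simp add: log_prime_def)
    qed
    finally have "char (prime_meas \<epsilon>) y = 1 / (?s - 1) + G ?s"
      using G(2)[of ?s] \<epsilon> sums_unique2 by auto
    moreover have "?s - 1 = of_real \<epsilon> - \<i> * of_real y" by (simp add: complex_eq_iff)
    ultimately show ?thesis using char_exp_meas[OF \<epsilon>, of y] by simp
  qed
  with G that show ?thesis by blast
qed

text \<open>Recentred at l n, the density becomes 1 on the whole line: the cut-off wanders to minus
  infinity, and the damping factor tends to 1 because \<epsilon> n and \<epsilon> n * l n tend to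
  0.\<close>

lemma kern_exp_meas_limit:
  assumes l: "filterlim l at_top sequentially" and \<epsilon>: "\<And>n. \<epsilon> n > 0" "\<epsilon> \<longlonglongrightarrow> 0" "(\<lambda>n. \<epsilon> n * l n) \<longlonglongrightarrow> 0"
  shows "(\<lambda>n. \<integral>v. of_real (kern (v - l n)) * iexp (u * (v - l n)) \<partial>exp_meas (\<epsilon> n))
           \<longlonglongrightarrow> (\<integral>t. of_real (kern t) * iexp (u * t) \<partial>lborel)"
proof -
  have eq: "(\<integral>v. of_real (kern (v - l n)) * iexp (u * (v - l n)) \<partial>exp_meas (\<epsilon> n)) =
      (\<integral>t. (indicator {0<..} (l n + t) * exp (- ((l n + t) * \<epsilon> n))) *\<^sub>R (of_real (kern t) * iexp (u * t)) \<partial>lborel)" for n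
  proof -
    have "(\<integral>v. of_real (kern (v - l n)) * iexp (u * (v - l n)) \<partial>exp_meas (\<epsilon> n)) =
      (\<integral>v. (indicator {0<..} v * exp (- (v * \<epsilon> n))) *\<^sub>R (of_real (kern (v - l n)) * iexp (u * (v - l n))) \<partial>lborel)"
      unfolding exp_meas_def by (subst integral_density) auto
    also have "\<dots> = (\<integral>t. (indicator {0<..} (l n + t) * exp (- ((l n + t) * \<epsilon> n))) *\<^sub>R (of_real (kern t) * iexp (u * t)) \<partial>lborel)"
      by (subst lborel_integral_real_affine[of 1 _ "l n"]) auto
    finally show ?thesis .
  qed
  show ?thesis unfolding eq
  proof (rule integral_dominated_convergence[where w = kern])
    show "integrable lborel kern" by (rule integrable_kern)
    show "AE t in lborel. (\<lambda>n. (indicator {0<..} (l n + t) * exp (- ((l n + t) * \<epsilon> n))) *\<^sub>R (of_real (kern t) * iexp (u * t)))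
        \<longlonglongrightarrow> of_real (kern t) * iexp (u * t)"
    proof (rule AE_I2)
      fix t
      have "eventually (\<lambda>n. l n > - t) sequentially"
        using l by (simp add: filterlim_at_top_dense)
      hence A: "(\<lambda>n. indicator {0<..} (l n + t) :: real) \<longlonglongrightarrow> 1"
        by (intro tendsto_eventually) (auto elim!: eventually_mono split: split_indicator)
      have B: "(\<lambda>n. exp (- (\<epsilon> n * l n + t * \<epsilon> n))) \<longlonglongrightarrow> exp (- (0 + t * 0))"
        by (intro tendsto_intros \<epsilon>)
      have "(\<lambda>n. (indicator {0<..} (l n + t) * exp (- (\<epsilon> n * l n + t * \<epsilon> n))) *\<^sub>R (of_real (kern t) * iexp (u * t)))
          \<longlonglongrightarrow> (1 * exp (- (0 + t * 0))) *\<^sub>R (of_real (kern t) * iexp (u * t))"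
        by (rule tendsto_scaleR[OF tendsto_mult[OF A B] tendsto_const])
      thus "(\<lambda>n. (indicator {0<..} (l n + t) * exp (- ((l n + t) * \<epsilon> n))) *\<^sub>R (of_real (kern t) * iexp (u * t)))
        \<longlonglongrightarrow> of_real (kern t) * iexp (u * t)"
        by (simp add: algebra_simps)
    qed
    show "AE t in lborel. norm ((indicator {0<..} (l n + t) * exp (- ((l n + t) * \<epsilon> n))) *\<^sub>R (of_real (kern t) * iexp (u * t))) \<le> kern t" for n
    proof (rule AE_I2)
      fix t
      have "indicator {0<..} (l n + t) * exp (- ((l n + t) * \<epsilon> n)) \<le> (1::real)"
        using \<epsilon>(1)[of n] by (auto split: split_indicator)
      thus "norm ((indicator {0<..} (l n + t) * exp (- ((l n + t) * \<epsilon> n))) *\<^sub>R (of_real (kern t) * iexp (u * t))) \<le> kern t"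
        using kern_nonneg[of t] by (simp add: norm_mult mult_left_le_one_le)
    qed
  qed auto
qed

text \<open>Moving \<epsilon> n to 0 costs \<open>D n\<close>, whatever the oscillating factor is,
  since that has modulus 1; \<open>D n\<close> vanishes by dominated convergence. At \<epsilon> = 0
  only the oscillation depends on n, and the Riemann-Lebesgue lemma applies.\<close>

lemma kern_error_limit:
  fixes G :: "complex \<Rightarrow> complex"
  assumes G: "continuous_on {s. Re s \<ge> 1} G"
    and l: "filterlim l at_top sequentially" and \<epsilon>: "\<And>n. \<epsilon> n > 0" "\<And>n. \<epsilon> n \<le> 1" "\<epsilon> \<longlonglongrightarrow> 0"
  shows "(\<lambda>n. \<integral>w. kern_hat w * iexp (- (w + u) * l n) * G (Complex (1 + \<epsilon> n) (- (w + u))) \<partial>lborel) \<longlonglongrightarrow> 0"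
proof -
  have Gc: "continuous_on UNIV (\<lambda>w. G (Complex (1 + e) (- (w + u))))" if "e \<ge> 0" for e
    by (rule continuous_on_compose2[OF G]) (use that in \<open>auto simp: Complex_eq intro!: continuous_intros\<close>)
  have Gm: "(\<lambda>w. G (Complex (1 + e) (- (w + u)))) \<in> borel_measurable borel" if "e \<ge> 0" for e
    using Gc[OF that] by (rule borel_measurable_continuous_onI)
  have [measurable]: "tri \<in> borel_measurable borel"
    by (intro borel_measurable_continuous_onI continuous_intros)
  have [measurable]: "kern_hat \<in> borel_measurable borel" unfolding kern_hat_def by measurable
  have int: "integrable lborel (\<lambda>w. kern_hat w * iexp (- (w + u) * a) * G (Complex (1 + e) (- (w + u))))" if "e \<ge> 0" for e a
    unfolding kern_hat_def mult.assoc by (intro integrable_tri_mult continuous_intros Gc that)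
  define D where "D = (\<lambda>n. \<integral>w. norm (kern_hat w) * norm (G (Complex (1 + \<epsilon> n) (- (w + u))) - G (Complex 1 (- (w + u)))) \<partial>lborel)"
  \<comment> \<open>The points \<open>Complex (1 + \<epsilon> n) (- (w + u))\<close> with w in
    [-1, 1] lie in this rectangle, as \<epsilon> n \<le> 1.\<close>
  have "compact (cbox (Complex 1 (-1 - \<bar>u\<bar>)) (Complex 2 (1 + \<bar>u\<bar>)))" by (rule compact_cbox)
  moreover have "continuous_on (cbox (Complex 1 (-1 - \<bar>u\<bar>)) (Complex 2 (1 + \<bar>u\<bar>))) G"
    by (rule continuous_on_subset[OF G]) (auto simp: in_cbox_complex_iff)
  ultimately have "bounded (G ` cbox (Complex 1 (-1 - \<bar>u\<bar>)) (Complex 2 (1 + \<bar>u\<bar>)))"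
    by (intro compact_imp_bounded compact_continuous_image)
  then obtain B where B: "\<And>s. s \<in> cbox (Complex 1 (-1 - \<bar>u\<bar>)) (Complex 2 (1 + \<bar>u\<bar>)) \<Longrightarrow> norm (G s) \<le> B"
    unfolding bounded_iff by (metis imageI)
  have kh: "norm (kern_hat w) \<le> 2 * indicator {-1..1} w" for w
  proof -
    have "norm (1 + iexp w) \<le> 2" using norm_triangle_ineq[of 1 "iexp w"] by simp
    hence "tri w * norm (1 + iexp w) \<le> 1 * 2" by (intro mult_mono) (auto simp: tri_bounds)
    thus ?thesis using tri_bounds[of w] by (auto simp: kern_hat_def norm_mult tri_def split: split_indicator)
  qed
  have "D \<longlonglongrightarrow> (\<integral>w. 0 \<partial>(lborel :: real measure))"
    unfolding D_def
  proof (rule integral_dominated_convergence[where w = "\<lambda>w. 2 * (B + B) * indicator {-1..1} w"])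
    show "(\<lambda>w. norm (kern_hat w) * norm (G (Complex (1 + \<epsilon> n) (- (w + u))) - G (Complex 1 (- (w + u))))) \<in> borel_measurable lborel" for n
    proof -
      have [measurable]: "(\<lambda>w. G (Complex (1 + \<epsilon> n) (- (w + u)))) \<in> borel_measurable borel"
        using \<epsilon>(1)[of n] by (intro Gm) simp
      have [measurable]: "(\<lambda>w. G (Complex 1 (- (w + u)))) \<in> borel_measurable borel"
        using Gm[of 0] by simp
      show ?thesis by measurable
    qed
    show "AE w in lborel. (\<lambda>n. norm (kern_hat w) * norm (G (Complex (1 + \<epsilon> n) (- (w + u))) - G (Complex 1 (- (w + u))))) \<longlonglongrightarrow> 0"
    proof (rule AE_I2)
      fix w
      have "(\<lambda>n. Complex (1 + \<epsilon> n) (- (w + u))) \<longlonglongrightarrow> Complex (1 + 0) (- (w + u))"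
        unfolding Complex_eq by (intro tendsto_intros \<epsilon>)
      hence "(\<lambda>n. G (Complex (1 + \<epsilon> n) (- (w + u)))) \<longlonglongrightarrow> G (Complex 1 (- (w + u)))"
        by (intro continuous_on_tendsto_compose[OF G]) (use \<epsilon>(1) in \<open>auto intro!: always_eventually less_imp_le\<close>)
      hence "(\<lambda>n. norm (G (Complex (1 + \<epsilon> n) (- (w + u))) - G (Complex 1 (- (w + u))))) \<longlonglongrightarrow> 0"
        by (intro tendsto_norm_zero) (simp add: LIM_zero)
      thus "(\<lambda>n. norm (kern_hat w) * norm (G (Complex (1 + \<epsilon> n) (- (w + u))) - G (Complex 1 (- (w + u))))) \<longlonglongrightarrow> 0"
        by (rule tendsto_mult_right_zero)
    qed
    show "AE w in lborel. norm (norm (kern_hat w) * norm (G (Complex (1 + \<epsilon> n) (- (w + u))) - G (Complex 1 (- (w + u))))) 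
       \<le> 2 * (B + B) * indicator {-1..1} w" for n
    proof (rule AE_I2)
      fix w
      show "norm (norm (kern_hat w) * norm (G (Complex (1 + \<epsilon> n) (- (w + u))) - G (Complex 1 (- (w + u))))) 
       \<le> 2 * (B + B) * indicator {-1..1} w"
      proof (cases "w \<in> {-1..1}")
        case True
        have "norm (G (Complex (1 + \<epsilon> n) (- (w + u))) - G (Complex 1 (- (w + u)))) \<le> B + B"
          by (intro order_trans[OF norm_triangle_ineq4] add_mono B)
             (use True \<epsilon>(1,2)[of n] in \<open>auto simp: in_cbox_complex_iff\<close>)
        moreover have "norm (kern_hat w) \<le> 2" using kh[of w] True by simp
        ultimately have "norm (kern_hat w) * norm (G (Complex (1 + \<epsilon> n) (- (w + u))) - G (Complex 1 (- (w + u)))) \<le> 2 * (B + B)"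
          by (intro mult_mono[of _ 2 _ "B + B"]) auto
        thus ?thesis using True by simp
      next
        case False
        thus ?thesis using kh[of w] by auto
      qed
    qed
  qed auto
  hence D: "D \<longlonglongrightarrow> 0" by simp
  define h where "h = (\<lambda>w. (1 + iexp w) * G (Complex (1 + 0) (- (w + u))))"
  have "continuous_on UNIV h" unfolding h_def by (intro continuous_intros Gc) auto
  from riemann_lebesgue_tri[OF this l]
  have R: "(\<lambda>n. \<integral>w. of_real (tri w) * h w * iexp (- w * l n) \<partial>lborel) \<longlonglongrightarrow> 0" .
  show ?thesis
  proof (rule Lim_null_comparison)
    show "(\<lambda>n. D n + norm (\<integral>w. of_real (tri w) * h w * iexp (- w * l n) \<partial>lborel)) \<longlonglongrightarrow> 0"
      using tendsto_add[OF D tendsto_norm_zero[OF R]] by simp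
    show "\<forall>\<^sub>F n in sequentially. norm (\<integral>w. kern_hat w * iexp (- (w + u) * l n) * G (Complex (1 + \<epsilon> n) (- (w + u))) \<partial>lborel)
        \<le> D n + norm (\<integral>w. of_real (tri w) * h w * iexp (- w * l n) \<partial>lborel)"
    proof (intro always_eventually allI)
      fix n
      let ?I = "\<lambda>e. \<integral>w. kern_hat w * iexp (- (w + u) * l n) * G (Complex (1 + e) (- (w + u))) \<partial>lborel"
      have gen: "norm (k * iexp a * v - k * iexp a * w) = norm k * norm (v - w)" for k v w :: complex and a :: real
      proof -
        have "k * E * v - k * E * w = k * E * (v - w)" for E by (rule right_diff_distrib[symmetric])
        from this[of "iexp a"] show ?thesis by (metis norm_mult norm_exp_i_times mult_1_right)
      qed
      have diff: "?I (\<epsilon> n) - ?I 0 = (\<integral>w. kern_hat w * iexp (- (w + u) * l n) * G (Complex (1 + \<epsilon> n) (- (w + u)))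
            - kern_hat w * iexp (- (w + u) * l n) * G (Complex (1 + 0) (- (w + u))) \<partial>lborel)"
        by (rule Bochner_Integration.integral_diff[symmetric]) (use int[of "\<epsilon> n" "l n"] int[of 0 "l n"] \<epsilon>(1)[of n] in auto)
      have "norm (?I (\<epsilon> n) - ?I 0) \<le> (\<integral>w. norm (kern_hat w * iexp (- (w + u) * l n) * G (Complex (1 + \<epsilon> n) (- (w + u)))
            - kern_hat w * iexp (- (w + u) * l n) * G (Complex (1 + 0) (- (w + u)))) \<partial>lborel)"
        unfolding diff by (rule integral_norm_bound)
      hence d: "norm (?I (\<epsilon> n) - ?I 0) \<le> D n"
        by (simp only: D_def gen add_0_right)
      have I0: "?I 0 = (\<integral>w. iexp (- u * l n) * (of_real (tri w) * h w * iexp (- w * l n)) \<partial>lborel)"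
      proof (rule Bochner_Integration.integral_cong)
        fix w
        have "- (w + u) * l n = - u * l n + - w * l n" by (simp add: algebra_simps)
        hence "iexp (- (w + u) * l n) = iexp (- u * l n) * iexp (- w * l n)"
          by (simp only: of_real_add distrib_left exp_add)
        thus "kern_hat w * iexp (- (w + u) * l n) * G (Complex (1 + 0) (- (w + u))) = 
              iexp (- u * l n) * (of_real (tri w) * h w * iexp (- w * l n))"
          unfolding kern_hat_def h_def by (simp only: mult_ac)
      qed auto
      have "norm (?I 0) = norm (\<integral>w. of_real (tri w) * h w * iexp (- w * l n) \<partial>lborel)"
        unfolding I0 by (simp only: Bochner_Integration.integral_mult_right_zero norm_mult norm_exp_i_times mult_1_left)
      with d show "norm (?I (\<epsilon> n)) \<le> D n + norm (\<integral>w. of_real (tri w) * h w * iexp (- w * l n) \<partial>lborel)"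
        using norm_triangle_ineq2[of "?I (\<epsilon> n)" "?I 0"] by linarith
    qed
  qed
qed

lemma kern_prime_meas_limit:
  assumes l: "filterlim l at_top sequentially" and \<epsilon>: "\<And>n. \<epsilon> n > 0" "\<And>n. \<epsilon> n \<le> 1" "\<epsilon> \<longlonglongrightarrow> 0" "(\<lambda>n. \<epsilon> n * l n) \<longlonglongrightarrow> 0"
  shows "(\<lambda>n. \<integral>v. of_real (kern (v - l n)) * iexp (u * (v - l n)) \<partial>prime_meas (\<epsilon> n))
           \<longlonglongrightarrow> (\<integral>t. of_real (kern t) * iexp (u * t) \<partial>lborel)"
proof -
  obtain G :: "complex \<Rightarrow> complex" where G: "continuous_on {s. Re s \<ge> 1} G"
    "\<And>\<epsilon> y. \<epsilon> > 0 \<Longrightarrow> char (prime_meas \<epsilon>) y = char (exp_meas \<epsilon>) y + G (Complex (1 + \<epsilon>) (- y))"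
    using char_prime_meas by blast
  have eq: "(\<integral>v. of_real (kern (v - l n)) * iexp (u * (v - l n)) \<partial>prime_meas (\<epsilon> n)) =
      (\<integral>v. of_real (kern (v - l n)) * iexp (u * (v - l n)) \<partial>exp_meas (\<epsilon> n)) +
      (\<integral>w. kern_hat w * iexp (- (w + u) * l n) * G (Complex (1 + \<epsilon> n) (- (w + u))) \<partial>lborel)" for n
  proof -
    have i1: "integrable lborel (\<lambda>w. kern_hat w * iexp (- (w + u) * l n) * char (exp_meas (\<epsilon> n)) (w + u))"
    proof -
      have "of_real (\<epsilon> n) - \<i> * of_real (w + u) \<noteq> 0" for w
        using \<epsilon>(1)[of n] by (auto simp: complex_eq_iff)
      thus ?thesis unfolding char_exp_meas[OF \<epsilon>(1)] kern_hat_def mult.assoc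
        by (intro integrable_tri_mult continuous_intros) blast
    qed
    have i2: "integrable lborel (\<lambda>w. kern_hat w * iexp (- (w + u) * l n) * G (Complex (1 + \<epsilon> n) (- (w + u))))"
      unfolding kern_hat_def mult.assoc
      by (intro integrable_tri_mult continuous_intros continuous_on_compose2[OF G(1)])
         (use \<epsilon>(1)[of n] in \<open>auto simp: Complex_eq intro!: continuous_intros\<close>)
    show ?thesis
      unfolding kern_fubini[OF finite_prime_meas[OF \<epsilon>(1)] sets_prime_meas] kern_fubini[OF finite_exp_meas[OF \<epsilon>(1)] sets_exp_meas]
      unfolding G(2)[OF \<epsilon>(1)] distrib_left by (rule Bochner_Integration.integral_add[OF i1 i2])
  qed
  show ?thesis unfolding eq
    using tendsto_add[OF kern_exp_meas_limit[OF l \<epsilon>(1,3,4)] kern_error_limit[OF G(1) l \<epsilon>(1-3)]] by simp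
qed

section \<open>Sums of 1 / p^2 over large primes\<close>

text \<open>The numerators of the two Fejer kernels cannot vanish together: cos t + cos (t + 1) = 2
  cos (t + 1/2) cos (1/2) stays away from 2. Hence kern t \<ge> 4 c / (t + 1)^2 with c = 1 - cos
  (1/2), and (t + 1)^2 \<le> 4 exp t absorbs the quadratic decay.\<close>

lemma exp_over_kern_le:
  assumes "t > 0"
  shows "kern t > 0" "exp (-t) / kern t \<le> 1 / (1 - cos (1/2))"
proof -
  define c :: real where "c = 1 - cos (1/2)"
  have c: "c > 0"
    using cos_monotone_0_pi[of 0 "1/2"] pi_gt3 by (simp add: c_def)
  have "cos t + cos (t + 1) = 2 * cos (t + 1/2) * cos (1/2)"
    using cos_plus_cos[of t "t + 1"] by (simp add: field_simps)
  also have "\<dots> \<le> 2 * cos (1/2)"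
    using cos_le_one[of "t + 1/2"] cos_gt_zero[of "1/2"] pi_gt3
      mult_right_mono[of "cos (t + 1/2)" 1 "2 * cos (1/2)"] by simp
  finally have cc: "4 * c \<le> 2 * (1 - cos t) + 2 * (1 - cos (t + 1))" by (simp add: c_def)
  have "4 * c / (t + 1)\<^sup>2 \<le> (2 * (1 - cos t) + 2 * (1 - cos (t + 1))) / (t + 1)\<^sup>2"
    using cc by (intro divide_right_mono) auto
  also have "\<dots> = 2 * (1 - cos t) / (t + 1)\<^sup>2 + 2 * (1 - cos (t + 1)) / (t + 1)\<^sup>2"
    by (rule add_divide_distrib)
  also have "2 * (1 - cos t) / (t + 1)\<^sup>2 \<le> 2 * (1 - cos t) / t\<^sup>2"
    using assms by (intro divide_left_mono power_mono mult_pos_pos) auto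
  finally have k: "4 * c / (t + 1)\<^sup>2 \<le> kern t"
    using assms by (simp add: kern_def fejer_def)
  moreover have "4 * c / (t + 1)\<^sup>2 > 0" using c assms by simp
  ultimately show kpos: "kern t > 0" by linarith
  have "(1 + t / 2) ^ 2 \<le> exp (t / 2) ^ 2"
    using exp_ge_add_one_self[of "t/2"] assms by (intro power_mono) auto
  also have "exp (t / 2) ^ 2 = exp t" by (simp add: exp_double[symmetric])
  finally have "(1 + t / 2) ^ 2 \<le> exp t" .
  moreover have "(t + 1) ^ 2 \<le> 4 * (1 + t / 2) ^ 2"
    using assms by (simp add: power2_eq_square field_simps)
  ultimately have e: "(t + 1) ^ 2 \<le> 4 * exp t" by linarith
  have "exp (-t) / kern t \<le> exp (-t) / (4 * c / (t + 1)\<^sup>2)"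
    using k c assms kpos by (intro divide_left_mono mult_pos_pos) auto
  also have "\<dots> = (t + 1)\<^sup>2 * exp (-t) / (4 * c)" by (simp add: field_simps)
  also have "\<dots> \<le> 4 * exp t * exp (-t) / (4 * c)"
    using e c by (intro divide_right_mono mult_right_mono) auto
  also have "\<dots> = 1 / c" by (simp add: exp_minus field_simps)
  finally show "exp (-t) / kern t \<le> 1 / (1 - cos (1/2))" by (simp add: c_def)
qed

lemma kern_bounds: "kern t \<le> 16" "0 \<le> kern t"
proof -
  have "fejer s \<le> 8" for s
    using fejer_le[of s] by (rule order_trans) (simp add: field_simps add_pos_nonneg)
  from this[of t] this[of "t + 1"] show "kern t \<le> 16" by (simp add: kern_def)
qed (rule kern_nonneg)

lemma kern_integral_pos: "(\<integral>t. kern t \<partial>lborel) > 0"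
proof -
  have "(\<integral>t. kern t \<partial>lborel) \<noteq> 0"
  proof
    assume "(\<integral>t. kern t \<partial>lborel) = 0"
    hence "AE t in lborel. kern t = 0"
      using integral_nonneg_eq_0_iff_AE[OF integrable_kern] kern_nonneg by simp
    moreover have "kern t \<noteq> 0" if "t \<in> {1..2}" for t
      using exp_over_kern_le(1)[of t] that by auto
    ultimately have "AE t in lborel. t \<notin> {1..2::real}"
      by (elim eventually_mono) blast
    hence "{1..2::real} \<in> null_sets lborel" by (intro AE_iff_null_sets[THEN iffD2]) auto
    hence "emeasure lborel {1..2::real} = 0" by (rule null_setsD1)
    thus False by simp
  qed
  moreover have "(\<integral>t. kern t \<partial>lborel) \<ge> 0"
    by (intro Bochner_Integration.integral_nonneg kern_nonneg)
  ultimately show ?thesis by simp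
qed

text \<open>Dividing the test function by the kernel removes the Fejer weight again.\<close>

lemma kern_test_limit:
  assumes M: "\<And>n. finite_measure (M n)" "\<And>n. sets (M n) = sets borel"
    and lim: "\<And>u. (\<lambda>n. \<integral>v. of_real (kern (v - l n)) * iexp (u * (v - l n)) \<partial>M n)
           \<longlonglongrightarrow> (\<integral>t. of_real (kern t) * iexp (u * t) \<partial>lborel)"
  shows "(\<lambda>n. \<integral>v. indicator {0<..} (v - l n) * exp (- (v - l n)) \<partial>M n) \<longlonglongrightarrow> 1"
proof -
  define C where "C = (\<integral>t. kern t \<partial>lborel)"
  have C: "C > 0" unfolding C_def by (rule kern_integral_pos)
  define N where "N = (\<lambda>n. distr (M n) borel (\<lambda>v. v - l n))"
  have Nsets [simp, measurable_cong]: "sets (N n) = sets borel" for n by (simp add: N_def)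
  have meas: "(\<lambda>v. v - l n) \<in> measurable (M n) borel" for n
    using M(2)[of n] by (simp cong: measurable_cong_sets)
  have Nfin: "finite_measure (N n)" for n
    unfolding N_def by (rule finite_measure.finite_measure_distr[OF M(1) meas])
  have Nint: "(\<integral>t. f t \<partial>N n) = (\<integral>v. f (v - l n) \<partial>M n)" if "f \<in> borel_measurable borel" 
    for n and f :: "real \<Rightarrow> 'b :: {banach, second_countable_topology}"
    unfolding N_def by (rule integral_distr[OF meas that])
  define c where "c = (\<lambda>n. \<integral>t. kern t \<partial>N n)"
  have kint: "integrable (N n) kern" for n
    by (rule finite_measure.integrable_const_bound[OF Nfin, of _ 16]) (use kern_bounds in auto)
  \<comment> \<open>The case u = 0 gives convergence of the total masses, by which the weighted
    measures are normalised.\<close>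
  have "(\<lambda>n. complex_of_real (c n)) \<longlonglongrightarrow> complex_of_real C"
    using lim[of 0] by (simp add: c_def C_def Nint)
  hence cC: "c \<longlonglongrightarrow> C" by (simp add: tendsto_of_real_iff)
  \<comment> \<open>Levy's theorem wants a probability measure at every index; the point mass fills
    in at the finitely many indices where c n is not positive.\<close>
  define \<mu> where "\<mu> = (\<lambda>n. if c n > 0 then density (N n) (\<lambda>t. ennreal (kern t / c n)) else return borel 0)"
  define \<mu>' where "\<mu>' = density lborel (\<lambda>t. ennreal (kern t / C))"
  have prob_density: "real_distribution (density Q (\<lambda>t. ennreal (kern t / a)))"
    if "a > 0" "a = (\<integral>t. kern t \<partial>Q)" "integrable Q kern" "sets Q = sets borel" for Q :: "real measure" and a
  proof -
    note [measurable_cong] = that(4)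
    have "emeasure (density Q (\<lambda>t. ennreal (kern t / a))) (space (density Q (\<lambda>t. ennreal (kern t / a)))) = (\<integral>\<^sup>+t. ennreal (kern t / a) \<partial>Q)"
      by (simp add: emeasure_density cong: nn_integral_cong)
    also have "\<dots> = ennreal (\<integral>t. kern t / a \<partial>Q)"
      using that kern_nonneg by (intro nn_integral_eq_integral) auto
    also have "(\<integral>t. kern t / a \<partial>Q) = 1" using that by simp
    finally have "prob_space (density Q (\<lambda>t. ennreal (kern t / a)))" by (intro prob_spaceI) simp
    thus ?thesis using that(4) by (simp add: real_distribution_def real_distribution_axioms_def)
  qed
  have \<mu>: "real_distribution (\<mu> n)" for n
    unfolding \<mu>_def using prob_density[OF _ _ kint Nsets, of "c n"] prob_space_return[of 0 "borel :: real measure"]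
    by (auto simp: c_def real_distribution_def real_distribution_axioms_def)
  have \<mu>': "real_distribution \<mu>'"
    unfolding \<mu>'_def by (rule prob_density) (use C in \<open>auto simp: C_def integrable_kern\<close>)
  have dens: "(\<integral>t. f t \<partial>density Q (\<lambda>t. ennreal (kern t / a))) = (\<integral>t. (kern t / a) *\<^sub>R f t \<partial>Q)"
    if "a > 0" "sets Q = sets borel" "f \<in> borel_measurable borel" 
    for Q :: "real measure" and a and f :: "real \<Rightarrow> 'b :: {banach, second_countable_topology}"
    using that kern_nonneg by (intro integral_density) (auto cong: measurable_cong_sets)
  have evc: "eventually (\<lambda>n. c n > 0) sequentially" by (rule order_tendstoD(1)[OF cC C])
  have "weak_conv_m \<mu> \<mu>'"
  proof (rule levy_continuity[OF \<mu> \<mu>'])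
    fix u
    have "(\<lambda>n. (\<integral>v. of_real (kern (v - l n)) * iexp (u * (v - l n)) \<partial>M n) / of_real (c n))
        \<longlonglongrightarrow> (\<integral>t. of_real (kern t) * iexp (u * t) \<partial>lborel) / of_real C"
      using C by (intro tendsto_divide lim tendsto_of_real cC) auto
    also have "(\<integral>t. of_real (kern t) * iexp (u * t) \<partial>lborel) / of_real C = char \<mu>' u"
      unfolding char_def \<mu>'_def using C by (subst dens) (auto simp: scaleR_conv_of_real)
    finally show "(\<lambda>n. char (\<mu> n) u) \<longlonglongrightarrow> char \<mu>' u"
    proof (rule Lim_transform_eventually)
      show "\<forall>\<^sub>F n in sequentially. (\<integral>v. of_real (kern (v - l n)) * iexp (u * (v - l n)) \<partial>M n) / of_real (c n) = char (\<mu> n) u"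
        using evc
      proof eventually_elim
        case (elim n)
        have "char (\<mu> n) u = (\<integral>t. (kern t / c n) *\<^sub>R iexp (u * t) \<partial>N n)"
          using elim by (simp add: \<mu>_def char_def dens)
        also have "\<dots> = (\<integral>v. (kern (v - l n) / c n) *\<^sub>R iexp (u * (v - l n)) \<partial>M n)"
          by (rule Nint) auto
        finally show ?case by (simp add: scaleR_conv_of_real)
      qed
    qed
  qed
  \<comment> \<open>Bounded by \<open>exp_over_kern_le\<close> and continuous except at 0, a point
    without mass for the limit measure; so weak convergence may be tested on it.\<close>
  define f where "f = (\<lambda>t. if t > 0 then exp (-t) / kern t else 0)"
  have fk: "kern t * f t = indicator {0<..} t * exp (-t)" for t
    using exp_over_kern_le(1)[of t] by (auto simp: f_def split: split_indicator)
  have fmeas [measurable]: "f \<in> borel_measurable borel" unfolding f_def by measurable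
  have "(\<lambda>n. integral\<^sup>L (\<mu> n) f) \<longlonglongrightarrow> integral\<^sup>L \<mu>' f"
  proof (rule weak_conv_imp_bdd_ae_continuous_conv[OF \<mu> \<mu>' \<open>weak_conv_m \<mu> \<mu>'\<close>])
    have "isCont f t" if "t \<noteq> 0" for t
    proof (cases "t > 0")
      case True
      have "isCont (\<lambda>t. exp (-t) / (2 * (1 - cos t) / t\<^sup>2 + 2 * (1 - cos (t + 1)) / (t + 1)\<^sup>2)) t"
        using True exp_over_kern_le(1)[of t] by (intro continuous_intros) (auto simp: kern_def fejer_def)
      moreover have "\<forall>\<^sub>F s in nhds t. f s = exp (-s) / (2 * (1 - cos s) / s\<^sup>2 + 2 * (1 - cos (s + 1)) / (s + 1)\<^sup>2)"
        using eventually_nhds_in_open[of "{0<..}" t] True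
        by (auto elim!: eventually_mono simp: f_def kern_def fejer_def)
      ultimately show ?thesis by (simp only: isCont_cong)
    next
      case False
      have "\<forall>\<^sub>F s in nhds t. f s = 0"
        using eventually_nhds_in_open[of "{..<0}" t] that False
        by (auto elim!: eventually_mono simp: f_def)
      hence "isCont f t \<longleftrightarrow> isCont (\<lambda>_. 0 :: real) t" by (rule isCont_cong)
      thus ?thesis by simp
    qed
    hence sub: "{t. \<not> isCont f t} \<subseteq> {0}" by auto
    have "emeasure \<mu>' {0} = 0"
      unfolding \<mu>'_def by (subst emeasure_density) (auto simp: nn_integral_indicator_singleton)
    thus "emeasure \<mu>' {t. \<not> isCont f t} = 0"
      using emeasure_mono[OF sub, of \<mu>'] by (simp add: \<mu>'_def)
    show "norm (f t) \<le> 1 / (1 - cos (1/2))" for t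
      using exp_over_kern_le[of t] cos_le_one[of "1/2"] by (auto simp: f_def)
  qed auto
  hence "(\<lambda>n. c n * integral\<^sup>L (\<mu> n) f) \<longlonglongrightarrow> C * integral\<^sup>L \<mu>' f"
    by (intro tendsto_mult cC)
  also have "C * integral\<^sup>L \<mu>' f = (\<integral>t. indicator {0<..} t * exp (-t) \<partial>lborel)"
  proof -
    have "integral\<^sup>L \<mu>' f = (\<integral>t. (kern t / C) *\<^sub>R f t \<partial>lborel)"
      unfolding \<mu>'_def using C by (intro dens) auto
    also have "\<dots> = (\<integral>t. indicator {0<..} t * exp (-t) \<partial>lborel) / C" by (simp add: fk)
    finally show ?thesis using C by simp
  qed
  also have "(\<integral>t. indicator {0<..} t * exp (-t) \<partial>lborel) = (1::real)"
    using has_bochner_integral_I0i_power_exp_m[of 0] by (auto simp: mult.commute dest!: has_bochner_integral_integral_eq)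
  finally show ?thesis
  proof (rule Lim_transform_eventually)
    show "\<forall>\<^sub>F n in sequentially. c n * integral\<^sup>L (\<mu> n) f = (\<integral>v. indicator {0<..} (v - l n) * exp (- (v - l n)) \<partial>M n)"
      using evc
    proof eventually_elim
      case (elim n)
      have "integral\<^sup>L (\<mu> n) f = (\<integral>t. (kern t / c n) *\<^sub>R f t \<partial>N n)"
        using elim by (simp add: \<mu>_def dens)
      also have "\<dots> = (\<integral>t. indicator {0<..} t * exp (-t) \<partial>N n) / c n" by (simp add: fk)
      also have "(\<integral>t. indicator {0<..} t * exp (-t) \<partial>N n) = (\<integral>v. indicator {0<..} (v - l n) * exp (- (v - l n)) \<partial>M n)"
        by (rule Nint) auto
      finally show ?case using elim by simp
    qed
  qed
qed

lemma suminf_tail_tendsto_0: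
  fixes f :: "nat \<Rightarrow> real"
  assumes f: "summable f" "\<And>n. f n \<ge> 0" and x: "filterlim x at_top sequentially"
  shows "(\<lambda>n. \<Sum>k. if real k > x n then f k else 0) \<longlonglongrightarrow> 0"
proof -
  have "(\<lambda>n. if real k > x n then f k else 0) \<longlonglongrightarrow> 0" for k
  proof (rule tendsto_eventually)
    have "eventually (\<lambda>n. x n > real k) sequentially" using x by (simp add: filterlim_at_top_dense)
    thus "eventually (\<lambda>n. (if real k > x n then f k else 0) = 0) sequentially"
      by eventually_elim auto
  qed
  hence "eventually (\<lambda>n. summable (\<lambda>k. norm (if real k > x n then f k else 0))) sequentially \<and>
           summable (\<lambda>n::nat. norm (0::real)) \<and>
           ((\<lambda>n. \<Sum>k. if real k > x n then f k else 0) \<longlonglongrightarrow> suminf (\<lambda>k. 0 :: real))"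
    by (rule tannerys_theorem[where M = f, OF _ always_eventually]) (use f in auto)
  thus ?thesis by simp
qed

section \<open>Asymptotics of the sum of 1 / p^2 over p > x\<close>

definition prime_tail :: "real \<Rightarrow> real" where
  "prime_tail x = (\<Sum>k. if prime k \<and> real k > x then 1 / real k ^ 2 else 0)"

text \<open>The damping exponent is taken to be \<open>\<epsilon> = 1 / x\<close>: it keeps all sums absolutely convergent and
  changes the sum over \<open>p > x\<close> only by a tail of \<open>\<Sum>_n (ln n / n)^2\<close>.\<close>

lemma log_prime_tail_tendsto:
  assumes x: "filterlim x at_top sequentially" and x1: "\<And>n. x n > 1"
  shows "(\<lambda>n. \<Sum>k. if real k > x n then log_prime k * real k powr (-2 - 1 / x n) * x n else 0) \<longlonglongrightarrow> 1"
proof -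
  have x0: "x n > 0" for n using x1[of n] by simp
  have l: "filterlim (\<lambda>n. ln (x n)) at_top sequentially"
    using ln_at_top x by (rule filterlim_compose)
  have e0: "(\<lambda>n. 1 / x n) \<longlonglongrightarrow> 0"
    by (rule real_tendsto_divide_at_top[OF tendsto_const x])
  \<comment> \<open>With \<epsilon> = 1 / x, this is the condition \<epsilon> ln x \<longrightarrow>
    0 of the kernel limits.\<close>
  have "((\<lambda>x::real. 1 / x * ln x) \<longlongrightarrow> 0) at_top" by real_asymp
  hence el: "(\<lambda>n. 1 / x n * ln (x n)) \<longlonglongrightarrow> 0" using x by (rule filterlim_compose)
  have "(\<lambda>n. \<integral>v. indicator {0<..} (v - ln (x n)) * exp (- (v - ln (x n))) \<partial>prime_meas (1 / x n)) \<longlonglongrightarrow> 1"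
  proof (rule kern_test_limit)
    show "finite_measure (prime_meas (1 / x n))" for n using x0[of n] by (intro finite_prime_meas) simp
    show "(\<lambda>n. \<integral>v. of_real (kern (v - ln (x n))) * iexp (u * (v - ln (x n))) \<partial>prime_meas (1 / x n))
           \<longlonglongrightarrow> (\<integral>t. of_real (kern t) * iexp (u * t) \<partial>lborel)" for u
      by (rule kern_prime_meas_limit[OF l _ _ e0 el]) (use x0 x1 in \<open>auto simp: field_simps less_imp_le\<close>)
  qed simp
  also have "(\<lambda>n. \<integral>v. indicator {0<..} (v - ln (x n)) * exp (- (v - ln (x n))) \<partial>prime_meas (1 / x n)) =
    (\<lambda>n. \<Sum>k. if real k > x n then log_prime k * real k powr (-2 - 1 / x n) * x n else 0)"
  proof
    fix n
    have "(\<lambda>k. (log_prime k * real k powr (-1 - 1 / x n)) *\<^sub>R (indicator {0<..} (ln (real k) - ln (x n)) * exp (- (ln (real k) - ln (x n)))))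
      sums (\<integral>v. indicator {0<..} (v - ln (x n)) * exp (- (v - ln (x n))) \<partial>prime_meas (1 / x n))"
      by (rule integral_prime_meas[where B = 1]) (use x0[of n] in \<open>auto split: split_indicator\<close>)
    also have "(\<lambda>k. (log_prime k * real k powr (-1 - 1 / x n)) *\<^sub>R (indicator {0<..} (ln (real k) - ln (x n)) * exp (- (ln (real k) - ln (x n))))) =
      (\<lambda>k. if real k > x n then log_prime k * real k powr (-2 - 1 / x n) * x n else 0)"
    proof
      fix k
      show "(log_prime k * real k powr (-1 - 1 / x n)) *\<^sub>R (indicator {0<..} (ln (real k) - ln (x n)) * exp (- (ln (real k) - ln (x n)))) =
        (if real k > x n then log_prime k * real k powr (-2 - 1 / x n) * x n else 0)"
      proof (cases "prime k")
        case True
        hence k: "real k > 0" by (simp add: prime_gt_0_nat)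
        have "exp (- (ln (real k) - ln (x n))) = x n / real k"
          using k x0[of n] by (simp add: exp_diff)
        moreover have "real k powr (-2 - 1 / x n) = real k powr (-1 - 1 / x n) / real k"
        proof -
          have "-2 - 1 / x n = (-1 - 1 / x n) - 1" by simp
          thus ?thesis using k by (simp only: powr_diff powr_one)
        qed
        ultimately show ?thesis using k x0[of n] by (auto split: split_indicator)
      qed (simp add: log_prime_def)
    qed
    finally show "(\<integral>v. indicator {0<..} (v - ln (x n)) * exp (- (v - ln (x n))) \<partial>prime_meas (1 / x n)) = 
       (\<Sum>k. if real k > x n then log_prime k * real k powr (-2 - 1 / x n) * x n else 0)"
      by (rule sums_unique)
  qed
  finally show ?thesis .
qed

lemma summable_log_sq: "summable (\<lambda>k. ln (real k) ^ 2 * real k powr -2)"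
proof (rule summable_comparison_test')
  show "summable (\<lambda>k. 16 * real k powr (-3/2))"
    by (intro summable_mult) (simp add: summable_real_powr_iff)
  fix k :: nat assume k: "k \<ge> 1"
  have "ln (real k) \<le> 4 * real k powr (1/4)"
    using ln_powr_bound[of "real k" "1/4"] k by simp
  hence "ln (real k) ^ 2 \<le> (4 * real k powr (1/4)) ^ 2"
    using k by (intro power_mono) auto
  also have "\<dots> = 16 * real k powr (1/2)"
    by (simp add: power_mult_distrib power2_eq_square powr_add[symmetric])
  finally have "ln (real k) ^ 2 * real k powr -2 \<le> 16 * real k powr (1/2) * real k powr -2"
    by (intro mult_right_mono) auto
  also have "\<dots> = 16 * real k powr (-3/2)" by (simp add: powr_add[symmetric])
  finally show "norm (ln (real k) ^ 2 * real k powr -2) \<le> 16 * real k powr (-3/2)" by simp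
qed

lemma summable_prime_tail: "summable (\<lambda>k. if prime k \<and> real k > x then 1 / real k ^ 2 else 0)"
  by (rule summable_comparison_test'[OF inverse_power_summable[of 2 , where ?'a = real], of 0])
     (auto simp: divide_inverse)

text \<open>Two weights have to be removed from the sum S. For the upper bound, ln x \<le> ln p and
  p^(-1/x) \<ge> 1 - ln p / x leave a tail of the sum of (ln k / k)^2. For the lower bound the
  damping is dropped and the primes are split at x^(1+\<eta>): below, ln p is at most (1+\<eta>) ln
  x; beyond, x \<le> p^(1/(1+\<eta>)) leaves a tail of another convergent series.\<close>

lemma prime_tail_asymp_aux:
  assumes x: "filterlim x at_top sequentially" and x1: "\<And>n. x n > 1"
  shows "(\<lambda>n. x n * ln (x n) * prime_tail (x n)) \<longlonglongrightarrow> 1"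
proof -
  define A where "A = (\<lambda>n. x n * ln (x n) * prime_tail (x n))"
  define t where "t = (\<lambda>n k. if real k > x n then log_prime k * real k powr (-2 - 1 / x n) * x n else 0)"
  define S where "S = (\<lambda>n. \<Sum>k. t n k)"
  have S: "S \<longlonglongrightarrow> 1" unfolding S_def t_def by (rule log_prime_tail_tendsto[OF x x1])
  have x0: "x n > 0" for n using x1[of n] by simp
  have lnx: "ln (x n) > 0" for n using x1[of n] by simp
  have sumt: "summable (t n)" for n
  proof (rule summable_comparison_test')
    show "summable (\<lambda>k. log_prime k * real k powr (- (2 + 1 / x n)) * x n)"
      using x0[of n] by (intro summable_mult2 summable_log_prime) (simp add: add_pos_pos)
    show "norm (t n k) \<le> log_prime k * real k powr (- (2 + 1 / x n)) * x n" for k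
      using x0[of n] by (auto simp: t_def)
  qed
  have A_eq: "A n = (\<Sum>k. x n * ln (x n) * (if prime k \<and> real k > x n then 1 / real k ^ 2 else 0))" for n
    unfolding A_def prime_tail_def by (rule suminf_mult[OF summable_prime_tail, symmetric])
  have sumA: "summable (\<lambda>k. x n * ln (x n) * (if prime k \<and> real k > x n then 1 / real k ^ 2 else 0))" for n
    by (rule summable_mult[OF summable_prime_tail])
  have sumtail: "summable (\<lambda>k. if real k > x n then f k else 0)" if "summable f" "\<And>k. f k \<ge> 0" for f :: "nat \<Rightarrow> real" and n
    by (rule summable_comparison_test'[OF that(1), of 0]) (auto simp: that(2))
  have upper: "A n \<le> S n + (\<Sum>k. if real k > x n then ln (real k) ^ 2 * real k powr -2 else 0)" for n
  proof -
    have "A n \<le> (\<Sum>k. t n k + (if real k > x n then ln (real k) ^ 2 * real k powr -2 else 0))"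
      unfolding A_eq
    proof (rule suminf_le[OF _ sumA])
      show "summable (\<lambda>k. t n k + (if real k > x n then ln (real k) ^ 2 * real k powr -2 else 0))"
        by (intro summable_add sumt sumtail summable_log_sq) auto
      fix k
      show "x n * ln (x n) * (if prime k \<and> real k > x n then 1 / real k ^ 2 else 0)
         \<le> t n k + (if real k > x n then ln (real k) ^ 2 * real k powr -2 else 0)"
      proof (cases "prime k \<and> real k > x n")
        case True
        hence k: "real k > 0" "ln (real k) > 0" using x1[of n] by auto
        have "real k powr (- 1 / x n) = exp (- (ln (real k) / x n))"
          using k by (simp add: powr_def)
        hence "1 - ln (real k) / x n \<le> real k powr (- 1 / x n)"
          using exp_ge_add_one_self[of "- (ln (real k) / x n)"] by simp
        hence "real k powr -2 * (1 - ln (real k) / x n) \<le> real k powr -2 * real k powr (- 1 / x n)"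
          by (intro mult_left_mono) auto
        also have "\<dots> = real k powr (-2 - 1 / x n)" by (simp add: powr_add[symmetric])
        finally have "ln (real k) * x n * (real k powr -2 * (1 - ln (real k) / x n)) \<le> ln (real k) * x n * real k powr (-2 - 1 / x n)"
          using k x0[of n] by (intro mult_left_mono) auto
        moreover have "ln (real k) * x n * (real k powr -2 * (1 - ln (real k) / x n)) = 
           ln (real k) * x n * real k powr -2 - ln (real k) ^ 2 * real k powr -2"
          using x0[of n] by (simp add: field_simps power2_eq_square)
        moreover have "x n * ln (x n) * real k powr -2 \<le> x n * ln (real k) * real k powr -2"
          using True x0[of n] by (intro mult_left_mono mult_right_mono) auto
        moreover have "1 / real k ^ 2 = real k powr -2"
          using k by (simp add: powr_minus divide_inverse)
        ultimately show ?thesis using True by (simp add: t_def log_prime_def mult_ac)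
      qed (use x0[of n] in \<open>auto simp: t_def\<close>)
    qed
    also have "\<dots> = S n + (\<Sum>k. if real k > x n then ln (real k) ^ 2 * real k powr -2 else 0)"
      unfolding S_def by (intro suminf_add[symmetric] sumt sumtail summable_log_sq) auto
    finally show ?thesis .
  qed
  have lower: "S n \<le> (1 + \<eta>) * A n + (\<Sum>k. if real k > x n then ln (real k) * real k powr (- (2 - 1 / (1 + \<eta>))) else 0)"
    if \<eta>: "\<eta> > 0" for n \<eta>
  proof -
    let ?f = "\<lambda>k. ln (real k) * real k powr (- (2 - 1 / (1 + \<eta>)))"
    have sumf: "summable ?f" using \<eta> by (intro summable_log_powr) (simp add: field_simps)
    have fpos: "?f k \<ge> 0" for k by (cases "k = 0") auto
    have "S n \<le> (\<Sum>k. (1 + \<eta>) * (x n * ln (x n) * (if prime k \<and> real k > x n then 1 / real k ^ 2 else 0)) + (if real k > x n then ?f k else 0))"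
      unfolding S_def
    proof (rule suminf_le[OF _ sumt])
      show "summable (\<lambda>k. (1 + \<eta>) * (x n * ln (x n) * (if prime k \<and> real k > x n then 1 / real k ^ 2 else 0)) + (if real k > x n then ?f k else 0))"
        by (intro summable_add summable_mult[OF sumA] sumtail sumf fpos)
      fix k
      show "t n k \<le> (1 + \<eta>) * (x n * ln (x n) * (if prime k \<and> real k > x n then 1 / real k ^ 2 else 0)) + (if real k > x n then ?f k else 0)"
      proof (cases "prime k \<and> real k > x n")
        case True
        hence k: "real k > 1" "ln (real k) > 0" using x1[of n] by auto
        have p2: "1 / real k ^ 2 = real k powr -2"
          using k by (simp add: powr_minus divide_inverse)
        have "t n k \<le> ln (real k) * real k powr -2 * x n"
          using True k x0[of n] by (auto simp: t_def log_prime_def intro!: mult_right_mono mult_left_mono powr_mono)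
        also have "\<dots> \<le> (1 + \<eta>) * (x n * ln (x n) * real k powr -2) + ?f k"
        proof (cases "ln (real k) \<le> (1 + \<eta>) * ln (x n)")
          case True
          hence "ln (real k) * (real k powr -2 * x n) \<le> (1 + \<eta>) * ln (x n) * (real k powr -2 * x n)"
            using x0[of n] by (intro mult_right_mono) auto
          thus ?thesis using fpos[of k] by (simp add: mult_ac)
        next
          case False
          hence "ln (x n) \<le> 1 / (1 + \<eta>) * ln (real k)" using \<eta> by (simp add: field_simps)
          hence "exp (ln (x n)) \<le> exp (1 / (1 + \<eta>) * ln (real k))" by (rule exp_le_cancel_iff[THEN iffD2])
          hence "x n \<le> real k powr (1 / (1 + \<eta>))" using x0[of n] k by (simp add: powr_def)
          hence "ln (real k) * real k powr -2 * x n \<le> ln (real k) * real k powr -2 * real k powr (1 / (1 + \<eta>))"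
            using k by (intro mult_left_mono) auto
          also have "\<dots> = ?f k" by (simp add: powr_add[symmetric] mult.assoc)
          finally have "ln (real k) * real k powr -2 * x n \<le> ?f k" .
          moreover have "0 \<le> (1 + \<eta>) * (x n * ln (x n) * real k powr -2)"
            using \<eta> x0[of n] lnx[of n] by (intro mult_nonneg_nonneg) auto
          ultimately show ?thesis by linarith
        qed
        finally show ?thesis using True p2 by simp
      next
        case False
        thus ?thesis using fpos[of k] by (auto simp: t_def log_prime_def)
      qed
    qed
    also have "\<dots> = (\<Sum>k. (1 + \<eta>) * (x n * ln (x n) * (if prime k \<and> real k > x n then 1 / real k ^ 2 else 0))) + (\<Sum>k. if real k > x n then ?f k else 0)"
      by (intro suminf_add[symmetric] summable_mult[OF sumA] sumtail sumf fpos)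
    also have "(\<Sum>k. (1 + \<eta>) * (x n * ln (x n) * (if prime k \<and> real k > x n then 1 / real k ^ 2 else 0))) = (1 + \<eta>) * A n"
      unfolding A_eq by (rule suminf_mult[OF sumA])
    finally show ?thesis .
  qed
  have "A \<longlonglongrightarrow> 1"
  proof (rule order_tendstoI)
    fix b :: real assume "b > 1"
    have "(\<lambda>n. S n + (\<Sum>k. if real k > x n then ln (real k) ^ 2 * real k powr -2 else 0)) \<longlonglongrightarrow> 1 + 0"
      by (intro tendsto_add S suminf_tail_tendsto_0 summable_log_sq x) auto
    hence "\<forall>\<^sub>F n in sequentially. S n + (\<Sum>k. if real k > x n then ln (real k) ^ 2 * real k powr -2 else 0) < b"
      using \<open>b > 1\<close> by (intro order_tendstoD) auto
    thus "\<forall>\<^sub>F n in sequentially. A n < b"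
      by eventually_elim (use upper le_less_trans in blast)
  next
    fix a :: real assume "a < 1"
    \<comment> \<open>Chosen so that (1 + \<eta>) a < 1; the absolute value takes care of a negative
      a.\<close>
    define \<eta> where "\<eta> = (1 - a) / (2 * (1 + \<bar>a\<bar>))"
    have \<eta>: "\<eta> > 0" using \<open>a < 1\<close> by (simp add: \<eta>_def)
    have "\<eta> * a \<le> \<eta> * (1 + \<bar>a\<bar>)" using \<eta> by (intro mult_left_mono) auto
    also have "\<dots> = (1 - a) / 2" unfolding \<eta>_def by (simp add: add_pos_nonneg field_simps)
    also have "\<dots> < 1 - a" using \<open>a < 1\<close> by simp
    finally have a\<eta>: "(1 + \<eta>) * a < 1" by (simp add: algebra_simps)
    let ?f = "\<lambda>k. ln (real k) * real k powr (- (2 - 1 / (1 + \<eta>)))"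
    have sumf: "summable ?f" using \<eta> by (intro summable_log_powr) (simp add: field_simps)
    have fpos: "?f k \<ge> 0" for k by (cases "k = 0") auto
    have "(\<lambda>n. S n - (\<Sum>k. if real k > x n then ?f k else 0)) \<longlonglongrightarrow> 1 - 0"
      by (intro tendsto_diff S suminf_tail_tendsto_0 sumf fpos x)
    hence "\<forall>\<^sub>F n in sequentially. S n - (\<Sum>k. if real k > x n then ?f k else 0) > (1 + \<eta>) * a"
      using a\<eta> by (intro order_tendstoD) auto
    thus "\<forall>\<^sub>F n in sequentially. a < A n"
    proof eventually_elim
      case (elim n)
      with lower[OF \<eta>, of n] have "(1 + \<eta>) * a < (1 + \<eta>) * A n" by linarith
      thus ?case using \<eta> by simp
    qed
  qed
  thus ?thesis by (simp add: A_def)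
qed

theorem prime_tail_asymp:
  assumes x: "filterlim x at_top sequentially"
  shows "(\<lambda>n. x n * ln (x n) * prime_tail (x n)) \<longlonglongrightarrow> 1"
proof -
  have ev: "\<forall>\<^sub>F n in sequentially. x n > 2"
    using x by (simp add: filterlim_at_top_dense)
  have "filterlim (\<lambda>n. max 2 (x n)) at_top sequentially"
    by (rule filterlim_at_top_mono[OF x]) auto
  hence "(\<lambda>n. max 2 (x n) * ln (max 2 (x n)) * prime_tail (max 2 (x n))) \<longlonglongrightarrow> 1"
    by (rule prime_tail_asymp_aux) auto
  thus ?thesis
    by (rule Lim_transform_eventually) (use ev in \<open>auto elim!: eventually_mono simp: max_def\<close>)
qed

section \<open>The gauss_transfer operator of the Gauss map\<close>

text \<open>The weight of the inverse branch t \<mapsto> 1 / (k + 1 + t): its Jacobian (k + 1 +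
  t)^(-2) times the ratio of the Gauss densities at the branch point and at t.\<close>

definition branch_weight :: "nat \<Rightarrow> real \<Rightarrow> real" where
  "branch_weight k t = (1 + t) / ((real k + 1 + t) * (real k + 2 + t))"

text \<open>S is the set of first digits that are kept; \<open>Suc k\<close> because digits start at
  1 and the series at 0.\<close>

definition gauss_transfer :: "nat set \<Rightarrow> (real \<Rightarrow> real) \<Rightarrow> real \<Rightarrow> real" where
  "gauss_transfer S g t = (\<Sum>k. if Suc k \<in> S then branch_weight k t * g (1 / (real k + 1 + t)) else 0)"

text \<open>The \<sigma> of the overview when S consists of the primes above the level: it controls
  both the mass and the Lipschitz constant of the branches in S.\<close>

definition inv_sq_sum :: "nat set \<Rightarrow> real" where
  "inv_sq_sum S = (\<Sum>k. if Suc k \<in> S then 1 / (real k + 1)\<^sup>2 else 0)"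

definition lip01 :: "real \<Rightarrow> (real \<Rightarrow> real) \<Rightarrow> bool" where
  "lip01 L g \<longleftrightarrow> (\<forall>x\<in>{0..1}. \<forall>y\<in>{0..1}. \<bar>g x - g y\<bar> \<le> L * \<bar>x - y\<bar>)"

lemma lip01D: "lip01 L g \<Longrightarrow> x \<in> {0..1} \<Longrightarrow> y \<in> {0..1} \<Longrightarrow> \<bar>g x - g y\<bar> \<le> L * \<bar>x - y\<bar>"
  by (auto simp: lip01_def)

lemma branch_weight_nonneg: "t \<in> {0..1} \<Longrightarrow> 0 \<le> branch_weight k t"
  by (auto simp: branch_weight_def)

lemma branch_weight_le: 
  assumes "t \<in> {0..1}"
  shows "branch_weight k t \<le> 2 / (real k + 1)\<^sup>2"
proof -
  have "(real k + 1) * (real k + 1) \<le> (real k + 1 + t) * (real k + 2 + t)"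
    using assms by (intro mult_mono) auto
  thus ?thesis unfolding branch_weight_def power2_eq_square
    by (intro frac_le) (use assms in auto)
qed

lemma branch_point_mem: "t \<in> {0..1} \<Longrightarrow> 1 / (real k + 1 + t) \<in> {0..1}"
  by (auto simp: field_simps)

lemma branch_point_dist:
  assumes "t \<in> {0..1}" "s \<in> {0..1}"
  shows "\<bar>1 / (real k + 1 + t) - 1 / (real k + 1 + s)\<bar> = \<bar>t - s\<bar> / ((real k + 1 + t) * (real k + 1 + s))"
proof -
  have "1 / (real k + 1 + t) - 1 / (real k + 1 + s) = (s - t) / ((real k + 1 + t) * (real k + 1 + s))"
    using assms by (subst diff_frac_eq) (auto simp: add_nonneg_eq_0_iff add_pos_nonneg)
  thus ?thesis using assms by (simp add: abs_mult abs_minus_commute)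
qed

lemma summable_inv_sq: "summable (\<lambda>k. 1 / (real k + 1)\<^sup>2)"
proof -
  have "summable (\<lambda>k. inverse (real (Suc k) ^ 2))"
    using inverse_power_summable[of 2, where ?'a = real] summable_Suc_iff[of "\<lambda>n. inverse (real n ^ 2)"] by blast
  thus ?thesis by (simp add: inverse_eq_divide add.commute)
qed

lemma summable_inv_sq_if: "summable (\<lambda>k. if Suc k \<in> S then 1 / (real k + 1)\<^sup>2 else 0)"
  by (rule summable_comparison_test'[OF summable_inv_sq, of 0]) auto

lemma inv_sq_sum_nonneg: "0 \<le> inv_sq_sum S"
  unfolding inv_sq_sum_def by (rule suminf_nonneg[OF summable_inv_sq_if]) auto

lemma suminf_abs_le:
  fixes f g :: "nat \<Rightarrow> real"
  assumes "summable g" "\<And>n. \<bar>f n\<bar> \<le> g n"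
  shows "summable f" "\<bar>suminf f\<bar> \<le> suminf g"
proof -
  have "summable (\<lambda>n. \<bar>f n\<bar>)"
    by (rule summable_comparison_test'[OF assms(1), of 0]) (use assms(2) in auto)
  thus "summable f" by (rule summable_rabs_cancel)
  show "\<bar>suminf f\<bar> \<le> suminf g"
    using summable_rabs[OF \<open>summable (\<lambda>n. \<bar>f n\<bar>)\<close>] suminf_le[OF assms(2) \<open>summable (\<lambda>n. \<bar>f n\<bar>)\<close> assms(1)]
    by linarith
qed

lemma transfer_summable:
  assumes t: "t \<in> {0..1}" and g: "\<And>x. x \<in> {0..1} \<Longrightarrow> \<bar>g x\<bar> \<le> K"
  shows "summable (\<lambda>k. if Suc k \<in> S then branch_weight k t * g (1 / (real k + 1 + t)) else 0)"
proof (rule suminf_abs_le(1))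
  show "summable (\<lambda>k. 2 * K * (1 / (real k + 1)\<^sup>2))"
    by (intro summable_mult summable_inv_sq)
  have K: "K \<ge> 0" using order_trans[OF abs_ge_zero g[of 0]] by simp
  fix k
  have "\<bar>branch_weight k t * g (1 / (real k + 1 + t))\<bar> \<le> 2 / (real k + 1)\<^sup>2 * K"
    unfolding abs_mult using branch_weight_le[OF t] branch_weight_nonneg[OF t] branch_point_mem[OF t] 
    by (intro mult_mono g) auto
  thus "\<bar>if Suc k \<in> S then branch_weight k t * g (1 / (real k + 1 + t)) else 0\<bar> \<le> 2 * K * (1 / (real k + 1)\<^sup>2)"
    using K by (auto simp: mult_ac)
qed

text \<open>The weights telescope, \<open>branch_weight k t\<close> being (k+1)/(k+2+t) - k/(k+1+t).
  The closed form yields U 1 = 1 and, later, the summation by parts.\<close>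

lemma branch_weight_partial_sum:
  assumes "t \<in> {0..1}"
  shows "(\<Sum>j<k. branch_weight j t) = real k / (real k + 1 + t)"
proof (induction k)
  case (Suc k)
  have "real k + 1 + t \<noteq> 0" "real k + 2 + t \<noteq> 0" using assms by auto
  hence "real k / (real k + 1 + t) + (1 + t) / ((real k + 1 + t) * (real k + 2 + t)) = (real k + 1) / (real k + 2 + t)"
    by (simp add: divide_simps, (simp add: algebra_simps)?)
  thus ?case using Suc.IH by (simp add: branch_weight_def add_ac)
qed simp

lemma branch_weight_sums_1:
  assumes "t \<in> {0..1}"
  shows "(\<lambda>k. branch_weight k t) sums 1"
  unfolding sums_def branch_weight_partial_sum[OF assms] by real_asymp

lemma transfer_one_le:
  assumes t: "t \<in> {0..1}"
  shows "gauss_transfer S (\<lambda>_. 1) t \<le> 1" "0 \<le> gauss_transfer S (\<lambda>_. 1) t" "gauss_transfer S (\<lambda>_. 1) t \<le> 2 * inv_sq_sum S"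
proof -
  have sm: "summable (\<lambda>k. if Suc k \<in> S then branch_weight k t * 1 else 0)"
    by (rule transfer_summable[OF t, of _ 1]) auto
  have "gauss_transfer S (\<lambda>_. 1) t \<le> (\<Sum>k. branch_weight k t)"
    unfolding gauss_transfer_def using branch_weight_sums_1[OF t] branch_weight_nonneg[OF t]
    by (intro suminf_le[OF _ sm]) (auto simp: sums_iff)
  thus "gauss_transfer S (\<lambda>_. 1) t \<le> 1" using branch_weight_sums_1[OF t] by (simp add: sums_iff)
  show "0 \<le> gauss_transfer S (\<lambda>_. 1) t"
    unfolding gauss_transfer_def by (rule suminf_nonneg[OF sm]) (use branch_weight_nonneg[OF t] in auto)
  have "gauss_transfer S (\<lambda>_. 1) t \<le> (\<Sum>k. 2 * (if Suc k \<in> S then 1 / (real k + 1)\<^sup>2 else 0))"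
    unfolding gauss_transfer_def using branch_weight_le[OF t]
    by (intro suminf_le[OF _ sm] summable_mult summable_inv_sq_if) auto
  also have "\<dots> = 2 * inv_sq_sum S" unfolding inv_sq_sum_def by (rule suminf_mult[OF summable_inv_sq_if])
  finally show "gauss_transfer S (\<lambda>_. 1) t \<le> 2 * inv_sq_sum S" .
qed

text \<open>Positivity of the operator, applied to g - c. Replacing a density by a constant within
  distance d thus costs only d times the mass of the branches in S, a second small factor when S is
  the deleted set.\<close>

lemma transfer_diff_const_le:
  assumes t: "t \<in> {0..1}" and g: "\<And>x. x \<in> {0..1} \<Longrightarrow> \<bar>g x - c\<bar> \<le> d"
  shows "\<bar>gauss_transfer S g t - c * gauss_transfer S (\<lambda>_. 1) t\<bar> \<le> d * gauss_transfer S (\<lambda>_. 1) t"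
proof -
  have "\<bar>g x\<bar> \<le> \<bar>c\<bar> + d" if "x \<in> {0..1}" for x using g[OF that] by linarith
  note sg = transfer_summable[OF t this, where S = S]
  have s1: "summable (\<lambda>k. if Suc k \<in> S then branch_weight k t * 1 else 0)"
    by (rule transfer_summable[OF t, of _ 1]) auto
  have "gauss_transfer S g t - c * gauss_transfer S (\<lambda>_. 1) t = 
     (\<Sum>k. (if Suc k \<in> S then branch_weight k t * g (1 / (real k + 1 + t)) else 0) - c * (if Suc k \<in> S then branch_weight k t * 1 else 0))"
    unfolding gauss_transfer_def suminf_mult[OF s1, symmetric] by (rule suminf_diff[OF sg summable_mult[OF s1]])
  also have "\<bar>\<dots>\<bar> \<le> (\<Sum>k. d * (if Suc k \<in> S then branch_weight k t * 1 else 0))"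
  proof (rule suminf_abs_le(2)[OF summable_mult[OF s1]])
    fix k
    have "branch_weight k t * \<bar>g (1 / (real k + 1 + t)) - c\<bar> \<le> branch_weight k t * d"
      by (intro mult_left_mono g branch_point_mem[OF t] branch_weight_nonneg[OF t])
    hence "\<bar>branch_weight k t * g (1 / (real k + 1 + t)) - c * branch_weight k t\<bar> \<le> branch_weight k t * d"
      using branch_weight_nonneg[OF t, of k] by (simp add: abs_mult right_diff_distrib[symmetric] mult.commute[of c])
    thus "\<bar>(if Suc k \<in> S then branch_weight k t * g (1 / (real k + 1 + t)) else 0) - c * (if Suc k \<in> S then branch_weight k t * 1 else 0)\<bar>
       \<le> d * (if Suc k \<in> S then branch_weight k t * 1 else 0)" by (auto simp: mult.commute)
  qed
  also have "\<dots> = d * gauss_transfer S (\<lambda>_. 1) t"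
    unfolding gauss_transfer_def by (rule suminf_mult[OF s1])
  finally show ?thesis .
qed

lemma transfer_bounds:
  assumes t: "t \<in> {0..1}" and g: "\<And>x. x \<in> {0..1} \<Longrightarrow> 0 \<le> g x \<and> g x \<le> K"
  shows "0 \<le> gauss_transfer S g t" "gauss_transfer S g t \<le> K"
proof -
  have K: "0 \<le> K" using g[of 0] by simp
  have ga: "\<bar>g x\<bar> \<le> K" if "x \<in> {0..1}" for x using g[OF that] by simp
  show "0 \<le> gauss_transfer S g t"
    unfolding gauss_transfer_def by (rule suminf_nonneg[OF transfer_summable[OF t ga]])
      (use g branch_point_mem[OF t] branch_weight_nonneg[OF t] in auto)
  have "\<bar>gauss_transfer S g t - 0 * gauss_transfer S (\<lambda>_. 1) t\<bar> \<le> K * gauss_transfer S (\<lambda>_. 1) t"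
    by (rule transfer_diff_const_le[OF t]) (use ga in auto)
  also have "\<dots> \<le> K * 1" by (intro mult_left_mono transfer_one_le K t)
  finally show "gauss_transfer S g t \<le> K" by simp
qed

lemma transfer_Compl:
  assumes t: "t \<in> {0..1}" and g: "\<And>x. x \<in> {0..1} \<Longrightarrow> \<bar>g x\<bar> \<le> K"
  shows "gauss_transfer (- B) g t = gauss_transfer UNIV g t - gauss_transfer B g t"
proof -
  let ?f = "\<lambda>S k. if Suc k \<in> S then branch_weight k t * g (1 / (real k + 1 + t)) else 0"
  have s: "summable (?f S)" for S using t g by (rule transfer_summable)
  have eq: "?f (- B) = (\<lambda>k. ?f UNIV k - ?f B k)" by (auto simp: fun_eq_iff)
  show ?thesis unfolding gauss_transfer_def
    by (rule trans[OF arg_cong[where f = suminf, OF eq] suminf_diff[OF s s, symmetric]])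
qed

section \<open>Lipschitz constants under the operator\<close>

lemma branch_weight_diff:
  assumes t: "t \<in> {0..1}" and s: "s \<in> {0..1}"
  shows "\<bar>branch_weight k t - branch_weight k s\<bar> \<le> 4 / (real k + 1)\<^sup>2 * \<bar>t - s\<bar>"
proof -
  define m where "m = real k + 1"
  have m: "m \<ge> 1" by (simp add: m_def)
  define d where "d = (\<lambda>t. (m + t) * (m + 1 + t))"
  have d: "d u \<ge> m * (m + 1)" "d u > 0" if "u \<in> {0..1}" for u
  proof -
    show "d u \<ge> m * (m + 1)" unfolding d_def using that m by (intro mult_mono) auto
    thus "d u > 0" using m by (smt (verit) mult_pos_pos)
  qed
  have "branch_weight k t - branch_weight k s = (1 + t) / d t - (1 + s) / d s"
    by (simp add: branch_weight_def d_def m_def add_ac)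
  also have "\<dots> = ((1 + t) * d s - (1 + s) * d t) / (d t * d s)"
    using d(2)[OF t] d(2)[OF s] by (subst diff_frac_eq) auto
  also have "(1 + t) * d s - (1 + s) * d t = (s - t) * (t + s + t * s + 2 * m + 1 - m * (m + 1))"
    by (simp add: d_def algebra_simps)
  finally have "\<bar>branch_weight k t - branch_weight k s\<bar> = \<bar>t - s\<bar> * \<bar>t + s + t * s + 2 * m + 1 - m * (m + 1)\<bar> / (d t * d s)"
    using d(2)[OF t] d(2)[OF s] by (simp add: abs_mult abs_minus_commute)
  \<comment> \<open>The denominators are at least m (m + 1) each; the last factor of the numerator
    is of order m^2 and is bounded by 4 (m+1)^2 just so that (m+1)^2 cancels.\<close>
  also have "\<dots> \<le> \<bar>t - s\<bar> * (4 * (m + 1)\<^sup>2) / ((m * (m + 1)) * (m * (m + 1)))"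
  proof (intro frac_le mult_left_mono mult_mono)
    have "0 \<le> t * s" "t * s \<le> 1" using t s by (auto intro: mult_le_one)
    moreover have "m \<le> m * m" using m by simp
    moreover have "m * (m + 1) = m * m + m" "4 * (m + 1)\<^sup>2 = 4 * (m * m) + 8 * m + 4"
      by (simp_all add: power2_eq_square algebra_simps)
    moreover have "0 \<le> t" "t \<le> 1" "0 \<le> s" "s \<le> 1" using t s by auto
    ultimately show "\<bar>t + s + t * s + 2 * m + 1 - m * (m + 1)\<bar> \<le> 4 * (m + 1)\<^sup>2"
      using m by linarith
  qed (use m d[OF t] d[OF s] in \<open>auto simp: mult_pos_pos less_imp_le\<close>)
  also have "\<dots> = 4 / m\<^sup>2 * \<bar>t - s\<bar>"
    using m by (simp add: power2_eq_square divide_simps)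
  finally show ?thesis by (simp add: m_def)
qed

text \<open>Product rule branch by branch: the variation of the weights, with constant 4 / (k+1)^2,
  meets the bound K; the weights themselves, at most 2 / (k+1)^2, meet the Lipschitz constant L, as
  the branch maps do not expand.\<close>

lemma transfer_lip_small:
  assumes g: "\<And>x. x \<in> {0..1} \<Longrightarrow> \<bar>g x\<bar> \<le> K" and L: "lip01 L g" "L \<ge> 0"
  shows "lip01 (inv_sq_sum B * (4 * K + 2 * L)) (gauss_transfer B g)"
  unfolding lip01_def
proof safe
  fix t s :: real assume t: "t \<in> {0..1}" and s: "s \<in> {0..1}"
  have K: "K \<ge> 0" using order_trans[OF abs_ge_zero g[of 0]] by simp
  let ?C = "(4 * K + 2 * L) * \<bar>t - s\<bar>"
  have diff: "gauss_transfer B g t - gauss_transfer B g s = 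
    (\<Sum>k. (if Suc k \<in> B then branch_weight k t * g (1 / (real k + 1 + t)) else 0) - (if Suc k \<in> B then branch_weight k s * g (1 / (real k + 1 + s)) else 0))"
    unfolding gauss_transfer_def by (rule suminf_diff[OF transfer_summable[OF t g] transfer_summable[OF s g]])
  have "\<bar>gauss_transfer B g t - gauss_transfer B g s\<bar> \<le> (\<Sum>k. ?C * (if Suc k \<in> B then 1 / (real k + 1)\<^sup>2 else 0))"
    unfolding diff
  proof (rule suminf_abs_le(2)[OF summable_mult[OF summable_inv_sq_if]])
    fix k
    let ?x = "1 / (real k + 1 + t)" and ?y = "1 / (real k + 1 + s)"
    have x: "?x \<in> {0..1}" and y: "?y \<in> {0..1}" using branch_point_mem t s by auto
    have "branch_weight k t * g ?x - branch_weight k s * g ?y = (branch_weight k t - branch_weight k s) * g ?x + branch_weight k s * (g ?x - g ?y)"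
      by (simp add: algebra_simps)
    also have "\<bar>\<dots>\<bar> \<le> \<bar>branch_weight k t - branch_weight k s\<bar> * \<bar>g ?x\<bar> + branch_weight k s * \<bar>g ?x - g ?y\<bar>"
      using branch_weight_nonneg[OF s, of k] by (metis abs_mult abs_of_nonneg abs_triangle_ineq)
    also have "\<dots> \<le> (4 / (real k + 1)\<^sup>2 * \<bar>t - s\<bar>) * K + 2 / (real k + 1)\<^sup>2 * (L * \<bar>t - s\<bar>)"
    proof (intro add_mono mult_mono branch_weight_diff t s g x branch_weight_le)
      have "1 \<le> (real k + 1 + t) * (real k + 1 + s)"
        using t s mult_mono[of 1 "real k + 1 + t" 1 "real k + 1 + s"] by auto
      hence "\<bar>?x - ?y\<bar> \<le> \<bar>t - s\<bar>"
        unfolding branch_point_dist[OF t s] by (simp add: divide_le_eq mult_le_cancel_left1)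
      hence "L * \<bar>?x - ?y\<bar> \<le> L * \<bar>t - s\<bar>" using L(2) by (intro mult_left_mono)
      thus "\<bar>g ?x - g ?y\<bar> \<le> L * \<bar>t - s\<bar>" using lip01D[OF L(1) x y] by linarith
    qed (use L(2) branch_weight_nonneg[OF s] in auto)
    also have "\<dots> = ?C * (1 / (real k + 1)\<^sup>2)" by (simp add: algebra_simps add_divide_distrib)
    finally show "\<bar>(if Suc k \<in> B then branch_weight k t * g ?x else 0) - (if Suc k \<in> B then branch_weight k s * g ?y else 0)\<bar>
        \<le> ?C * (if Suc k \<in> B then 1 / (real k + 1)\<^sup>2 else 0)" by simp
  qed
  also have "\<dots> = ?C * inv_sq_sum B" unfolding inv_sq_sum_def by (rule suminf_mult[OF summable_inv_sq_if])
  finally show "\<bar>gauss_transfer B g t - gauss_transfer B g s\<bar> \<le> inv_sq_sum B * (4 * K + 2 * L) * \<bar>t - s\<bar>"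
    by (simp add: mult_ac)
qed

lemma sum_by_parts:
  fixes D g :: "nat \<Rightarrow> real"
  assumes "D 0 = 0"
  shows "(\<Sum>k<N. (D (Suc k) - D k) * g k) = D N * g N - (\<Sum>k<N. D (Suc k) * (g (Suc k) - g k))"
proof (induction N)
  case 0
  show ?case by (simp add: assms)
next
  case (Suc N)
  show ?case unfolding sum.lessThan_Suc Suc.IH by (simp add: algebra_simps)
qed

text \<open>The variation of the branch points contributes at most 2/3, and that of the weights, after summation by
  parts, at most 1/4.\<close>

lemma transfer_lip_contraction:
  assumes g: "\<And>x. x \<in> {0..1} \<Longrightarrow> \<bar>g x\<bar> \<le> K" and L: "lip01 L g" "L \<ge> 0"
  shows "lip01 (11 / 12 * L) (gauss_transfer UNIV g)"
  unfolding lip01_def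
proof safe
  fix t s :: real assume t: "t \<in> {0..1}" and s: "s \<in> {0..1}"
  have K: "K \<ge> 0" using order_trans[OF abs_ge_zero g[of 0]] by simp
  define x where "x = (\<lambda>k. 1 / (real k + 1 + t))"
  define y where "y = (\<lambda>k. 1 / (real k + 1 + s))"
  have x: "x k \<in> {0..1}" and y: "y k \<in> {0..1}" for k using branch_point_mem t s by (auto simp: x_def y_def)
  \<comment> \<open>The difference of the partial sums of the weights at t and at s. Summation by
    parts against it replaces values of g by increments of g, hence K by L.\<close>
  define D where "D = (\<lambda>k. real k / (real k + 1 + t) - real k / (real k + 1 + s))"
  have D_Suc: "D (Suc k) - D k = branch_weight k t - branch_weight k s" for k
    using branch_weight_partial_sum[OF t, of "Suc k"] branch_weight_partial_sum[OF t, of k]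
          branch_weight_partial_sum[OF s, of "Suc k"] branch_weight_partial_sum[OF s, of k]
    unfolding D_def by simp
  have D_le: "\<bar>D k\<bar> \<le> real k / (real k + 1)\<^sup>2 * \<bar>t - s\<bar>" for k
  proof -
    have "D k = real k * (1 / (real k + 1 + t) - 1 / (real k + 1 + s))" by (simp add: D_def right_diff_distrib)
    hence "\<bar>D k\<bar> = real k * (\<bar>t - s\<bar> / ((real k + 1 + t) * (real k + 1 + s)))"
      by (simp only: abs_mult branch_point_dist[OF t s] abs_of_nat)
    also have "\<dots> \<le> real k * (\<bar>t - s\<bar> / ((real k + 1) * (real k + 1)))"
      using t s by (intro mult_left_mono divide_left_mono mult_mono mult_pos_pos) auto
    finally show ?thesis by (simp add: power2_eq_square)
  qed
  \<comment> \<open>Branch 0 accounts for 1/2, and the others, majorised by a telescoping series,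
    for 1/6.\<close>
  have first: "(\<Sum>k<N. branch_weight k s * \<bar>g (x k) - g (y k)\<bar>) \<le> 2 / 3 * (L * \<bar>t - s\<bar>)" for N
  proof -
    have tm: "branch_weight k s * \<bar>g (x k) - g (y k)\<bar> \<le> (if k = 0 then 1/2 else 1 / (3 * (real k + 1) * (real k + 2))) * (L * \<bar>t - s\<bar>)" for k
    proof -
      have "branch_weight k s * \<bar>g (x k) - g (y k)\<bar> \<le> branch_weight k s * (L * \<bar>x k - y k\<bar>)"
        by (intro mult_left_mono lip01D[OF L(1)] x y branch_weight_nonneg s)
      also have "\<dots> = branch_weight k s / ((real k + 1 + t) * (real k + 1 + s)) * (L * \<bar>t - s\<bar>)"
        unfolding x_def y_def branch_point_dist[OF t s] by simp
      also have "\<dots> \<le> (if k = 0 then 1/2 else 1 / (3 * (real k + 1) * (real k + 2))) * (L * \<bar>t - s\<bar>)"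
      proof (rule mult_right_mono)
        show "branch_weight k s / ((real k + 1 + t) * (real k + 1 + s)) \<le> (if k = 0 then 1/2 else 1 / (3 * (real k + 1) * (real k + 2)))"
        proof (cases "k = 0")
          case True
          have "branch_weight 0 s = 1 / (2 + s)" using s by (simp add: branch_weight_def)
          also have "\<dots> \<le> 1 / 2" using s by (simp add: field_simps)
          finally have "branch_weight 0 s / ((1 + t) * (1 + s)) \<le> (1/2) / 1"
            using t s branch_weight_nonneg[OF s] mult_mono[of 1 "1 + t" 1 "1 + s"] by (intro frac_le) auto
          thus ?thesis using True by simp
        next
          case False
          define m where "m = real k + 1"
          have m: "m \<ge> 2" using False by (simp add: m_def)
          have "(1 + s) * (m + 1) \<le> 2 * (m + s)" using s m mult_right_mono[of s 1 "m - 1"] by (simp add: algebra_simps)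
          hence h: "(1 + s) / (m + s) \<le> 2 / (m + 1)" using s m by (simp add: divide_le_eq le_divide_eq field_simps)
          have "(1 + s) / (m + s) / (m + 1 + s) \<le> 2 / (m + 1) / (m + 1)"
            by (rule frac_le[OF _ h]) (use s m in auto)
          hence w: "branch_weight k s \<le> 2 / ((m + 1) * (m + 1))"
            by (simp add: branch_weight_def m_def add_ac)
          have "branch_weight k s / ((m + t) * (m + s)) \<le> 2 / ((m + 1) * (m + 1)) / (m * m)"
            using w m t s by (intro frac_le mult_mono mult_pos_pos) auto
          also have "\<dots> = (2 / (m * (m + 1))) * (1 / (m * (m + 1)))"
            using m by (simp add: field_simps)
          also have "\<dots> \<le> (1 / 3) * (1 / (m * (m + 1)))"
          proof (rule mult_right_mono)
            have "6 \<le> m * (m + 1)" using m mult_mono[of 2 m 3 "m + 1"] by auto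
            thus "2 / (m * (m + 1)) \<le> 1 / 3" using m by (simp add: divide_le_eq le_divide_eq)
          qed (use m in auto)
          also have "\<dots> = 1 / (3 * (real k + 1) * (real k + 2))"
          proof -
            have "m + 1 = real k + 2" by (simp add: m_def)
            thus ?thesis by (simp only: m_def times_divide_times_eq mult_1 mult.assoc)
          qed
          finally show ?thesis using False by (simp only: m_def if_False)
        qed
      qed (use L in auto)
      finally show ?thesis .
    qed
    have bsum: "(\<Sum>k<N. if k = 0 then 1/2 else 1 / (3 * (real k + 1) * (real k + 2))) \<le> (2 / 3 - (if N = 0 then 2/3 else 1 / (3 * (real N + 1))) :: real)"
    proof (induction N)
      case (Suc N)
      show ?case
      proof (cases "N = 0")
        case False
        have "1 / (3 * (real N + 1) * (real N + 2)) = 1 / (3 * (real N + 1)) - 1 / (3 * (real N + 2))"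
          by (simp add: divide_simps, (simp add: algebra_simps)?)
        thus ?thesis using Suc.IH False by (simp add: add_ac)
      qed simp
    qed simp
    have "(\<Sum>k<N. branch_weight k s * \<bar>g (x k) - g (y k)\<bar>) \<le> (\<Sum>k<N. (if k = 0 then 1/2 else 1 / (3 * (real k + 1) * (real k + 2))) * (L * \<bar>t - s\<bar>))"
      by (intro sum_mono tm)
    also have "\<dots> = (\<Sum>k<N. if k = 0 then 1/2 else 1 / (3 * (real k + 1) * (real k + 2))) * (L * \<bar>t - s\<bar>)"
      by (rule sum_distrib_right[symmetric])
    also have "\<dots> \<le> 2 / 3 * (L * \<bar>t - s\<bar>)"
      using L(2) by (intro mult_right_mono order_trans[OF bsum]) auto
    finally show ?thesis .
  qed
  \<comment> \<open>The increments of g are taken between neighbouring branch points, at distance at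
    most 1 / ((k+1) (k+2)). Together with the bound on D this gives 1 / (k+2)^3, majorised by a
    telescoping series with sum 1/4.\<close>
  have second: "(\<Sum>k<N. \<bar>D (Suc k)\<bar> * \<bar>g (x (Suc k)) - g (x k)\<bar>) \<le> 1 / 4 * (L * \<bar>t - s\<bar>)" for N
  proof -
    have tm: "\<bar>D (Suc k)\<bar> * \<bar>g (x (Suc k)) - g (x k)\<bar> \<le> 1 / ((real k + 1) * (real k + 2) * (real k + 3)) * (L * \<bar>t - s\<bar>)" for k
    proof -
      have "x k - x (Suc k) = 1 / ((real k + 1 + t) * (real k + 2 + t))"
        using t unfolding x_def by (subst diff_frac_eq) auto
      hence "\<bar>x (Suc k) - x k\<bar> = 1 / ((real k + 1 + t) * (real k + 2 + t))"
        using t by (simp add: abs_minus_commute abs_mult)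
      also have "\<dots> \<le> 1 / ((real k + 1) * (real k + 2))"
        using t by (intro divide_left_mono mult_mono mult_pos_pos) auto
      finally have "L * \<bar>x (Suc k) - x k\<bar> \<le> L * (1 / ((real k + 1) * (real k + 2)))"
        using L(2) by (rule mult_left_mono)
      hence gx: "\<bar>g (x (Suc k)) - g (x k)\<bar> \<le> L * (1 / ((real k + 1) * (real k + 2)))"
        using lip01D[OF L(1) x x, of "Suc k" k] by linarith
      have "\<bar>D (Suc k)\<bar> * \<bar>g (x (Suc k)) - g (x k)\<bar> \<le> ((real k + 1) / (real k + 2)\<^sup>2 * \<bar>t - s\<bar>) * (L * (1 / ((real k + 1) * (real k + 2))))"
        using D_le[of "Suc k"] gx by (intro mult_mono) (auto simp: add_ac)
      also have "\<dots> = 1 / ((real k + 2) * (real k + 2) * (real k + 2)) * (L * \<bar>t - s\<bar>)"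
        by (simp add: power2_eq_square divide_simps)
      also have "\<dots> \<le> 1 / ((real k + 1) * (real k + 2) * (real k + 3)) * (L * \<bar>t - s\<bar>)"
      proof (rule mult_right_mono)
        have "(real k + 1) * (real k + 2) * (real k + 3) \<le> (real k + 2) * (real k + 2) * (real k + 2)"
          by (simp add: algebra_simps)
        thus "1 / ((real k + 2) * (real k + 2) * (real k + 2)) \<le> 1 / ((real k + 1) * (real k + 2) * (real k + 3))"
          by (intro divide_left_mono) auto
      qed (use L in auto)
      finally show ?thesis .
    qed
    have csum: "(\<Sum>k<N. 1 / ((real k + 1) * (real k + 2) * (real k + 3))) = 1 / 4 - 1 / (2 * (real N + 1) * (real N + 2))"
    proof (induction N)
      case (Suc N)
      have "1 / (2 * (real N + 1) * (real N + 2)) - 1 / ((real N + 1) * (real N + 2) * (real N + 3)) = 1 / (2 * (real N + 2) * (real N + 3))"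
        by (simp add: divide_simps, (simp add: algebra_simps)?)
      thus ?case using Suc.IH by (simp add: add_ac)
    qed simp
    have "(\<Sum>k<N. \<bar>D (Suc k)\<bar> * \<bar>g (x (Suc k)) - g (x k)\<bar>) \<le> (\<Sum>k<N. 1 / ((real k + 1) * (real k + 2) * (real k + 3)) * (L * \<bar>t - s\<bar>))"
      by (intro sum_mono tm)
    also have "\<dots> = (1 / 4 - 1 / (2 * (real N + 1) * (real N + 2))) * (L * \<bar>t - s\<bar>)"
      unfolding csum[symmetric] by (rule sum_distrib_right[symmetric])
    also have "\<dots> \<le> 1 / 4 * (L * \<bar>t - s\<bar>)"
      using L(2) by (intro mult_right_mono) auto
    finally show ?thesis .
  qed
  \<comment> \<open>The bound K survives only in the boundary term, which tends to 0 as N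
    grows.\<close>
  have partial: "\<bar>\<Sum>k<N. branch_weight k t * g (x k) - branch_weight k s * g (y k)\<bar> \<le> 11 / 12 * (L * \<bar>t - s\<bar>) + real N / (real N + 1)\<^sup>2 * \<bar>t - s\<bar> * K" for N
  proof -
    have "(\<Sum>k<N. branch_weight k t * g (x k) - branch_weight k s * g (y k)) = 
       (\<Sum>k<N. branch_weight k s * (g (x k) - g (y k))) + (\<Sum>k<N. (D (Suc k) - D k) * g (x k))"
      unfolding D_Suc sum.distrib[symmetric] by (intro sum.cong) (auto simp: algebra_simps)
    also have "(\<Sum>k<N. (D (Suc k) - D k) * g (x k)) = D N * g (x N) - (\<Sum>k<N. D (Suc k) * (g (x (Suc k)) - g (x k)))"
      by (rule sum_by_parts) (simp add: D_def)
    finally have eq: "(\<Sum>k<N. branch_weight k t * g (x k) - branch_weight k s * g (y k)) = 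
       (\<Sum>k<N. branch_weight k s * (g (x k) - g (y k))) + (D N * g (x N) - (\<Sum>k<N. D (Suc k) * (g (x (Suc k)) - g (x k))))" .
    have "\<bar>\<Sum>k<N. branch_weight k s * (g (x k) - g (y k))\<bar> \<le> (\<Sum>k<N. \<bar>branch_weight k s * (g (x k) - g (y k))\<bar>)"
      by (rule sum_abs)
    also have "\<dots> = (\<Sum>k<N. branch_weight k s * \<bar>g (x k) - g (y k)\<bar>)"
      using branch_weight_nonneg[OF s] by (simp add: abs_mult)
    finally have 1: "\<bar>\<Sum>k<N. branch_weight k s * (g (x k) - g (y k))\<bar> \<le> 2 / 3 * (L * \<bar>t - s\<bar>)"
      using first[of N] by linarith
    have "\<bar>\<Sum>k<N. D (Suc k) * (g (x (Suc k)) - g (x k))\<bar> \<le> (\<Sum>k<N. \<bar>D (Suc k) * (g (x (Suc k)) - g (x k))\<bar>)"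
      by (rule sum_abs)
    hence 2: "\<bar>\<Sum>k<N. D (Suc k) * (g (x (Suc k)) - g (x k))\<bar> \<le> 1 / 4 * (L * \<bar>t - s\<bar>)"
      using second[of N] by (simp add: abs_mult)
    have 3: "\<bar>D N * g (x N)\<bar> \<le> real N / (real N + 1)\<^sup>2 * \<bar>t - s\<bar> * K"
      unfolding abs_mult by (intro mult_mono D_le g x) auto
    show ?thesis unfolding eq using 1 2 3 by linarith
  qed
  have sx: "(\<lambda>k. branch_weight k t * g (x k)) sums gauss_transfer UNIV g t"
    using summable_sums[OF transfer_summable[OF t g, where S = UNIV]] by (simp add: gauss_transfer_def x_def)
  have sy: "(\<lambda>k. branch_weight k s * g (y k)) sums gauss_transfer UNIV g s"
    using summable_sums[OF transfer_summable[OF s g, where S = UNIV]] by (simp add: gauss_transfer_def y_def)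
  have "(\<lambda>N. \<bar>\<Sum>k<N. branch_weight k t * g (x k) - branch_weight k s * g (y k)\<bar>) \<longlonglongrightarrow> \<bar>gauss_transfer UNIV g t - gauss_transfer UNIV g s\<bar>"
    using sums_diff[OF sx sy] unfolding sums_def by (rule tendsto_rabs)
  moreover have "(\<lambda>N. real N / (real N + 1)\<^sup>2) \<longlonglongrightarrow> 0" by real_asymp
  hence "(\<lambda>N. 11 / 12 * (L * \<bar>t - s\<bar>) + real N / (real N + 1)\<^sup>2 * \<bar>t - s\<bar> * K) \<longlonglongrightarrow> 11 / 12 * (L * \<bar>t - s\<bar>) + 0 * \<bar>t - s\<bar> * K"
    by (intro tendsto_intros)
  ultimately have "\<bar>gauss_transfer UNIV g t - gauss_transfer UNIV g s\<bar> \<le> 11 / 12 * (L * \<bar>t - s\<bar>) + 0 * \<bar>t - s\<bar> * K"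
    by (rule LIMSEQ_le) (use partial in auto)
  thus "\<bar>gauss_transfer UNIV g t - gauss_transfer UNIV g s\<bar> \<le> 11 / 12 * L * \<bar>t - s\<bar>" by simp
qed

section \<open>Digits avoiding a small set\<close>

definition gauss_meas :: "real measure" where
  "gauss_meas = density lborel (\<lambda>t. ennreal (indicator {0<..<1} t / ((1 + t) * ln 2)))"

definition no_hit :: "nat set \<Rightarrow> nat \<Rightarrow> real \<Rightarrow> bool" where
  "no_hit B n x \<longleftrightarrow> (\<forall>k\<in>{1..n}. cf_digit k x \<notin> B)"

lemma cf_digit_Suc_Suc: "cf_digit (Suc (Suc k)) x = cf_digit (Suc k) (gauss_map x)"
  by (simp add: cf_digit_def funpow_swap1)

lemma no_hit_0 [simp]: "no_hit B 0 x"
  by (simp add: no_hit_def)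

lemma no_hit_Suc: "no_hit B (Suc n) x \<longleftrightarrow> cf_digit 1 x \<notin> B \<and> no_hit B n (gauss_map x)"
proof -
  have set: "{1..Suc n} = insert 1 (Suc ` {1..n})" by (auto simp: image_iff Suc_le_eq)
  have shift: "cf_digit (Suc k) x = cf_digit k (gauss_map x)" if "k \<in> {1..n}" for k
    using cf_digit_Suc_Suc[of "k - 1" x] that by auto
  have "no_hit B (Suc n) x \<longleftrightarrow> cf_digit 1 x \<notin> B \<and> (\<forall>k\<in>{1..n}. cf_digit (Suc k) x \<notin> B)"
    unfolding no_hit_def set by blast
  also have "(\<forall>k\<in>{1..n}. cf_digit (Suc k) x \<notin> B) \<longleftrightarrow> no_hit B n (gauss_map x)"
    unfolding no_hit_def by (rule ball_cong[OF refl]) (simp only: shift)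
  finally show ?thesis .
qed

lemma gauss_map_measurable [measurable]: "gauss_map \<in> borel_measurable borel"
  unfolding gauss_map_def frac_def by measurable

lemma cf_digit_measurable [measurable]: "cf_digit k \<in> measurable borel (count_space UNIV)"
proof -
  have "(gauss_map ^^ n) \<in> borel_measurable borel" for n
    by (induction n) (auto simp: comp_def)
  hence [measurable]: "(gauss_map ^^ (k - 1)) \<in> borel_measurable borel" .
  show ?thesis unfolding cf_digit_def by measurable
qed

lemma no_hit_measurable [measurable]: "Measurable.pred borel (no_hit B n)"
  unfolding no_hit_def by measurable

lemma sets_gauss_meas [simp, measurable_cong]: "sets gauss_meas = sets borel"
  by (simp add: gauss_meas_def)

lemma space_gauss_meas [simp]: "space gauss_meas = UNIV"
  by (simp add: gauss_meas_def)

lemma nn_integral_gauss: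
  assumes [measurable]: "f \<in> borel_measurable borel"
  shows "(\<integral>\<^sup>+x. ennreal (f x) \<partial>gauss_meas) = (\<integral>\<^sup>+x. ennreal (f x * (indicator {0<..<1} x / ((1 + x) * ln 2))) \<partial>lborel)"
proof -
  have "ennreal (f x * (indicator {0<..<1} x / ((1 + x) * ln 2))) = ennreal (f x) * ennreal (indicator {0<..<1} x / ((1 + x) * ln 2))" for x
    by (rule ennreal_mult'') (auto split: split_indicator)
  thus ?thesis unfolding gauss_meas_def by (subst nn_integral_density) (auto simp: mult.commute)
qed

lemma AE_gauss: "AE x in gauss_meas. x \<in> {0<..<1}"
  unfolding gauss_meas_def by (subst AE_density) (auto split: split_indicator)

lemma prob_space_gauss: "prob_space gauss_meas"
proof
  have "emeasure gauss_meas (space gauss_meas) = (\<integral>\<^sup>+x. ennreal 1 \<partial>gauss_meas)" by simp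
  also have "\<dots> = (\<integral>\<^sup>+x. ennreal (1 / ((1 + x) * ln 2)) * indicator {0..1} x \<partial>lborel)"
  proof (subst nn_integral_gauss, simp, rule nn_integral_cong_AE)
    show "AE x in lborel. ennreal (1 * (indicator {0<..<1} x / ((1 + x) * ln 2))) = ennreal (1 / ((1 + x) * ln 2)) * indicator {0..1} x"
      using AE_lborel_singleton[of 0] AE_lborel_singleton[of 1]
      by eventually_elim (auto split: split_indicator)
  qed
  also have "\<dots> = ennreal (inverse (ln 2) * ln (1 + 1) - inverse (ln 2) * ln (1 + 0))"
    by (rule nn_integral_FTC_Icc) (auto intro!: derivative_eq_intros simp: divide_simps)
  finally show "emeasure gauss_meas (space gauss_meas) = 1" by simp
qed

interpretation gauss: prob_space gauss_meas by (rule prob_space_gauss)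

lemma gauss_prob_UNIV [simp]: "measure gauss_meas UNIV = 1"
  using gauss.prob_space by simp

lemma cf_branch:
  assumes "0 < t" "t < 1"
  shows "gauss_map (1 / (real k + 1 + t)) = t" "cf_digit 1 (1 / (real k + 1 + t)) = Suc k"
proof -
  have fl: "\<lfloor>real k + 1 + t\<rfloor> = int (Suc k)" using assms by (intro floor_unique) auto
  show "gauss_map (1 / (real k + 1 + t)) = t" using fl by (simp add: gauss_map_def frac_def)
  show "cf_digit 1 (1 / (real k + 1 + t)) = Suc k" using fl by (simp add: cf_digit_def)
qed

section \<open>Change of variables along the branches\<close>

lemma nn_integral_branch:
  assumes h [measurable]: "h \<in> borel_measurable borel"
  shows "(\<integral>\<^sup>+x. ennreal (h x * indicator {1 / (real k + 2)..1 / (real k + 1)} x) \<partial>lborel) =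
         (\<integral>\<^sup>+t. ennreal (h (1 / (real k + 1 + t)) / (real k + 1 + t)\<^sup>2 * indicator {0..1} t) \<partial>lborel)"
proof -
  \<comment> \<open>The substitution rule is stated for increasing maps, so the branch is first run
    backwards in s = 1 - t and then reflected.\<close>
  define G where "G = (\<lambda>s. 1 / (real k + 2 - s))"
  have "(\<integral>\<^sup>+x. ennreal (h x * indicator {G 0..G 1} x) \<partial>lborel) = (\<integral>\<^sup>+s. ennreal (h (G s) * (1 / (real k + 2 - s)\<^sup>2) * indicator {0..1} s) \<partial>lborel)"
  proof (rule nn_integral_substitution)
    show "set_borel_measurable borel {G 0..G 1} h" unfolding set_borel_measurable_def by measurable
    show "(G has_real_derivative 1 / (real k + 2 - s)\<^sup>2) (at s)" if "s \<in> {0..1}" for s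
      unfolding G_def using that by (auto intro!: derivative_eq_intros simp: power2_eq_square)
    show "continuous_on {0..1} (\<lambda>s. 1 / (real k + 2 - s)\<^sup>2)" by (intro continuous_intros) auto
  qed auto
  also have "\<dots> = (\<integral>\<^sup>+t. ennreal (h (G (1 + (-1) * t)) * (1 / (real k + 2 - (1 + (-1) * t))\<^sup>2) * indicator {0..1} (1 + (-1) * t)) \<partial>lborel)"
    by (subst nn_integral_real_affine[where c = "-1" and t = 1]) (auto simp: G_def)
  also have "\<dots> = (\<integral>\<^sup>+t. ennreal (h (1 / (real k + 1 + t)) / (real k + 1 + t)\<^sup>2 * indicator {0..1} t) \<partial>lborel)"
  proof (rule nn_integral_cong)
    fix t :: real
    have e: "real k + 2 - (1 + (-1) * t) = real k + 1 + t" by simp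
    have i: "indicator {0..1} (1 + (-1) * t) = (indicator {0..1} t :: real)" by (auto split: split_indicator)
    show "ennreal (h (G (1 + (-1) * t)) * (1 / (real k + 2 - (1 + (-1) * t))\<^sup>2) * indicator {0..1} (1 + (-1) * t)) = 
       ennreal (h (1 / (real k + 1 + t)) / (real k + 1 + t)\<^sup>2 * indicator {0..1} t)"
      unfolding G_def e i by (simp only: times_divide_eq_right mult_1_right)
  qed
  finally show ?thesis by (simp add: G_def add_ac)
qed

lemma nn_integral_unit_branches:
  assumes h [measurable]: "h \<in> borel_measurable borel"
  shows "(\<integral>\<^sup>+x. ennreal (h x * indicator {0<..<1} x) \<partial>lborel) =
     (\<Sum>k. \<integral>\<^sup>+x. ennreal (h x * indicator {1 / (real k + 2)..1 / (real k + 1)} x) \<partial>lborel)"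
proof -
  have "(\<integral>\<^sup>+x. ennreal (h x * indicator {0<..<1} x) \<partial>lborel) =
     (\<integral>\<^sup>+x. (\<Sum>k. ennreal (h x * indicator {1 / (real k + 2)..1 / (real k + 1)} x)) \<partial>lborel)"
  proof (rule nn_integral_cong_AE)
    \<comment> \<open>The closed intervals overlap in the end points 1 / (k + 1). Off this countable
      set, each point of (0, 1) lies in just one of them.\<close>
    have "range (\<lambda>k. 1 / (real k + 1)) \<in> null_sets lborel"
      by (intro countable_imp_null_set_lborel) auto
    hence "AE x in lborel. x \<notin> range (\<lambda>k. 1 / (real k + 1))" by (rule AE_not_in)
    thus "AE x in lborel. ennreal (h x * indicator {0<..<1} x) = (\<Sum>k. ennreal (h x * indicator {1 / (real k + 2)..1 / (real k + 1)} x))"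
    proof eventually_elim
      case (elim x)
      show ?case
      proof (cases "x \<in> {0<..<1}")
        case True
        define j where "j = nat \<lfloor>1 / x\<rfloor> - 1"
        have "1 / x > 1" using True by (simp add: field_simps)
        hence fl: "\<lfloor>1 / x\<rfloor> \<ge> 1" by linarith
        hence "int j = \<lfloor>1 / x\<rfloor> - 1" unfolding j_def by linarith
        hence j: "real j = of_int \<lfloor>1 / x\<rfloor> - 1" by (metis of_int_of_nat_eq of_int_diff of_int_1)
        have mem: "x \<in> {1 / (real k + 2)..1 / (real k + 1)} \<longleftrightarrow> k = j" for k
        proof
          assume "k = j"
          moreover have "real j + 1 \<le> 1 / x" "1 / x \<le> real j + 2" unfolding j by linarith+
          ultimately show "x \<in> {1 / (real k + 2)..1 / (real k + 1)}"
            using True by (auto simp: field_simps)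
        next
          assume x: "x \<in> {1 / (real k + 2)..1 / (real k + 1)}"
          have "x \<noteq> 1 / (real (Suc k) + 1)" "x \<noteq> 1 / (real k + 1)" using elim by blast+
          hence "1 / (real k + 2) < x" "x < 1 / (real k + 1)" using x by (auto simp: add_ac)
          hence "1 / x < real k + 2" "real k + 1 < 1 / x" using True by (auto simp: field_simps)
          hence "\<lfloor>1 / x\<rfloor> = int k + 1" by (intro floor_unique) auto
          thus "k = j" by (simp add: j_def)
        qed
        have "(\<lambda>k. ennreal (h x * indicator {1 / (real k + 2)..1 / (real k + 1)} x)) = (\<lambda>k. if k = j then ennreal (h x) else 0)"
          by (auto simp: fun_eq_iff indicator_def mem simp del: atLeastAtMost_iff)
        moreover have "(\<lambda>k. if k = j then ennreal (h x) else 0) sums ennreal (h x)"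
          using sums_single[of j "\<lambda>_. ennreal (h x)"] by simp
        ultimately show ?thesis using True by (simp add: sums_iff)
      next
        case False
        have "x \<notin> {1 / (real k + 2)..1 / (real k + 1)}" for k
        proof
          assume x: "x \<in> {1 / (real k + 2)..1 / (real k + 1)}"
          have "x > 0" using x by (auto intro: less_le_trans[rotated])
          moreover have "1 / (real k + 1) \<le> 1" by simp
          hence "x \<le> 1" using x by (meson atLeastAtMost_iff order_trans)
          moreover have "x \<noteq> 1" using elim by (auto intro: rev_image_eqI[of 0])
          ultimately show False using False by auto
        qed
        thus ?thesis using False by simp
      qed
    qed
  qed
  also have "\<dots> = (\<Sum>k. \<integral>\<^sup>+x. ennreal (h x * indicator {1 / (real k + 2)..1 / (real k + 1)} x) \<partial>lborel)"
    by (rule nn_integral_suminf) simp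
  finally show ?thesis .
qed

lemma transfer_measurable [measurable]:
  assumes [measurable]: "g \<in> borel_measurable borel"
  shows "gauss_transfer S g \<in> borel_measurable borel"
  unfolding gauss_transfer_def branch_weight_def by measurable

text \<open>\<^const>\<open>gauss_transfer\<close> is the Perron-Frobenius operator of the Gauss map with respect to its invariant measure.\<close>

lemma transfer_duality:
  assumes [measurable]: "f \<in> borel_measurable borel" "g \<in> borel_measurable borel"
    and f: "\<And>x. f x \<ge> 0" and g: "\<And>x. x \<in> {0..1} \<Longrightarrow> 0 \<le> g x \<and> g x \<le> K"
  shows "(\<integral>\<^sup>+x. ennreal (of_bool (cf_digit 1 x \<in> S) * f (gauss_map x) * g x) \<partial>gauss_meas) =
         (\<integral>\<^sup>+t. ennreal (f t * gauss_transfer S g t) \<partial>gauss_meas)"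
proof -
  define h where "h = (\<lambda>x. of_bool (cf_digit 1 x \<in> S) * f (gauss_map x) * g x / ((1 + x) * ln 2))"
  have [measurable]: "h \<in> borel_measurable borel" unfolding h_def by measurable
  define a where "a = (\<lambda>k t. if Suc k \<in> S then branch_weight k t * g (1 / (real k + 1 + t)) else 0)"
  have [measurable]: "a k \<in> borel_measurable borel" for k unfolding a_def branch_weight_def by measurable
  have "(\<integral>\<^sup>+x. ennreal (of_bool (cf_digit 1 x \<in> S) * f (gauss_map x) * g x) \<partial>gauss_meas) = 
    (\<integral>\<^sup>+x. ennreal (h x * indicator {0<..<1} x) \<partial>lborel)"
    by (subst nn_integral_gauss) (auto simp: h_def intro!: nn_integral_cong)
  also have "\<dots> = (\<Sum>k. \<integral>\<^sup>+t. ennreal (h (1 / (real k + 1 + t)) / (real k + 1 + t)\<^sup>2 * indicator {0..1} t) \<partial>lborel)"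
    by (simp only: nn_integral_unit_branches[OF \<open>h \<in> borel_measurable borel\<close>] nn_integral_branch[OF \<open>h \<in> borel_measurable borel\<close>])
  also have "\<dots> = (\<Sum>k. \<integral>\<^sup>+t. ennreal ((f t * (indicator {0<..<1} t / ((1 + t) * ln 2))) * a k t) \<partial>lborel)"
  proof (intro arg_cong[where f = suminf] ext nn_integral_cong_AE)
    fix k
    show "AE t in lborel. ennreal (h (1 / (real k + 1 + t)) / (real k + 1 + t)\<^sup>2 * indicator {0..1} t) = 
      ennreal ((f t * (indicator {0<..<1} t / ((1 + t) * ln 2))) * a k t)"
      using AE_lborel_singleton[of 0] AE_lborel_singleton[of 1]
    proof eventually_elim
      case (elim t)
      show ?case
      proof (cases "t \<in> {0<..<1}")
        case True
        define m where "m = real k + 1 + t"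
        have m: "m > 0" using True by (simp add: m_def)
        have "h (1 / m) = of_bool (Suc k \<in> S) * f t * g (1 / m) / ((1 + 1 / m) * ln 2)"
          using cf_branch[of t k] True by (simp add: h_def m_def)
        moreover have "branch_weight k t = (1 + t) / (m * (m + 1))" by (simp add: branch_weight_def m_def add_ac)
        moreover have "c / ((1 + 1 / m) * ln 2) / m\<^sup>2 = c / ((1 + t) * ln 2) * ((1 + t) / (m * (m + 1)))" for c
        proof -
          have "(1 + 1 / m) * m\<^sup>2 = m * (m + 1)" using m by (simp add: power2_eq_square field_simps)
          moreover have "1 + t \<noteq> 0" using True by auto
          ultimately show ?thesis by (simp add: mult_ac)
        qed
        ultimately have "h (1 / m) / m\<^sup>2 = f t / ((1 + t) * ln 2) * a k t"
          by (auto simp: a_def m_def)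
        thus ?thesis using True by (simp add: m_def)
      next
        case False
        thus ?thesis using elim by (auto split: split_indicator)
      qed
    qed
  qed
  also have "\<dots> = (\<integral>\<^sup>+t. (\<Sum>k. ennreal ((f t * (indicator {0<..<1} t / ((1 + t) * ln 2))) * a k t)) \<partial>lborel)"
    by (rule nn_integral_suminf[symmetric]) simp
  also have "\<dots> = (\<integral>\<^sup>+t. ennreal ((f t * gauss_transfer S g t) * (indicator {0<..<1} t / ((1 + t) * ln 2))) \<partial>lborel)"
  proof (rule nn_integral_cong)
    fix t :: real
    show "(\<Sum>k. ennreal ((f t * (indicator {0<..<1} t / ((1 + t) * ln 2))) * a k t)) = ennreal ((f t * gauss_transfer S g t) * (indicator {0<..<1} t / ((1 + t) * ln 2)))"
    proof (cases "t \<in> {0<..<1}")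
      case True
      hence t: "t \<in> {0..1}" by auto
      have "\<bar>g x\<bar> \<le> K" if "x \<in> {0..1}" for x using g[OF that] by simp
      hence sm: "summable (\<lambda>k. a k t)" unfolding a_def by (rule transfer_summable[OF t])
      have nn: "a k t \<ge> 0" for k using g[OF branch_point_mem[OF t, of k]] branch_weight_nonneg[OF t] by (auto simp: a_def)
      let ?c = "f t * (indicator {0<..<1} t / ((1 + t) * ln 2))"
      have c: "?c \<ge> 0" using f[of t] t by (auto split: split_indicator)
      have "(\<Sum>k. ennreal (?c * a k t)) = ennreal (\<Sum>k. ?c * a k t)"
        by (rule suminf_ennreal2[OF mult_nonneg_nonneg[OF c nn] summable_mult[OF sm]])
      also have "(\<Sum>k. ?c * a k t) = ?c * gauss_transfer S g t"
        unfolding suminf_mult[OF sm] by (simp add: gauss_transfer_def a_def)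
      finally show ?thesis by (simp add: mult_ac)
    qed simp
  qed
  also have "\<dots> = (\<integral>\<^sup>+t. ennreal (f t * gauss_transfer S g t) \<partial>gauss_meas)"
    by (rule nn_integral_gauss[symmetric]) simp
  finally show ?thesis .
qed

lemma gauss_integrable:
  fixes f :: "real \<Rightarrow> real"
  assumes "f \<in> borel_measurable borel" "\<And>x. x \<in> {0..1} \<Longrightarrow> \<bar>f x\<bar> \<le> C"
  shows "integrable gauss_meas f"
proof (rule gauss.integrable_const_bound[where B = C])
  show "AE x in gauss_meas. norm (f x) \<le> C" using AE_gauss by eventually_elim (use assms(2) in auto)
qed (use assms(1) in auto)

lemma gauss_integral_abs_le:
  fixes f :: "real \<Rightarrow> real"
  assumes "f \<in> borel_measurable borel" "\<And>x. x \<in> {0..1} \<Longrightarrow> \<bar>f x\<bar> \<le> C"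
  shows "\<bar>\<integral>x. f x \<partial>gauss_meas\<bar> \<le> C"
proof -
  have "\<bar>\<integral>x. f x \<partial>gauss_meas\<bar> \<le> (\<integral>x. \<bar>f x\<bar> \<partial>gauss_meas)"
    by (rule integral_abs_bound)
  also have "\<dots> \<le> C"
  proof (rule gauss.integral_le_const)
    show "integrable gauss_meas (\<lambda>x. \<bar>f x\<bar>)" using gauss_integrable[OF assms] by simp
    show "AE x in gauss_meas. \<bar>f x\<bar> \<le> C" using AE_gauss by eventually_elim (use assms(2) in auto)
  qed
  finally show ?thesis .
qed

section \<open>Iterating the restricted operator\<close>

definition unit_fun :: "real \<Rightarrow> (real \<Rightarrow> real) \<Rightarrow> bool" where
  "unit_fun K g \<longleftrightarrow> g \<in> borel_measurable borel \<and> (\<forall>x\<in>{0..1}. 0 \<le> g x \<and> g x \<le> K)"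

lemma unit_funD:
  assumes "unit_fun K g"
  shows "g \<in> borel_measurable borel" "x \<in> {0..1} \<Longrightarrow> 0 \<le> g x \<and> g x \<le> K" "x \<in> {0..1} \<Longrightarrow> \<bar>g x\<bar> \<le> K"
  using assms by (auto simp: unit_fun_def)

lemma unit_fun_transfer:
  assumes "unit_fun K g"
  shows "unit_fun K (gauss_transfer S g)"
  unfolding unit_fun_def using unit_funD(1)[OF assms] transfer_bounds[OF _ unit_funD(2)[OF assms]] by auto

lemma unit_fun_transfer_pow:
  assumes "unit_fun K g"
  shows "unit_fun K ((gauss_transfer S ^^ n) g)"
  by (induction n) (auto simp: assms unit_fun_transfer)

text \<open>Each use of duality strips the first digit: the condition on the remaining digits is a
  function of \<open>gauss_map x\<close>, and the condition on the first one goes into the operator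
  acting on the density.\<close>

lemma nn_integral_no_hit:
  assumes "unit_fun K g"
  shows "(\<integral>\<^sup>+x. ennreal (of_bool (no_hit B n x) * g x) \<partial>gauss_meas) = (\<integral>\<^sup>+t. ennreal ((gauss_transfer (- B) ^^ n) g t) \<partial>gauss_meas)"
  using assms
proof (induction n arbitrary: g)
  case (Suc n)
  have eq: "of_bool (no_hit B (Suc n) x) = (of_bool (cf_digit 1 x \<in> - B) * of_bool (no_hit B n (gauss_map x)) :: real)" for x
    by (auto simp: no_hit_Suc)
  have "(\<integral>\<^sup>+x. ennreal (of_bool (no_hit B (Suc n) x) * g x) \<partial>gauss_meas) = 
        (\<integral>\<^sup>+t. ennreal (of_bool (no_hit B n t) * gauss_transfer (- B) g t) \<partial>gauss_meas)"
    unfolding eq by (rule transfer_duality) (use unit_funD[OF Suc.prems] in auto)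
  also have "\<dots> = (\<integral>\<^sup>+t. ennreal ((gauss_transfer (- B) ^^ n) (gauss_transfer (- B) g) t) \<partial>gauss_meas)"
    by (rule Suc.IH[OF unit_fun_transfer[OF Suc.prems]])
  finally show ?case by (simp only: funpow_Suc_right o_apply)
qed simp

lemma integral_of_nn_integral_gauss:
  fixes f h :: "real \<Rightarrow> real"
  assumes "unit_fun K f" "unit_fun K h" "(\<integral>\<^sup>+x. ennreal (f x) \<partial>gauss_meas) = (\<integral>\<^sup>+x. ennreal (h x) \<partial>gauss_meas)"
  shows "(\<integral>x. f x \<partial>gauss_meas) = (\<integral>x. h x \<partial>gauss_meas)"
proof -
  have "(\<integral>x. f x \<partial>gauss_meas) = enn2real (\<integral>\<^sup>+x. ennreal (f x) \<partial>gauss_meas)" if "unit_fun K f" for f :: "real \<Rightarrow> real"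
  proof (rule integral_eq_nn_integral)
    show "AE x in gauss_meas. 0 \<le> f x" using AE_gauss by eventually_elim (use unit_funD(2)[OF that] in auto)
  qed (use unit_funD(1)[OF that] in simp)
  thus ?thesis using assms by simp
qed

lemma integral_no_hit:
  assumes g: "unit_fun K g"
  shows "(\<integral>x. of_bool (no_hit B n x) * g x \<partial>gauss_meas) = (\<integral>t. (gauss_transfer (- B) ^^ n) g t \<partial>gauss_meas)"
proof (rule integral_of_nn_integral_gauss[OF _ unit_fun_transfer_pow[OF g] nn_integral_no_hit[OF g]])
  have [measurable]: "g \<in> borel_measurable borel" by (rule unit_funD[OF g])
  have "K \<ge> 0" using unit_funD(2)[OF g, of 0] by auto
  thus "unit_fun K (\<lambda>x. of_bool (no_hit B n x) * g x)"
    using unit_funD(2)[OF g] by (auto simp: unit_fun_def)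
qed

text \<open>Invariance of the Gauss measure, obtained as the case of one digit and an empty
  forbidden set.\<close>

lemma integral_transfer_UNIV:
  assumes g: "unit_fun K g"
  shows "(\<integral>t. gauss_transfer UNIV g t \<partial>gauss_meas) = (\<integral>t. g t \<partial>gauss_meas)"
  using integral_no_hit[OF g, of "{}" 1] by (simp add: no_hit_def)

lemma lip01_mono: "lip01 L g \<Longrightarrow> L \<le> L' \<Longrightarrow> lip01 L' g"
  unfolding lip01_def by (meson abs_ge_zero mult_right_mono order_trans)

lemma lip01_transfer_Compl:
  assumes g: "unit_fun K g" and L: "lip01 L g" "L \<ge> 0"
  shows "lip01 (11 / 12 * L + inv_sq_sum B * (4 * K + 2 * L)) (gauss_transfer (- B) g)"
  unfolding lip01_def
proof safe
  fix t s :: real assume t: "t \<in> {0..1}" and s: "s \<in> {0..1}"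
  note ga = unit_funD(3)[OF g]
  have "\<bar>gauss_transfer UNIV g t - gauss_transfer UNIV g s\<bar> \<le> 11 / 12 * L * \<bar>t - s\<bar>"
    by (rule lip01D[OF transfer_lip_contraction[OF ga L] t s])
  moreover have "\<bar>gauss_transfer B g t - gauss_transfer B g s\<bar> \<le> inv_sq_sum B * (4 * K + 2 * L) * \<bar>t - s\<bar>"
    by (rule lip01D[OF transfer_lip_small[OF ga L] t s])
  moreover have "gauss_transfer (- B) g t = gauss_transfer UNIV g t - gauss_transfer B g t"
    by (rule transfer_Compl[OF t ga])
  moreover have "gauss_transfer (- B) g s = gauss_transfer UNIV g s - gauss_transfer B g s"
    by (rule transfer_Compl[OF s ga])
  ultimately show "\<bar>gauss_transfer (- B) g t - gauss_transfer (- B) g s\<bar> \<le> (11 / 12 * L + inv_sq_sum B * (4 * K + 2 * L)) * \<bar>t - s\<bar>"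
    unfolding distrib_right by linarith
qed

text \<open>For \<sigma> \<le> 1/48 one step takes a Lipschitz constant M to at most (11/12 + 2/48)
  M + 4 \<sigma> K = 23/24 M + 4 \<sigma> K, and 96 \<sigma> K is the fixed point of this
  recursion.\<close>

lemma lip01_transfer_pow:
  assumes g: "unit_fun K g" and L: "lip01 L g" "L \<ge> 0" and B: "inv_sq_sum B \<le> 1 / 48"
  shows "lip01 ((23 / 24) ^ n * L + 96 * inv_sq_sum B * K) ((gauss_transfer (- B) ^^ n) g)"
proof (induction n)
  case 0
  have "K \<ge> 0" using unit_funD(2)[OF g, of 0] by auto
  thus ?case using L inv_sq_sum_nonneg[of B] by (auto intro: lip01_mono)
next
  case (Suc n)
  define M where "M = (23 / 24) ^ n * L + 96 * inv_sq_sum B * K"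
  have "K \<ge> 0" using unit_funD(2)[OF g, of 0] by auto
  hence M: "M \<ge> 0" using L inv_sq_sum_nonneg[of B] by (simp add: M_def)
  have lip: "lip01 (11 / 12 * M + inv_sq_sum B * (4 * K + 2 * M)) (gauss_transfer (- B) ((gauss_transfer (- B) ^^ n) g))"
    using Suc.IH M by (intro lip01_transfer_Compl unit_fun_transfer_pow g) (auto simp: M_def)
  have "inv_sq_sum B * M \<le> 1 / 48 * M" using B M by (rule mult_right_mono)
  hence "11 / 12 * M + inv_sq_sum B * (4 * K + 2 * M) \<le> 23 / 24 * M + 4 * inv_sq_sum B * K"
    by (simp add: algebra_simps)
  also have "\<dots> = (23 / 24) ^ Suc n * L + 96 * inv_sq_sum B * K" by (simp add: M_def algebra_simps)
  finally show ?case using lip01_mono[OF lip] by simp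
qed

text \<open>The means q n of the iterates satisfy q (n+1) = (1 - e) q n up to 2 \<sigma> M n, with M
  n the current Lipschitz constant: an iterate lies within M n of its mean, and the operator of the
  deleted branches maps 1 below 2 \<sigma>. Summing M n gives at most 24 L from the geometric part
  and 96 n \<sigma> K from the constant part, hence the factors 48 and 192.\<close>

lemma no_hit_rate:
  assumes g: "unit_fun K g" and L: "lip01 L g" "L \<ge> 0" and B: "inv_sq_sum B \<le> 1 / 48"
  shows "\<bar>(\<integral>x. of_bool (no_hit B n x) * g x \<partial>gauss_meas) 
      - (1 - (\<integral>t. gauss_transfer B (\<lambda>_. 1) t \<partial>gauss_meas)) ^ n * (\<integral>x. g x \<partial>gauss_meas)\<bar>
     \<le> 48 * inv_sq_sum B * L + 192 * real n * (inv_sq_sum B)\<^sup>2 * K"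
proof -
  define \<sigma> where "\<sigma> = inv_sq_sum B"
  have \<sigma>: "\<sigma> \<ge> 0" by (simp add: \<sigma>_def inv_sq_sum_nonneg)
  have K: "K \<ge> 0" using unit_funD(2)[OF g, of 0] by auto
  define G where "G = (\<lambda>n. (gauss_transfer (- B) ^^ n) g)"
  have uG: "unit_fun K (G n)" for n unfolding G_def by (rule unit_fun_transfer_pow[OF g])
  define q where "q = (\<lambda>n. \<integral>t. G n t \<partial>gauss_meas)"
  define e where "e = (\<integral>t. gauss_transfer B (\<lambda>_. 1) t \<partial>gauss_meas)"
  have u1: "unit_fun 1 (\<lambda>_. 1)" by (simp add: unit_fun_def)
  have uB: "unit_fun 1 (gauss_transfer B (\<lambda>_. 1))" by (rule unit_fun_transfer[OF u1])
  have intB: "integrable gauss_meas (gauss_transfer B (\<lambda>_. 1))"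
    by (rule gauss_integrable[OF unit_funD(1)[OF uB] unit_funD(3)[OF uB]])
  have e: "0 \<le> e" "e \<le> 1"
  proof -
    show "0 \<le> e" unfolding e_def
      by (rule integral_nonneg_AE) (use AE_gauss in eventually_elim, use unit_funD(2)[OF uB] in auto)
    show "e \<le> 1" using gauss_integral_abs_le[OF unit_funD(1)[OF uB] unit_funD(3)[OF uB]] by (simp add: e_def)
  qed
  define M where "M = (\<lambda>n. (23 / 24) ^ n * L + 96 * \<sigma> * K)"
  have M: "M n \<ge> 0" for n using L \<sigma> K by (simp add: M_def)
  have step: "\<bar>q (Suc n) - (1 - e) * q n\<bar> \<le> 2 * \<sigma> * M n" for n
  proof -
    have lip: "lip01 (M n) (G n)" unfolding M_def G_def \<sigma>_def by (rule lip01_transfer_pow[OF g L B])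
    have intG: "integrable gauss_meas (G n)" by (rule gauss_integrable[OF unit_funD(1)[OF uG] unit_funD(3)[OF uG]])
    have near: "\<bar>G n x - q n\<bar> \<le> M n" if x: "x \<in> {0..1}" for x
    proof -
      have "G n x - q n = (\<integral>t. G n x - G n t \<partial>gauss_meas)"
        using intG by (simp add: q_def)
      also have "\<bar>\<dots>\<bar> \<le> M n"
      proof (rule gauss_integral_abs_le)
        show "(\<lambda>t. G n x - G n t) \<in> borel_measurable borel" using unit_funD(1)[OF uG, of n] by simp
        fix t :: real assume t: "t \<in> {0..1}"
        have "\<bar>G n x - G n t\<bar> \<le> M n * \<bar>x - t\<bar>" by (rule lip01D[OF lip x t])
        also have "\<dots> \<le> M n * 1" using x t by (intro mult_left_mono M) auto
        finally show "\<bar>G n x - G n t\<bar> \<le> M n" by simp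
      qed
      finally show ?thesis .
    qed
    have uT: "unit_fun K (gauss_transfer S (G n))" for S by (rule unit_fun_transfer[OF uG])
    have intT: "integrable gauss_meas (gauss_transfer S (G n))" for S by (rule gauss_integrable[OF unit_funD(1)[OF uT] unit_funD(3)[OF uT]])
    have "q (Suc n) = (\<integral>t. gauss_transfer UNIV (G n) t - gauss_transfer B (G n) t \<partial>gauss_meas)"
      unfolding q_def
    proof (rule integral_cong_AE)
      show "AE t in gauss_meas. G (Suc n) t = gauss_transfer UNIV (G n) t - gauss_transfer B (G n) t"
        using AE_gauss
      proof eventually_elim
        case (elim t)
        hence "t \<in> {0..1}" by auto
        from transfer_Compl[OF this unit_funD(3)[OF uG]] show ?case by (simp add: G_def)
      qed
    qed (use unit_funD(1)[OF uG, of "Suc n"] unit_funD(1)[OF uT] in auto)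
    also have "\<dots> = q n - (\<integral>t. gauss_transfer B (G n) t \<partial>gauss_meas)"
      using intT by (simp add: integral_transfer_UNIV[OF uG] q_def)
    finally have "q (Suc n) - (1 - e) * q n = - ((\<integral>t. gauss_transfer B (G n) t \<partial>gauss_meas) - q n * e)"
      by (simp add: algebra_simps)
    also have "(\<integral>t. gauss_transfer B (G n) t \<partial>gauss_meas) - q n * e = (\<integral>t. gauss_transfer B (G n) t - q n * gauss_transfer B (\<lambda>_. 1) t \<partial>gauss_meas)"
      using intT intB by (simp add: e_def)
    finally have eq: "q (Suc n) - (1 - e) * q n = - (\<integral>t. gauss_transfer B (G n) t - q n * gauss_transfer B (\<lambda>_. 1) t \<partial>gauss_meas)" .
    have "\<bar>\<integral>t. gauss_transfer B (G n) t - q n * gauss_transfer B (\<lambda>_. 1) t \<partial>gauss_meas\<bar> \<le> 2 * \<sigma> * M n"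
    proof (rule gauss_integral_abs_le)
      show "(\<lambda>t. gauss_transfer B (G n) t - q n * gauss_transfer B (\<lambda>_. 1) t) \<in> borel_measurable borel"
        using unit_funD(1)[OF uT, of B] unit_funD(1)[OF uB] by simp
      fix t :: real assume t: "t \<in> {0..1}"
      have "\<bar>gauss_transfer B (G n) t - q n * gauss_transfer B (\<lambda>_. 1) t\<bar> \<le> M n * gauss_transfer B (\<lambda>_. 1) t"
        by (rule transfer_diff_const_le[OF t near])
      also have "\<dots> \<le> M n * (2 * \<sigma>)" unfolding \<sigma>_def by (intro mult_left_mono M transfer_one_le(3) t)
      finally show "\<bar>gauss_transfer B (G n) t - q n * gauss_transfer B (\<lambda>_. 1) t\<bar> \<le> 2 * \<sigma> * M n" by (simp add: mult_ac)
    qed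
    thus ?thesis unfolding eq by simp
  qed
  \<comment> \<open>As 0 \<le> 1 - e \<le> 1, earlier errors are not amplified.\<close>
  have acc: "\<bar>q n - (1 - e) ^ n * q 0\<bar> \<le> (\<Sum>j<n. 2 * \<sigma> * M j)"
  proof (induction n)
    case (Suc n)
    have "q (Suc n) - (1 - e) ^ Suc n * q 0 = (q (Suc n) - (1 - e) * q n) + (1 - e) * (q n - (1 - e) ^ n * q 0)"
      by (simp add: algebra_simps)
    also have "\<bar>\<dots>\<bar> \<le> \<bar>q (Suc n) - (1 - e) * q n\<bar> + (1 - e) * \<bar>q n - (1 - e) ^ n * q 0\<bar>"
      using e by (metis abs_mult abs_of_nonneg abs_triangle_ineq diff_ge_0_iff_ge)
    also have "\<dots> \<le> 2 * \<sigma> * M n + 1 * (\<Sum>j<n. 2 * \<sigma> * M j)"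
      using e by (intro add_mono mult_mono step Suc.IH) auto
    finally show ?case by simp
  qed simp
  have geo: "(\<Sum>j<n. (23 / 24 :: real) ^ j) \<le> 24"
  proof -
    have "(\<Sum>j<n. (23 / 24 :: real) ^ j) = (1 - (23 / 24) ^ n) * 24" by (subst sum_gp_strict) simp
    thus ?thesis by simp
  qed
  have "(\<Sum>j<n. 2 * \<sigma> * M j) = 2 * \<sigma> * L * (\<Sum>j<n. (23 / 24) ^ j) + 192 * real n * \<sigma>\<^sup>2 * K"
    by (simp add: M_def algebra_simps sum.distrib sum_distrib_left power2_eq_square)
  also have "\<dots> \<le> 2 * \<sigma> * L * 24 + 192 * real n * \<sigma>\<^sup>2 * K"
    using \<sigma> L by (intro add_right_mono mult_left_mono geo) auto
  finally have "\<bar>q n - (1 - e) ^ n * q 0\<bar> \<le> 48 * \<sigma> * L + 192 * real n * \<sigma>\<^sup>2 * K"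
    using acc by (simp add: mult_ac)
  moreover have "(\<integral>x. of_bool (no_hit B n x) * g x \<partial>gauss_meas) = q n"
    unfolding integral_no_hit[OF g] q_def G_def ..
  moreover have "(\<integral>x. g x \<partial>gauss_meas) = q 0" by (simp add: q_def G_def)
  ultimately show ?thesis by (simp add: e_def \<sigma>_def)
qed

section \<open>The limit law\<close>

definition large_primes :: "real \<Rightarrow> nat set" where
  "large_primes L = {p. prime p \<and> real p > L}"

text \<open>By duality, the Gauss measure of the points whose first digit is a prime above L, in the
  form in which \<open>no_hit_rate\<close> uses it.\<close>

definition hit_prob :: "real \<Rightarrow> real" where
  "hit_prob L = (\<integral>t. gauss_transfer (large_primes L) (\<lambda>_. 1) t \<partial>gauss_meas)"

lemma inv_sq_sum_large_primes: "inv_sq_sum (large_primes L) = prime_tail L"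
proof -
  have "(\<Sum>k. if prime (Suc k) \<and> real (Suc k) > L then 1 / real (Suc k) ^ 2 else 0) = prime_tail L - (if prime (0::nat) \<and> real 0 > L then 1 / real 0 ^ 2 else 0)"
    unfolding prime_tail_def by (rule suminf_split_head[OF summable_prime_tail])
  moreover have "inv_sq_sum (large_primes L) = (\<Sum>k. if prime (Suc k) \<and> real (Suc k) > L then 1 / real (Suc k) ^ 2 else 0)"
    unfolding inv_sq_sum_def large_primes_def mem_Collect_eq of_nat_Suc add.commute[of 1] ..
  ultimately show ?thesis by simp
qed

text \<open>Source of the log 2 in the normalisation: the operator of the deleted branches maps 1 to
  nearly \<sigma> (1 + t), whose Gauss mean is \<sigma> / ln 2.\<close>

lemma gauss_integral_1_plus: "(\<integral>x. 1 + x \<partial>gauss_meas) = 1 / ln 2"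
proof -
  have "(\<integral>x. 1 + x \<partial>gauss_meas) = enn2real (\<integral>\<^sup>+x. ennreal (1 + x) \<partial>gauss_meas)"
    by (rule integral_eq_nn_integral) (use AE_gauss in \<open>auto elim!: eventually_mono\<close>)
  also have "(\<integral>\<^sup>+x. ennreal (1 + x) \<partial>gauss_meas) = (\<integral>\<^sup>+x. ennreal (1 / ln 2) * indicator {0<..<1::real} x \<partial>lborel)"
  proof (rule trans[OF nn_integral_gauss nn_integral_cong])
    fix x :: real
    show "ennreal ((1 + x) * (indicator {0<..<1} x / ((1 + x) * ln 2))) = ennreal (1 / ln 2) * indicator {0<..<1} x"
      by (auto split: split_indicator)
  qed simp
  also have "\<dots> = ennreal (1 / ln 2)" by (subst nn_integral_cmult_indicator) auto
  finally show ?thesis by simp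
qed

text \<open>For a digit m > L the weight (1 + t) / ((m + t) (m + 1 + t)) lies between (1 + t) /
  ((m+1) (m+2)) and (1 + t) / m^2, whose ratio is at least 1 - 3/m.\<close>

lemma transfer_one_sharp:
  assumes t: "t \<in> {0..1}" and L: "L \<ge> 3" and B: "\<And>p. p \<in> B \<Longrightarrow> real p > L"
  shows "gauss_transfer B (\<lambda>_. 1) t \<le> inv_sq_sum B * (1 + t)"
    and "(1 - 3 / L) * inv_sq_sum B * (1 + t) \<le> gauss_transfer B (\<lambda>_. 1) t"
proof -
  have sm: "summable (\<lambda>k. if Suc k \<in> B then branch_weight k t * 1 else 0)"
    by (rule transfer_summable[OF t, of _ 1]) auto
  let ?s = "\<lambda>k. if Suc k \<in> B then 1 / (real k + 1)\<^sup>2 else 0"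
  have "gauss_transfer B (\<lambda>_. 1) t \<le> (\<Sum>k. (1 + t) * ?s k)"
    unfolding gauss_transfer_def
  proof (rule suminf_le[OF _ sm summable_mult[OF summable_inv_sq_if]])
    fix k
    have "branch_weight k t \<le> (1 + t) / ((real k + 1) * (real k + 1))"
      unfolding branch_weight_def using t by (intro divide_left_mono mult_mono mult_pos_pos) auto
    thus "(if Suc k \<in> B then branch_weight k t * 1 else 0) \<le> (1 + t) * ?s k"
      by (simp add: power2_eq_square)
  qed
  thus "gauss_transfer B (\<lambda>_. 1) t \<le> inv_sq_sum B * (1 + t)"
    unfolding suminf_mult[OF summable_inv_sq_if] inv_sq_sum_def[symmetric] by (simp add: mult.commute)
  have "(\<Sum>k. ((1 - 3 / L) * (1 + t)) * ?s k) \<le> gauss_transfer B (\<lambda>_. 1) t"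
    unfolding gauss_transfer_def
  proof (rule suminf_le[OF _ summable_mult[OF summable_inv_sq_if] sm])
    fix k
    show "((1 - 3 / L) * (1 + t)) * ?s k \<le> (if Suc k \<in> B then branch_weight k t * 1 else 0)"
    proof (cases "Suc k \<in> B")
      case True
      define m where "m = real k + 1"
      have m: "m > L" "m > 0" using B[OF True] L by (auto simp: m_def)
      have "1 - 3 / L \<le> 1 - 3 / m" using m L by (simp add: frac_le)
      also have "\<dots> \<le> m * m / ((m + 1) * (m + 2))"
      proof -
        have "(1 - 3 / m) * ((m + 1) * (m + 2)) = m * m - 7 - 6 / m" using m by (simp add: field_simps)
        also have "\<dots> \<le> m * m"
        proof -
          have "0 \<le> 6 / m" using m by simp
          thus ?thesis by linarith
        qed
        finally show ?thesis using m by (simp add: le_divide_eq)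
      qed
      finally have "(1 - 3 / L) / (m * m) \<le> m * m / ((m + 1) * (m + 2)) / (m * m)"
        by (rule divide_right_mono) (use m in auto)
      also have "\<dots> = 1 / ((m + 1) * (m + 2))" using m by simp
      also have "\<dots> \<le> 1 / ((m + t) * (m + 1 + t))"
        using m t by (intro divide_left_mono mult_mono mult_pos_pos) auto
      finally have "(1 + t) * ((1 - 3 / L) / (m * m)) \<le> (1 + t) * (1 / ((m + t) * (m + 1 + t)))"
        using t by (intro mult_left_mono) auto
      thus ?thesis using True by (simp add: branch_weight_def m_def power2_eq_square add_ac mult_ac)
    qed simp
  qed
  thus "(1 - 3 / L) * inv_sq_sum B * (1 + t) \<le> gauss_transfer B (\<lambda>_. 1) t"
    unfolding suminf_mult[OF summable_inv_sq_if] inv_sq_sum_def[symmetric] by (simp add: mult_ac)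
qed

lemma hit_prob_bounds:
  assumes L: "L \<ge> 3"
  shows "hit_prob L \<le> prime_tail L / ln 2" "(1 - 3 / L) * prime_tail L / ln 2 \<le> hit_prob L"
proof -
  let ?B = "large_primes L"
  have B: "\<And>p. p \<in> ?B \<Longrightarrow> real p > L" by (simp add: large_primes_def)
  have u: "unit_fun 1 (gauss_transfer ?B (\<lambda>_. 1))" by (rule unit_fun_transfer) (simp add: unit_fun_def)
  have i: "integrable gauss_meas (gauss_transfer ?B (\<lambda>_. 1))" by (rule gauss_integrable[OF unit_funD(1)[OF u] unit_funD(3)[OF u]])
  have i1: "integrable gauss_meas (\<lambda>x. c * (1 + x))" for c
    by (rule integrable_mult_right, rule gauss_integrable[where C = 2]) auto
  have ic: "(\<integral>x. c * (1 + x) \<partial>gauss_meas) = c / ln 2" for c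
    by (subst Bochner_Integration.integral_mult_right_zero) (simp add: gauss_integral_1_plus)
  have "hit_prob L \<le> (\<integral>x. prime_tail L * (1 + x) \<partial>gauss_meas)"
    unfolding hit_prob_def
  proof (rule integral_mono_AE[OF i i1])
    show "AE t in gauss_meas. gauss_transfer ?B (\<lambda>_. 1) t \<le> prime_tail L * (1 + t)"
      using AE_gauss
    proof eventually_elim
      case (elim t)
      hence t: "t \<in> {0..1}" by auto
      show ?case using transfer_one_sharp(1)[OF t L, of ?B] B by (simp add: inv_sq_sum_large_primes)
    qed
  qed
  thus "hit_prob L \<le> prime_tail L / ln 2" by (simp only: ic)
  have "(\<integral>x. (1 - 3 / L) * prime_tail L * (1 + x) \<partial>gauss_meas) \<le> hit_prob L"
    unfolding hit_prob_def
  proof (rule integral_mono_AE[OF i1 i])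
    show "AE t in gauss_meas. (1 - 3 / L) * prime_tail L * (1 + t) \<le> gauss_transfer ?B (\<lambda>_. 1) t"
      using AE_gauss
    proof eventually_elim
      case (elim t)
      hence t: "t \<in> {0..1}" by auto
      show ?case using transfer_one_sharp(2)[OF t L, of ?B] B by (simp add: inv_sq_sum_large_primes)
    qed
  qed
  thus "(1 - 3 / L) * prime_tail L / ln 2 \<le> hit_prob L" by (simp only: ic)
qed

text \<open>Since n e n converges, e n tends to 0, and n ln (1 - e n) differs from - n e n by at
  most 2 n (e n)^2 for large n.\<close>

lemma one_minus_pow_tendsto:
  fixes e :: "nat \<Rightarrow> real"
  assumes e: "\<And>n. 0 \<le> e n" "(\<lambda>n. real n * e n) \<longlonglongrightarrow> a"
  shows "(\<lambda>n. (1 - e n) ^ n) \<longlonglongrightarrow> exp (- a)"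
proof -
  have "(\<lambda>n. (real n * e n) * (1 / real n)) \<longlonglongrightarrow> a * 0"
    by (intro tendsto_mult e lim_1_over_n)
  hence "(\<lambda>n. (real n * e n) * (1 / real n)) \<longlonglongrightarrow> 0" by simp
  hence e0: "e \<longlonglongrightarrow> 0"
  proof (rule Lim_transform_eventually)
    show "\<forall>\<^sub>F n in sequentially. (real n * e n) * (1 / real n) = e n"
      using eventually_gt_at_top[of 0] by eventually_elim simp
  qed
  have ev: "\<forall>\<^sub>F n in sequentially. e n \<le> 1 / 2"
    using order_tendstoD(2)[OF e0, of "1/2"] by (auto elim: eventually_mono)
  have "(\<lambda>n. real n * ln (1 - e n) + real n * e n) \<longlonglongrightarrow> 0"
  proof (rule Lim_null_comparison)
    show "(\<lambda>n. 2 * (real n * e n) * e n) \<longlonglongrightarrow> 0"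
      using tendsto_mult[OF tendsto_mult[OF tendsto_const[of 2] e(2)] e0] by simp
    show "\<forall>\<^sub>F n in sequentially. norm (real n * ln (1 - e n) + real n * e n) \<le> 2 * (real n * e n) * e n"
      using ev
    proof eventually_elim
      case (elim n)
      have "\<bar>ln (1 + (- e n)) - (- e n)\<bar> \<le> 2 * (- e n)\<^sup>2"
        by (rule abs_ln_one_plus_x_minus_x_bound_nonpos) (use elim e(1)[of n] in auto)
      hence "real n * \<bar>ln (1 - e n) + e n\<bar> \<le> real n * (2 * (e n)\<^sup>2)" by (intro mult_left_mono) auto
      moreover have "norm (real n * ln (1 - e n) + real n * e n) = real n * \<bar>ln (1 - e n) + e n\<bar>"
        by (simp add: abs_mult flip: distrib_left)
      ultimately show ?case by (simp add: power2_eq_square mult_ac)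
    qed
  qed
  from tendsto_diff[OF this e(2)] have "(\<lambda>n. real n * ln (1 - e n)) \<longlonglongrightarrow> - a" by simp
  hence "(\<lambda>n. exp (real n * ln (1 - e n))) \<longlonglongrightarrow> exp (- a)" by (rule tendsto_exp)
  thus ?thesis
  proof (rule Lim_transform_eventually)
    show "\<forall>\<^sub>F n in sequentially. exp (real n * ln (1 - e n)) = (1 - e n) ^ n"
      using ev
    proof eventually_elim
      case (elim n)
      hence "1 - e n > 0" by simp
      thus ?case by (simp add: exp_of_nat_mult)
    qed
  qed
qed

text \<open>The threshold for the maximum itself that corresponds to y for the normalised
  maximum.\<close>

definition level :: "real \<Rightarrow> nat \<Rightarrow> real" where
  "level y n = y * real n / (ln 2 * ln (real n))"

lemma level_at_top: "y > 0 \<Longrightarrow> filterlim (level y) at_top sequentially"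
  unfolding level_def by real_asymp

text \<open>As ln (level y n) is asymptotic to ln n, \<open>level y n * ln (level y n)\<close> is
  asymptotic to y n / ln 2.\<close>

lemma level_prime_tail:
  assumes y: "y > 0"
  shows "(\<lambda>n. real n * prime_tail (level y n)) \<longlonglongrightarrow> ln 2 / y"
proof -
  have "(\<lambda>n. real n / (level y n * ln (level y n))) \<longlonglongrightarrow> inverse y * ln 2"
    unfolding level_def using y by real_asymp
  hence "(\<lambda>n. real n / (level y n * ln (level y n))) \<longlonglongrightarrow> ln 2 / y"
    by (simp only: divide_inverse mult.commute)
  hence "(\<lambda>n. real n / (level y n * ln (level y n)) * (level y n * ln (level y n) * prime_tail (level y n))) \<longlonglongrightarrow> ln 2 / y * 1"
    by (rule tendsto_mult[OF _ prime_tail_asymp[OF level_at_top[OF y]]])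
  hence "(\<lambda>n. real n / (level y n * ln (level y n)) * (level y n * ln (level y n) * prime_tail (level y n))) \<longlonglongrightarrow> ln 2 / y"
    by simp
  thus ?thesis
  proof (rule Lim_transform_eventually)
    have "\<forall>\<^sub>F n in sequentially. level y n > 1"
      using level_at_top[OF y] by (simp add: filterlim_at_top_dense)
    thus "\<forall>\<^sub>F n in sequentially. real n / (level y n * ln (level y n)) * (level y n * ln (level y n) * prime_tail (level y n)) = real n * prime_tail (level y n)"
      by eventually_elim simp
  qed
qed

lemma hit_prob_nonneg: "0 \<le> hit_prob L"
  unfolding hit_prob_def
proof (rule integral_nonneg_AE)
  show "AE t in gauss_meas. 0 \<le> gauss_transfer (large_primes L) (\<lambda>_. 1) t"
    using AE_gauss by eventually_elim (auto intro: transfer_one_le)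
qed

lemma level_hit_prob:
  assumes y: "y > 0"
  shows "(\<lambda>n. real n * hit_prob (level y n)) \<longlonglongrightarrow> 1 / y"
proof (rule real_tendsto_sandwich)
  have ev: "\<forall>\<^sub>F n in sequentially. level y n > 3"
    using level_at_top[OF y] by (simp add: filterlim_at_top_dense)
  show "\<forall>\<^sub>F n in sequentially. (1 - 3 / level y n) * (real n * prime_tail (level y n)) / ln 2 \<le> real n * hit_prob (level y n)"
    using ev
  proof eventually_elim
    case (elim n)
    hence "real n * ((1 - 3 / level y n) * prime_tail (level y n) / ln 2) \<le> real n * hit_prob (level y n)"
      by (intro mult_left_mono hit_prob_bounds) auto
    thus ?case by (simp add: mult_ac)
  qed
  show "\<forall>\<^sub>F n in sequentially. real n * hit_prob (level y n) \<le> real n * prime_tail (level y n) / ln 2"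
    using ev
  proof eventually_elim
    case (elim n)
    hence "real n * hit_prob (level y n) \<le> real n * (prime_tail (level y n) / ln 2)"
      by (intro mult_left_mono hit_prob_bounds) auto
    thus ?case by simp
  qed
  have "(\<lambda>n. 3 / level y n) \<longlonglongrightarrow> 0"
    by (rule real_tendsto_divide_at_top[OF tendsto_const level_at_top[OF y]])
  hence "(\<lambda>n. (1 - 3 / level y n) * (real n * prime_tail (level y n)) / ln 2) \<longlonglongrightarrow> (1 - 0) * (ln 2 / y) / ln 2"
    by (intro tendsto_intros level_prime_tail y) auto
  thus "(\<lambda>n. (1 - 3 / level y n) * (real n * prime_tail (level y n)) / ln 2) \<longlonglongrightarrow> 1 / y" by simp
  have "(\<lambda>n. real n * prime_tail (level y n) / ln 2) \<longlonglongrightarrow> (ln 2 / y) / ln 2"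
    by (intro tendsto_intros level_prime_tail y) auto
  thus "(\<lambda>n. real n * prime_tail (level y n) / ln 2) \<longlonglongrightarrow> 1 / y" by simp
qed

text \<open>Both error terms of \<open>no_hit_rate\<close> vanish: up to constants they are \<sigma>
  and (n \<sigma>) \<sigma>, with n \<sigma> convergent. The main term sees g only through its
  integral, so the limit is the same for all densities.\<close>

lemma no_hit_limit_lip:
  assumes y: "y > 0" and g: "unit_fun K g" and L: "lip01 L g" "L \<ge> 0"
  shows "(\<lambda>n. \<integral>x. of_bool (no_hit (large_primes (level y n)) n x) * g x \<partial>gauss_meas)
           \<longlonglongrightarrow> exp (- 1 / y) * (\<integral>x. g x \<partial>gauss_meas)"
proof -
  define \<sigma> where "\<sigma> = (\<lambda>n. prime_tail (level y n))"
  have ns: "(\<lambda>n. real n * \<sigma> n) \<longlonglongrightarrow> ln 2 / y" unfolding \<sigma>_def by (rule level_prime_tail[OF y])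
  have "(\<lambda>n. (real n * \<sigma> n) * (1 / real n)) \<longlonglongrightarrow> ln 2 / y * 0"
    by (intro tendsto_mult ns lim_1_over_n)
  hence "(\<lambda>n. (real n * \<sigma> n) * (1 / real n)) \<longlonglongrightarrow> 0" by simp
  hence s0: "\<sigma> \<longlonglongrightarrow> 0"
  proof (rule Lim_transform_eventually)
    show "\<forall>\<^sub>F n in sequentially. (real n * \<sigma> n) * (1 / real n) = \<sigma> n"
      using eventually_gt_at_top[of 0] by eventually_elim simp
  qed
  have ev: "\<forall>\<^sub>F n in sequentially. \<sigma> n \<le> 1 / 48"
    using order_tendstoD(2)[OF s0, of "1/48"] by (auto elim: eventually_mono)
  define I where "I = (\<lambda>n. \<integral>x. of_bool (no_hit (large_primes (level y n)) n x) * g x \<partial>gauss_meas)"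
  define J where "J = (\<lambda>n. (1 - hit_prob (level y n)) ^ n * (\<integral>x. g x \<partial>gauss_meas))"
  have "(\<lambda>n. I n - J n) \<longlonglongrightarrow> 0"
  proof (rule Lim_null_comparison)
    show "\<forall>\<^sub>F n in sequentially. norm (I n - J n) \<le> 48 * \<sigma> n * L + 192 * (real n * \<sigma> n) * \<sigma> n * K"
      using ev
    proof eventually_elim
      case (elim n)
      have "\<bar>I n - J n\<bar> \<le> 48 * \<sigma> n * L + 192 * real n * (\<sigma> n)\<^sup>2 * K"
        using no_hit_rate[OF g L, of "large_primes (level y n)" n] elim
        by (simp add: I_def J_def hit_prob_def \<sigma>_def inv_sq_sum_large_primes)
      thus ?case by (simp add: power2_eq_square mult_ac)
    qed
    have "(\<lambda>n. 48 * \<sigma> n * L + 192 * (real n * \<sigma> n) * \<sigma> n * K) \<longlonglongrightarrow> 48 * 0 * L + 192 * (ln 2 / y) * 0 * K"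
      by (intro tendsto_intros s0 ns)
    thus "(\<lambda>n. 48 * \<sigma> n * L + 192 * (real n * \<sigma> n) * \<sigma> n * K) \<longlonglongrightarrow> 0" by simp
  qed
  moreover have "J \<longlonglongrightarrow> exp (- (1 / y)) * (\<integral>x. g x \<partial>gauss_meas)"
    unfolding J_def by (intro tendsto_mult tendsto_const one_minus_pow_tendsto hit_prob_nonneg level_hit_prob y)
  ultimately have "(\<lambda>n. (I n - J n) + J n) \<longlonglongrightarrow> 0 + exp (- (1 / y)) * (\<integral>x. g x \<partial>gauss_meas)"
    by (rule tendsto_add)
  thus ?thesis by (simp add: I_def)
qed

section \<open>From Lipschitz densities to integrable ones\<close>

lemma tendsto_from_L1_approx:
  fixes f :: "real \<Rightarrow> real" and A :: "nat \<Rightarrow> real \<Rightarrow> bool"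
  assumes [measurable]: "\<And>n. Measurable.pred borel (A n)"
    and c: "0 \<le> c" "c \<le> 1" and f: "integrable gauss_meas f" and h: "\<And>i. integrable gauss_meas (h i)"
    and lim: "\<And>i. (\<lambda>n. \<integral>x. of_bool (A n x) * h i x \<partial>gauss_meas) \<longlonglongrightarrow> c * (\<integral>x. h i x \<partial>gauss_meas)"
    and approx: "(\<lambda>i. \<integral>x. \<bar>f x - h i x\<bar> \<partial>gauss_meas) \<longlonglongrightarrow> (0::real)"
  shows "(\<lambda>n. \<integral>x. of_bool (A n x) * f x \<partial>gauss_meas) \<longlonglongrightarrow> c * (\<integral>x. f x \<partial>gauss_meas)"
proof (rule LIMSEQ_I)
  fix r :: real assume r: "r > 0"
  have int_A: "integrable gauss_meas (\<lambda>x. of_bool (A n x) * g x)" if "integrable gauss_meas g" for n and g :: "real \<Rightarrow> real"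
    by (rule Bochner_Integration.integrable_bound[OF that]) (use that in auto)
  define d where "d = (\<lambda>i. \<integral>x. \<bar>f x - h i x\<bar> \<partial>gauss_meas)"
  have intd: "integrable gauss_meas (\<lambda>x. \<bar>f x - h i x\<bar>)" for i using f h by simp
  obtain i where i: "d i < r / 4"
    using order_tendstoD(2)[OF approx, of "r/4"] r unfolding d_def eventually_sequentially by auto
  have d0: "0 \<le> d i" unfolding d_def by (rule Bochner_Integration.integral_nonneg) simp
  obtain N where N: "\<And>n. n \<ge> N \<Longrightarrow> \<bar>(\<integral>x. of_bool (A n x) * h i x \<partial>gauss_meas) - c * (\<integral>x. h i x \<partial>gauss_meas)\<bar> < r / 4"
    using LIMSEQ_D[OF lim[of i], of "r/4"] r by auto
  have near: "\<bar>(\<integral>x. of_bool (A n x) * f x \<partial>gauss_meas) - (\<integral>x. of_bool (A n x) * h i x \<partial>gauss_meas)\<bar> \<le> d i" for n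
  proof -
    have "(\<integral>x. of_bool (A n x) * f x \<partial>gauss_meas) - (\<integral>x. of_bool (A n x) * h i x \<partial>gauss_meas)
        = (\<integral>x. of_bool (A n x) * f x - of_bool (A n x) * h i x \<partial>gauss_meas)"
      by (rule Bochner_Integration.integral_diff[symmetric]) (intro int_A f h)+
    moreover have "\<bar>\<integral>x. of_bool (A n x) * f x - of_bool (A n x) * h i x \<partial>gauss_meas\<bar> \<le> (\<integral>x. \<bar>of_bool (A n x) * f x - of_bool (A n x) * h i x\<bar> \<partial>gauss_meas)"
      by (rule integral_abs_bound)
    moreover have "(\<integral>x. \<bar>of_bool (A n x) * f x - of_bool (A n x) * h i x\<bar> \<partial>gauss_meas) \<le> d i"
      unfolding d_def using int_A[OF f, of n] int_A[OF h, of n i] intd[of i] by (intro integral_mono) auto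
    ultimately show ?thesis by linarith
  qed
  have "\<bar>(\<integral>x. h i x \<partial>gauss_meas) - (\<integral>x. f x \<partial>gauss_meas)\<bar> \<le> d i"
  proof -
    have "(\<integral>x. f x \<partial>gauss_meas) - (\<integral>x. h i x \<partial>gauss_meas) = (\<integral>x. f x - h i x \<partial>gauss_meas)"
      by (rule Bochner_Integration.integral_diff[symmetric]) (intro f h)+
    moreover have "\<bar>\<integral>x. f x - h i x \<partial>gauss_meas\<bar> \<le> d i" unfolding d_def by (rule integral_abs_bound)
    ultimately show ?thesis by linarith
  qed
  hence "c * \<bar>(\<integral>x. h i x \<partial>gauss_meas) - (\<integral>x. f x \<partial>gauss_meas)\<bar> \<le> 1 * d i"
    using c by (intro mult_mono) auto
  hence far: "\<bar>c * (\<integral>x. h i x \<partial>gauss_meas) - c * (\<integral>x. f x \<partial>gauss_meas)\<bar> \<le> d i"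
    using c(1) by (simp add: abs_mult flip: right_diff_distrib)
  have "\<bar>(\<integral>x. of_bool (A n x) * f x \<partial>gauss_meas) - c * (\<integral>x. f x \<partial>gauss_meas)\<bar> < r" if "n \<ge> N" for n
    using near[of n] far N[OF that] i r by linarith
  thus "\<exists>N. \<forall>n\<ge>N. norm ((\<integral>x. of_bool (A n x) * f x \<partial>gauss_meas) - c * (\<integral>x. f x \<partial>gauss_meas)) < r"
    by auto
qed

text \<open>The functions for which the limit holds are closed under linear combinations and L^1
  limits. Lipschitz ramps give the indicators of half-lines, a Dynkin argument those of Borel sets,
  and simple functions all integrable f.\<close>

lemma tendsto_from_lipschitz:
  fixes f :: "real \<Rightarrow> real" and A :: "nat \<Rightarrow> real \<Rightarrow> bool"
  assumes A [measurable]: "\<And>n. Measurable.pred borel (A n)"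
    and c: "0 \<le> c" "c \<le> 1" 
    and lip: "\<And>g K L. unit_fun K g \<Longrightarrow> lip01 L g \<Longrightarrow> L \<ge> 0 \<Longrightarrow>
       (\<lambda>n. \<integral>x. of_bool (A n x) * g x \<partial>gauss_meas) \<longlonglongrightarrow> c * (\<integral>x. g x \<partial>gauss_meas)"
    and f: "integrable gauss_meas f"
  shows "(\<lambda>n. \<integral>x. of_bool (A n x) * f x \<partial>gauss_meas) \<longlonglongrightarrow> c * (\<integral>x. f x \<partial>gauss_meas)"
proof -
  define good where "good = (\<lambda>g :: real \<Rightarrow> real. (\<lambda>n. \<integral>x. of_bool (A n x) * g x \<partial>gauss_meas) \<longlonglongrightarrow> c * (\<integral>x. g x \<partial>gauss_meas))"
  have goodI: "good f" if "integrable gauss_meas f" "\<And>i. integrable gauss_meas (h i)" "\<And>i. good (h i)" 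
    "(\<lambda>i. \<integral>x. \<bar>f x - h i x\<bar> \<partial>gauss_meas) \<longlonglongrightarrow> 0" for f h
    unfolding good_def by (rule tendsto_from_L1_approx[OF A c that(1,2) _ that(4)]) (use that(3) in \<open>auto simp: good_def\<close>)
  have int_A: "integrable gauss_meas (\<lambda>x. of_bool (A n x) * g x)" if "integrable gauss_meas g" for n and g :: "real \<Rightarrow> real"
    by (rule Bochner_Integration.integrable_bound[OF that]) (use that in auto)
  have good_add: "good (\<lambda>x. g x + h x)" if "good g" "good h" "integrable gauss_meas g" "integrable gauss_meas h" for g h
  proof -
    have e1: "(\<integral>x. of_bool (A n x) * (g x + h x) \<partial>gauss_meas) = (\<integral>x. of_bool (A n x) * g x \<partial>gauss_meas) + (\<integral>x. of_bool (A n x) * h x \<partial>gauss_meas)" for n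
      unfolding distrib_left by (rule Bochner_Integration.integral_add) (intro int_A that)+
    have e2: "(\<integral>x. g x + h x \<partial>gauss_meas) = (\<integral>x. g x \<partial>gauss_meas) + (\<integral>x. h x \<partial>gauss_meas)"
      by (rule Bochner_Integration.integral_add) (intro that)+
    show ?thesis unfolding good_def e1 e2 distrib_left[of c] using that(1,2) unfolding good_def by (rule tendsto_add)
  qed
  have good_scale: "good (\<lambda>x. a * g x)" if "good g" for a g
  proof -
    have e: "(\<integral>x. of_bool (A n x) * (a * g x) \<partial>gauss_meas) = a * (\<integral>x. of_bool (A n x) * g x \<partial>gauss_meas)" for n
      by (subst Bochner_Integration.integral_mult_right_zero[symmetric]) (simp add: mult_ac)
    have "(\<lambda>n. a * (\<integral>x. of_bool (A n x) * g x \<partial>gauss_meas)) \<longlonglongrightarrow> a * (c * (\<integral>x. g x \<partial>gauss_meas))"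
      using that unfolding good_def by (rule tendsto_mult_left)
    thus ?thesis unfolding good_def e by (simp add: mult_ac)
  qed
  have int_ind: "integrable gauss_meas (\<lambda>x. indicator D x :: real)" if "D \<in> sets borel" for D
    using that by (intro integrable_real_indicator) (auto simp: less_top[symmetric])
  have good_dom: "good f" if "integrable gauss_meas f" "integrable gauss_meas w" "\<And>i. integrable gauss_meas (h i)" "\<And>i. good (h i)" 
    "\<And>x. (\<lambda>i. h i x) \<longlonglongrightarrow> f x" "\<And>i x. \<bar>h i x\<bar> \<le> w x" for f w h
  proof (rule goodI[OF that(1,3,4)])
    have "(\<lambda>i. \<integral>x. \<bar>f x - h i x\<bar> \<partial>gauss_meas) \<longlonglongrightarrow> (\<integral>x. 0 \<partial>gauss_meas)"
    proof (rule integral_dominated_convergence[where w = "\<lambda>x. \<bar>f x\<bar> + w x"])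
      show "AE x in gauss_meas. (\<lambda>i. \<bar>f x - h i x\<bar>) \<longlonglongrightarrow> 0"
      proof (rule AE_I2)
        fix x
        have "(\<lambda>i. f x - h i x) \<longlonglongrightarrow> f x - f x" by (intro tendsto_intros that(5))
        thus "(\<lambda>i. \<bar>f x - h i x\<bar>) \<longlonglongrightarrow> 0" by (intro tendsto_rabs_zero) simp
      qed
      show "AE x in gauss_meas. norm \<bar>f x - h i x\<bar> \<le> \<bar>f x\<bar> + w x" for i
      proof (rule AE_I2)
        fix x
        show "norm \<bar>f x - h i x\<bar> \<le> \<bar>f x\<bar> + w x" using that(6)[of i x] by simp
      qed
    qed (use that(1,2,3) in auto)
    thus "(\<lambda>i. \<integral>x. \<bar>f x - h i x\<bar> \<partial>gauss_meas) \<longlonglongrightarrow> 0" by simp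
  qed
  have good_one: "good (\<lambda>_. 1)"
    unfolding good_def by (rule lip[of 1 _ 0]) (auto simp: unit_fun_def lip01_def)
  have good_atMost: "good (indicator {..a})" for a
  proof (rule good_dom[where w = "\<lambda>_. 1"])
    \<comment> \<open>A ramp equal to 1 up to a and to 0 from a + 1 / (i + 1) on, with slope of size
      i + 1 in between.\<close>
    define h where "h = (\<lambda>(i::nat) x. max 0 (min 1 (1 + (real i + 1) * (a - x))))"
    have u: "unit_fun 1 (h i)" for i unfolding unit_fun_def h_def by auto
    have l: "lip01 (real i + 1) (h i)" for i
      unfolding lip01_def
    proof safe
      fix x y :: real
      have "\<bar>h i x - h i y\<bar> \<le> \<bar>(1 + (real i + 1) * (a - x)) - (1 + (real i + 1) * (a - y))\<bar>"
        unfolding h_def by (auto simp: max_def min_def)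
      also have "(1 + (real i + 1) * (a - x)) - (1 + (real i + 1) * (a - y)) = (real i + 1) * (y - x)"
        by (simp add: algebra_simps)
      finally show "\<bar>h i x - h i y\<bar> \<le> (real i + 1) * \<bar>x - y\<bar>" by (simp add: abs_mult abs_minus_commute)
    qed
    show "good (h i)" for i unfolding good_def by (rule lip[OF u l]) simp
    show "integrable gauss_meas (h i)" for i by (rule gauss_integrable[OF unit_funD(1)[OF u] unit_funD(3)[OF u]])
    show "\<bar>h i x\<bar> \<le> 1" for i x by (simp add: h_def)
    show "(\<lambda>i. h i x) \<longlonglongrightarrow> indicator {..a} x" for x
    proof (cases "x \<le> a")
      case True
      hence "h i x = 1" for i by (simp add: h_def)
      thus ?thesis using True by simp
    next
      case False
      have "filterlim (\<lambda>i. (real i + 1) * (x - a)) at_top sequentially"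
        using False by real_asymp
      hence "\<forall>\<^sub>F i in sequentially. (real i + 1) * (x - a) > 1" by (simp add: filterlim_at_top_dense)
      hence "\<forall>\<^sub>F i in sequentially. h i x = 0"
        by eventually_elim (simp add: h_def algebra_simps)
      thus ?thesis using False by (simp add: tendsto_eventually)
    qed
  qed (auto intro: int_ind)
  have good_ind: "good (indicator D)" if "D \<in> sets borel" for D
  proof -
    have "Int_stable (range (\<lambda>a::real. {..a}))"
      by (auto simp: Int_stable_def Int_atMost)
    moreover have "range (\<lambda>a::real. {..a}) \<subseteq> Pow UNIV" by simp
    moreover have "D \<in> sigma_sets UNIV (range (\<lambda>a::real. {..a}))"
      using that by (simp add: borel_eq_atMost)
    ultimately show ?thesis
    proof (induction rule: sigma_sets_induct_disjoint)
      case (basic D)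
      thus ?case using good_atMost by auto
    next
      case empty
      show ?case using good_scale[OF good_one, of 0] by (simp add: indicator_def)
    next
      case (compl D)
      hence D: "D \<in> sets borel" by (simp add: borel_eq_atMost)
      have "good (\<lambda>x. 1 + (-1) * indicator D x)"
        by (intro good_add good_one good_scale compl integrable_mult_right int_ind D) simp
      also have "(\<lambda>x. 1 + (-1) * indicator D x) = (indicator (UNIV - D) :: real \<Rightarrow> real)"
        by (auto simp: fun_eq_iff split: split_indicator)
      finally show ?case .
    next
      case (union D)
      hence D: "D i \<in> sets borel" for i by (auto simp: borel_eq_atMost)
      have g: "good (\<lambda>x. \<Sum>j<i. indicator (D j) x)" for i
      proof (induction i)
        case 0
        show ?case using good_scale[OF good_one, of 0] by simp
      next
        case (Suc i)
        thus ?case using union(3)[of i] D by (auto intro!: good_add int_ind)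
      qed
      show ?case
      proof (rule good_dom[where w = "\<lambda>_. 1", OF _ _ _ g])
        show "(\<lambda>i. \<Sum>j<i. indicator (D j) x) \<longlonglongrightarrow> (indicator (\<Union>i. D i) x :: real)" for x
          using indicator_sums[of D x] union(1) unfolding sums_def by (auto simp: disjoint_family_on_def)
        show "\<bar>\<Sum>j<i. indicator (D j) x\<bar> \<le> (1::real)" for i x
        proof -
          have "(\<Sum>j<i. indicator (D j) x) = (indicator (\<Union>j<i. D j) x :: real)"
            using union(1) by (intro indicator_UN_disjoint[symmetric]) (auto simp: disjoint_family_on_def)
          thus ?thesis by (simp add: indicator_def)
        qed
      qed (use D in \<open>auto intro!: int_ind\<close>)
    qed
  qed
  have "good f"
    using f
  proof (induction rule: integrable_induct)
    case (base D a)
    have "good (\<lambda>x. a * indicator D x)" using base by (intro good_scale good_ind) simp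
    thus ?case by (simp add: mult.commute)
  next
    case (add g h)
    thus ?case by (intro good_add)
  next
    case (lim g s)
    show ?case
    proof (rule good_dom[where w = "\<lambda>x. 2 * \<bar>g x\<bar>" and h = s])
      show "integrable gauss_meas (\<lambda>x. 2 * \<bar>g x\<bar>)" using \<open>integrable gauss_meas g\<close> by simp
    qed (use lim in auto)
  qed
  thus ?thesis by (simp add: good_def)
qed

text \<open>On (0, 1] Lebesgue and Gauss measure have the same null sets, so P has a density with
  respect to the Gauss measure. This density is merely integrable, which is why the limit was
  extended to L^1.\<close>

lemma prob_no_hit_limit:
  assumes y: "y > 0" and P: "prob_space P" "sets P = sets lambda_I" "absolutely_continuous lambda_I P"
  shows "(\<lambda>n. measure P {x \<in> space P. no_hit (large_primes (level y n)) n x}) \<longlonglongrightarrow> exp (- 1 / y)"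
proof -
  interpret P: prob_space P by fact
  have id: "(\<lambda>x. x) \<in> measurable P borel"
    using measurable_restrict_space1[OF measurable_ident_sets[of lborel borel], of unit_I]
    by (simp add: lambda_I_def P(2) cong: measurable_cong_sets)
  have sp: "space P = unit_I"
    using sets_eq_imp_space_eq[OF P(2)] by (simp add: lambda_I_def space_restrict_space)
  \<comment> \<open>P lives on the trace of the Borel sets on (0, 1]; its image on the whole line
    has the same measurable sets as \<open>gauss_meas\<close>, as Radon-Nikodym requires.\<close>
  define P' where "P' = distr P borel (\<lambda>x. x)"
  have P': "prob_space P'" unfolding P'_def by (rule P.prob_space_distr[OF id])
  have setsP': "sets P' = sets gauss_meas" by (simp add: P'_def)
  have unit_I: "unit_I \<in> sets lborel" by (simp add: unit_I_def)
  have ac: "absolutely_continuous gauss_meas P'"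
    unfolding absolutely_continuous_def
  proof
    fix N assume "N \<in> null_sets gauss_meas"
    hence N: "N \<in> sets borel" "AE x in lborel. x \<in> N \<longrightarrow> ennreal (indicator {0<..<1} x / ((1 + x) * ln 2)) = 0"
      unfolding gauss_meas_def by (auto simp: null_sets_density_iff)
    \<comment> \<open>The Gauss density vanishes at 1, which belongs to \<open>unit_I\<close>; this
      point is discarded as a null set.\<close>
    have "AE x in lborel. x \<notin> N \<inter> unit_I"
      using N(2) AE_lborel_singleton[of 1]
    proof eventually_elim
      case (elim x)
      show ?case
      proof
        assume "x \<in> N \<inter> unit_I"
        with elim have "x \<in> {0<..<1}" "ennreal (1 / ((1 + x) * ln 2)) = 0" by (auto simp: unit_I_def)
        thus False by (auto simp: ennreal_eq_0_iff mult_le_0_iff)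
      qed
    qed
    hence "N \<inter> unit_I \<in> null_sets lborel"
      using N(1) unit_I by (subst AE_iff_null_sets) auto
    hence "N \<inter> unit_I \<in> null_sets lambda_I"
      unfolding lambda_I_def by (subst null_sets_restrict_space[OF unit_I]) auto
    hence "N \<inter> unit_I \<in> null_sets P" using P(3) by (auto simp: absolutely_continuous_def)
    hence "emeasure P' N = 0"
      using N(1) unfolding P'_def by (subst emeasure_distr[OF id]) (auto simp: sp)
    thus "N \<in> null_sets P'" using N(1) by (auto simp: P'_def)
  qed
  obtain D where D: "D \<in> borel_measurable gauss_meas" "AE x in gauss_meas. RN_deriv gauss_meas P' x = ennreal (D x)" "\<And>x. 0 \<le> D x"
    using gauss.real_RN_deriv[OF prob_space.finite_measure[OF P'] ac setsP'] by blast
  have Dm [measurable]: "D \<in> borel_measurable borel" using D(1) by (simp cong: measurable_cong_sets)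
  have "density gauss_meas (RN_deriv gauss_meas P') = P'" by (rule gauss.density_RN_deriv[OF ac setsP'])
  moreover have "density gauss_meas (RN_deriv gauss_meas P') = density gauss_meas (\<lambda>x. ennreal (D x))"
    using D(2) by (intro density_cong) auto
  ultimately have dens: "P' = density gauss_meas (\<lambda>x. ennreal (D x))" by simp
  interpret P': prob_space P' by fact
  have int: "(\<integral>x. f x \<partial>P') = (\<integral>x. f x * D x \<partial>gauss_meas)" if "f \<in> borel_measurable borel" for f :: "real \<Rightarrow> real"
    unfolding dens using that D(3) by (subst integral_density) (auto simp: mult.commute)
  have intD: "integrable gauss_meas D"
  proof -
    have "integrable P' (\<lambda>_. 1 :: real)" by simp
    thus ?thesis unfolding dens using D(3) by (subst (asm) integrable_density) auto
  qed
  have "(\<integral>x. 1 \<partial>P') = (\<integral>x. D x \<partial>gauss_meas)" using int[of "\<lambda>_. 1"] by simp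
  hence D1: "(\<integral>x. D x \<partial>gauss_meas) = 1" using P'.prob_space by simp
  have "(\<lambda>n. \<integral>x. of_bool (no_hit (large_primes (level y n)) n x) * D x \<partial>gauss_meas) \<longlonglongrightarrow> exp (- 1 / y) * (\<integral>x. D x \<partial>gauss_meas)"
    by (rule tendsto_from_lipschitz[OF no_hit_measurable _ _ no_hit_limit_lip[OF y] intD]) (use y in auto)
  moreover have "(\<integral>x. of_bool (no_hit B n x) * D x \<partial>gauss_meas) = measure P {x \<in> space P. no_hit B n x}" for B n
  proof -
    have "(\<integral>x. of_bool (no_hit B n x) * D x \<partial>gauss_meas) = (\<integral>x. of_bool (no_hit B n x) \<partial>P')"
      by (rule int[symmetric]) simp
    also have "\<dots> = (\<integral>x. of_bool (no_hit B n x) \<partial>P)"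
      unfolding P'_def by (rule integral_distr[OF id]) simp
    also have "\<dots> = (\<integral>x. indicator {x \<in> space P. no_hit B n x} x \<partial>P)"
      by (rule Bochner_Integration.integral_cong) auto
    also have "\<dots> = measure P ({x \<in> space P. no_hit B n x} \<inter> space P)" by simp
    also have "{x \<in> space P. no_hit B n x} \<inter> space P = {x \<in> space P. no_hit B n x}" by auto
    finally show ?thesis .
  qed
  ultimately show ?thesis by (simp add: D1)
qed

section \<open>The maximum of the prime digits\<close>

lemma max_prime_digit_le_iff:
  assumes "n \<ge> 1"
  shows "max_prime_digit n x \<le> m \<longleftrightarrow> (\<forall>k\<in>{1..n}. cf_digit_prime k x \<le> m)"
proof -
  have "{cf_digit_prime k x | k. 1 \<le> k \<and> k \<le> n} = (\<lambda>k. cf_digit_prime k x) ` {1..n}" by auto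
  thus ?thesis using assms by (simp add: max_prime_digit_def Max_le_iff)
qed

text \<open>Digits that are not prime were replaced by 0, which never exceeds a level L \<ge> 0;
  only primes above L can violate the bound.\<close>

lemma max_prime_digit_le_level:
  assumes "n \<ge> 1" "L \<ge> 0"
  shows "real (max_prime_digit n x) \<le> L \<longleftrightarrow> no_hit (large_primes L) n x"
proof -
  have fl: "real m \<le> L \<longleftrightarrow> m \<le> nat \<lfloor>L\<rfloor>" for m
    using assms(2) by (simp add: le_nat_iff le_floor_iff)
  have "real (max_prime_digit n x) \<le> L \<longleftrightarrow> (\<forall>k\<in>{1..n}. real (cf_digit_prime k x) \<le> L)"
    unfolding fl by (rule max_prime_digit_le_iff[OF assms(1)])
  also have "\<dots> \<longleftrightarrow> no_hit (large_primes L) n x"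
    using assms(2) by (auto simp: no_hit_def large_primes_def cf_digit_prime_def not_less)
  finally show ?thesis .
qed

lemma max_prime_digit_measurable [measurable]: "max_prime_digit n \<in> measurable borel (count_space UNIV)"
proof (cases "n \<ge> 1")
  case True
  have "(\<lambda>x. real (max_prime_digit n x)) \<in> borel_measurable borel"
  proof (rule borel_measurable_iff_le[THEN iffD2], rule allI)
    fix a
    show "{x \<in> space borel. real (max_prime_digit n x) \<le> a} \<in> sets borel"
    proof (cases "a \<ge> 0")
      case True
      thus ?thesis using max_prime_digit_le_level[OF \<open>n \<ge> 1\<close> True] by simp
    next
      case False
      hence "{x \<in> space borel. real (max_prime_digit n x) \<le> a} = {}" by auto
      thus ?thesis by simp
    qed
  qed
  hence "(\<lambda>x. nat \<lfloor>real (max_prime_digit n x)\<rfloor>) \<in> measurable borel (count_space UNIV)" by measurable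
  thus ?thesis by simp
next
  case False
  hence "{cf_digit_prime k x | k. 1 \<le> k \<and> k \<le> n} = {}" for x by auto
  \<comment> \<open>For n = 0 the value is \<open>Max {}\<close>, unspecified but constant in
    x.\<close>
  hence "max_prime_digit n = (\<lambda>_. Max {})" by (intro ext) (simp only: max_prime_digit_def)
  thus ?thesis by simp
qed

theorem theorem3p3:
  fixes Theta :: "real measure"
  assumes "real_distribution Theta"
    and "\<And>y. y > 0 \<Longrightarrow> cdf Theta y = exp (- 1 / y)"
    and "cdf Theta 0 = 0"
  shows "strong_dist_conv
           (\<lambda>n x. ln 2 * ln (real n) / real n * real (max_prime_digit n x)) Theta"
  unfolding strong_dist_conv_def
proof (intro allI impI, elim conjE)
  fix P assume P: "prob_space P" "sets P = sets lambda_I" "absolutely_continuous lambda_I P"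
  interpret P: prob_space P by fact
  interpret Theta: real_distribution Theta by fact
  define R where "R = (\<lambda>n x. ln 2 * ln (real n) / real n * real (max_prime_digit n x))"
  have id: "(\<lambda>x. x) \<in> measurable P borel"
    using measurable_restrict_space1[OF measurable_ident_sets[of lborel borel], of unit_I]
    by (simp add: lambda_I_def P(2) cong: measurable_cong_sets)
  have R: "R n \<in> measurable P borel" for n
    unfolding R_def by (rule measurable_compose[OF id]) measurable
  interpret D: real_distribution "distr P borel (R n)" for n
    using R by (rule P.real_distribution_distr)
  have pos: "(\<lambda>n. cdf (distr P borel (R n)) y) \<longlonglongrightarrow> exp (- 1 / y)" if y: "y > 0" for y
    using prob_no_hit_limit[OF y P]
  proof (rule Lim_transform_eventually)
    show "\<forall>\<^sub>F n in sequentially. measure P {x \<in> space P. no_hit (large_primes (level y n)) n x} = cdf (distr P borel (R n)) y"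
      using eventually_ge_at_top[of 2]
    proof eventually_elim
      case (elim n)
      \<comment> \<open>From n = 2 on, ln n is positive, so the normalised inequality can be solved
        for the maximum.\<close>
      have ln: "ln (real n) > 0" "real n > 0" using elim by auto
      have "R n x \<le> y \<longleftrightarrow> no_hit (large_primes (level y n)) n x" for x
      proof -
        have "R n x \<le> y \<longleftrightarrow> real (max_prime_digit n x) \<le> level y n"
          using ln by (simp add: R_def level_def field_simps)
        also have "\<dots> \<longleftrightarrow> no_hit (large_primes (level y n)) n x"
          using ln y elim by (intro max_prime_digit_le_level) (auto simp: level_def)
        finally show ?thesis .
      qed
      hence "R n -` {..y} \<inter> space P = {x \<in> space P. no_hit (large_primes (level y n)) n x}" by auto
      thus ?case using R[of n] by (simp add: cdf_def measure_distr)
    qed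
  qed
  \<comment> \<open>At z \<le> 0 the distribution functions are bounded by their values at any y >
    0, and the limits exp (-1/y) of these are arbitrarily small.\<close>
  have nonpos: "(\<lambda>n. cdf (distr P borel (R n)) z) \<longlonglongrightarrow> 0" if z: "z \<le> 0" for z
  proof (rule order_tendstoI)
    fix a :: real assume "a < 0"
    thus "\<forall>\<^sub>F n in sequentially. a < cdf (distr P borel (R n)) z"
      using D.cdf_nonneg by (intro always_eventually allI) (auto intro: less_le_trans)
  next
    fix e :: real assume e: "0 < e"
    have "((\<lambda>y::real. exp (- 1 / y)) \<longlongrightarrow> 0) (at_right 0)" by real_asymp
    hence "\<forall>\<^sub>F y in at_right 0. exp (- 1 / y) < e" using e by (rule order_tendstoD)
    moreover have "\<forall>\<^sub>F y::real in at_right 0. y > 0" by (rule eventually_at_right_less)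
    ultimately have "\<exists>y>0. exp (- 1 / y) < e"
      using eventually_happens[OF eventually_conj] trivial_limit_at_right_real by blast
    then obtain y :: real where y: "y > 0" "exp (- 1 / y) < e" by blast
    have "\<forall>\<^sub>F n in sequentially. cdf (distr P borel (R n)) y < e"
      by (rule order_tendstoD(2)[OF pos[OF y(1)] y(2)])
    thus "\<forall>\<^sub>F n in sequentially. cdf (distr P borel (R n)) z < e"
      by eventually_elim (use D.cdf_nondecreasing y(1) z in \<open>meson le_less_trans less_imp_le order_trans\<close>)
  qed
  \<comment> \<open>Convergence holds at every point, in particular at the continuity points of the
    limit.\<close>
  have "(\<lambda>n. cdf (distr P borel (R n)) z) \<longlonglongrightarrow> cdf Theta z" for z
  proof (cases "z > 0")
    case True
    thus ?thesis using pos[OF True] assms(2)[OF True] by simp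
  next
    case False
    hence "cdf Theta z \<le> cdf Theta 0" by (intro Theta.cdf_nondecreasing) simp
    hence "cdf Theta z = 0" using assms(3) Theta.cdf_nonneg[of z] by linarith
    thus ?thesis using nonpos[of z] False by simp
  qed
  thus "weak_conv_m (\<lambda>n. distr P borel (\<lambda>x. ln 2 * ln (real n) / real n * real (max_prime_digit n x))) Theta"
    unfolding weak_conv_m_def weak_conv_def R_def by blast
qed

end
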